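(* Let $\mathbb G=\mathbb W\mathbb V$ be a splitting of a Carnot group by homogeneous complementary subgroups with $\mathbb V\ne\{0\}$ horizontal. Let $A\subset\mathbb W$ and let $\phi:A\to\mathbb V$ be intrinsic Lipschitz. Then there exists a sequence $(\phi_i)_{i\in\mathbb N}$ of $C^\infty$-regular and intrinsic Lipschitz maps $\phi_i:\mathbb W\to\mathbb V$ such that $$\phi_i\to\phi\quad\text{uniformly in }A\text{ as }i\to\infty .$$ Moreover, the intrinsic Lipschitz constant of $\phi_i$ is bounded, uniformly in $i$, in terms of the intrinsic Lipschitz constant of $\phi$ (that is, by $u(\ell)$ whenever the constant of $\phi$ is at most $\ell$, for a function $u:[0,\infty)\to[0,\infty)$ depending only on $\mathbb G,\mathbb W,\mathbb V,d$).
   Context: A Carnot group $\mathbb G$ is a connected, simply connected nilpotent Lie group whose Lie algebra is stratified: $\mathfrak g=\mathfrak g_1\oplus\dots\oplus\mathfrak g_s$, $\mathfrak g_{j+1}=[\mathfrak g_j,\mathfrak g_1]$, $\mathfrak g_s\ne\{0\}$, $[\mathfrak g_s,\mathfrak g]=\{0\}$. Dilations $\delta_\lambda$, $\lambda>0$, are the group automorphisms induced via $\exp$ by $X\mapsto\lambda^jX$ on $\mathfrak g_j$. $d$ is a fixed left-invariant distance on $\mathbb G$ inducing the manifold topology with $d(\delta_\lambda x,\delta_\lambda y)=\lambda d(x,y)$; $\|x\|_{\mathbb G}:=d(0,x)$. Homogeneous complementary subgroups: Lie subgroups $\mathbb W,\mathbb V$ invariant under dilations with $\mathbb W\cap\mathbb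 V=\{0\}$ and $\mathbb G=\mathbb W\mathbb V$; every $x\in\mathbb G$ is uniquely $x=x_{\mathbb W}x_{\mathbb V}$. $\mathbb V$ is horizontal if $\mathbb V\subset\exp(\mathfrak g_1)$; then $\mathbb V$ is Abelian and is identified with $\mathbb R^k$, $k=\dim\mathbb V$, through $(v_1,\dots,v_k)\leftrightarrow\exp(v_1X_1+\dots+v_kX_k)$ for a fixed basis $X_1,\dots,X_k$ of its Lie algebra. For $A\subset\mathbb W$ and $\phi:A\to\mathbb V$, $\mathrm{gr}_\phi:=\{w\phi(w):w\in A\}$. With $\mathscr C_\alpha:=\{x\in\mathbb G:\|x_{\mathbb W}\|_{\mathbb G}\le\alpha\|x_{\mathbb V}\|_{\mathbb G}\}$, $\phi$ is intrinsic Lipschitz if there is $\alpha>0$ with $\mathrm{gr}_\phi\cap x\mathscr C_\alpha=\{x\}$ for every $x\in\mathrm{gr}_\phi$; its intrinsic Lipschitz constant is the infimum of $1/\alpha$ over all such $\alpha>0$. *)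

theory Defs
  imports "HOL-Analysis.Analysis"
begin

section \<open>Smooth maps and smooth manifolds\<close>

primrec Ck_on :: "nat \<Rightarrow> 'a::euclidean_space set \<Rightarrow> ('a \<Rightarrow> 'b::euclidean_space) \<Rightarrow> bool" where
  "Ck_on 0 S f \<longleftrightarrow> continuous_on S f"
| "Ck_on (Suc k) S f \<longleftrightarrow>
     (\<forall>x\<in>S. f differentiable (at x)) \<and>
     (\<forall>v. Ck_on k S (\<lambda>x. frechet_derivative f (at x) v))"

text \<open>Only used for open \<open>S\<close>.\<close>

definition smooth_on :: "'a::euclidean_space set \<Rightarrow> ('a \<Rightarrow> 'b::euclidean_space) \<Rightarrow> bool" where
  "smooth_on S f \<longleftrightarrow> (\<forall>k. Ck_on k S f)"

text \<open>A chart is a pair of an open domain and a coordinate map, of which only the values on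
  the domain matter. The dimension of the manifold is that of the model space \<open>'a\<close>.\<close>

type_synonym ('m, 'a) chart = "'m set \<times> ('m \<Rightarrow> 'a)"

definition is_chart :: "('m::topological_space, 'a::euclidean_space) chart \<Rightarrow> bool" where
  "is_chart c \<longleftrightarrow> (case c of (U, \<kappa>) \<Rightarrow>
     open U \<and> open (\<kappa> ` U) \<and> homeomorphism U (\<kappa> ` U) \<kappa> (inv_into U \<kappa>))"

definition compatible ::
  "('m, 'a::euclidean_space) chart \<Rightarrow> ('m, 'a) chart \<Rightarrow> bool" where
  "compatible c c' \<longleftrightarrow> (case (c, c') of ((U, \<kappa>), (U', \<kappa>')) \<Rightarrow>
     smooth_on (\<kappa> ` (U \<inter> U')) (\<kappa>' \<circ> inv_into U \<kappa>) \<and>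
     smooth_on (\<kappa>' ` (U \<inter> U')) (\<kappa> \<circ> inv_into U' \<kappa>'))"

definition smooth_atlas ::
  "('m::{t2_space, second_countable_topology}, 'a::euclidean_space) chart set \<Rightarrow> bool" where
  "smooth_atlas \<A> \<longleftrightarrow> (\<forall>c\<in>\<A>. is_chart c) \<and> (\<Union>c\<in>\<A>. fst c) = UNIV \<and>
     (\<forall>c\<in>\<A>. \<forall>c'\<in>\<A>. compatible c c')"

definition maximal_atlas ::
  "('m::topological_space, 'a::euclidean_space) chart set \<Rightarrow> ('m, 'a) chart set" where
  "maximal_atlas \<A> = {c. is_chart c \<and> (\<forall>c'\<in>\<A>. compatible c c')}"

definition prod_atlas ::
  "('m, 'a) chart set \<Rightarrow> ('n, 'b) chart set \<Rightarrow> ('m \<times> 'n, 'a \<times> 'b) chart set" where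
  "prod_atlas \<A> \<B> = {(U \<times> U', map_prod \<kappa> \<kappa>') | U \<kappa> U' \<kappa>'. (U, \<kappa>) \<in> \<A> \<and> (U', \<kappa>') \<in> \<B>}"

abbreviation euclidean_atlas :: "('a, 'a) chart set" where
  "euclidean_atlas \<equiv> {(UNIV, \<lambda>x. x)}"

text \<open>Smoothness of \<open>f\<close> on an open subset \<open>S\<close> of a manifold.\<close>

definition smooth_map_on ::
  "('m::topological_space, 'a::euclidean_space) chart set \<Rightarrow>
   ('n::topological_space, 'b::euclidean_space) chart set \<Rightarrow> 'm set \<Rightarrow> ('m \<Rightarrow> 'n) \<Rightarrow> bool" where
  "smooth_map_on \<A> \<B> S f \<longleftrightarrow> continuous_on S f \<and>
     (\<forall>(U, \<kappa>)\<in>\<A>. \<forall>(U', \<kappa>')\<in>\<B>.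
        smooth_on (\<kappa> ` (S \<inter> U \<inter> f -` U')) (\<kappa>' \<circ> f \<circ> inv_into U \<kappa>))"

definition embedded_submanifold ::
  "('m::topological_space, 'a::euclidean_space) chart set \<Rightarrow> 'm set \<Rightarrow> bool" where
  "embedded_submanifold \<A> H \<longleftrightarrow>
     (\<forall>p\<in>H. \<exists>(U, \<kappa>)\<in>maximal_atlas \<A>. \<exists>S. p \<in> U \<and> affine S \<and> \<kappa> ` (U \<inter> H) = \<kappa> ` U \<inter> S)"

text \<open>For an embedded submanifold \<open>H\<close>, a map on \<open>H\<close> is smooth with respect to
  the manifold structure of \<open>H\<close> iff it locally extends to smooth maps on open subsets of the
  ambient manifold. If it takes values in an embedded submanifold, smoothness into that
  submanifold and into the ambient manifold are the same.\<close>

definition smooth_map_on_submanifold ::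
  "('m::topological_space, 'a::euclidean_space) chart set \<Rightarrow>
   ('n::topological_space, 'b::euclidean_space) chart set \<Rightarrow> 'm set \<Rightarrow> ('m \<Rightarrow> 'n) \<Rightarrow> bool" where
  "smooth_map_on_submanifold \<A> \<B> H f \<longleftrightarrow>
     (\<forall>p\<in>H. \<exists>U F. open U \<and> p \<in> U \<and> smooth_map_on \<A> \<B> U F \<and> (\<forall>x\<in>U \<inter> H. F x = f x))"

section \<open>Lie groups\<close>

text \<open>Groups are written additively, as instances of the (not necessarily commutative) class
  \<open>group_add\<close>; the identity element is \<open>0\<close>.\<close>

definition is_subgroup :: "'g::group_add set \<Rightarrow> bool" where
  "is_subgroup H \<longleftrightarrow> 0 \<in> H \<and> (\<forall>x\<in>H. \<forall>y\<in>H. x + y \<in> H) \<and> (\<forall>x\<in>H. - x \<in> H)"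

primrec lower_central :: "nat \<Rightarrow> 'g::group_add set" where
  "lower_central 0 = UNIV"
| "lower_central (Suc n) = is_subgroup hull {x + y - x - y | x y. x \<in> lower_central n}"

definition nilpotent_group :: "'g::group_add itself \<Rightarrow> bool" where
  "nilpotent_group _ \<longleftrightarrow> (\<exists>n. lower_central n = ({0} :: 'g set))"

definition lie_group ::
  "('g::{group_add, t2_space, second_countable_topology}, 'a::euclidean_space) chart set \<Rightarrow> bool" where
  "lie_group \<A> \<longleftrightarrow> smooth_atlas \<A> \<and>
     smooth_map_on (prod_atlas \<A> \<A>) \<A> UNIV (\<lambda>(x, y). x + y) \<and>
     smooth_map_on \<A> \<A> UNIV uminus"

definition lie_automorphism ::
  "('g::{group_add, t2_space, second_countable_topology}, 'a::euclidean_space) chart set \<Rightarrow>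
   ('g \<Rightarrow> 'g) \<Rightarrow> bool" where
  "lie_automorphism \<A> f \<longleftrightarrow> bij f \<and> (\<forall>x y. f (x + y) = f x + f y) \<and>
     smooth_map_on \<A> \<A> UNIV f \<and> smooth_map_on \<A> \<A> UNIV (inv f)"

definition lie_subgroup ::
  "('g::{group_add, t2_space, second_countable_topology}, 'a::euclidean_space) chart set \<Rightarrow>
   'g set \<Rightarrow> bool" where
  "lie_subgroup \<A> H \<longleftrightarrow> is_subgroup H \<and> embedded_submanifold \<A> H"

text \<open>The Lie algebra is the tangent space at the identity, represented by the model space \<open>'a\<close>
  through the differential at \<open>0\<close> of a chart \<open>e\<close> whose domain contains \<open>0\<close>.
  \<open>left_inv_field e X\<close> is the left-invariant vector field with value \<open>X\<close> at the identity,
  written in the coordinates \<open>e\<close>; the argument \<open>p\<close> is a coordinate vector too.\<close>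

definition left_inv_field ::
  "('g::group_add, 'a::euclidean_space) chart \<Rightarrow> 'a \<Rightarrow> 'a \<Rightarrow> 'a" where
  "left_inv_field e X p = (case e of (U, \<kappa>) \<Rightarrow>
     frechet_derivative (\<lambda>q. \<kappa> (inv_into U \<kappa> p + inv_into U \<kappa> q)) (at (\<kappa> 0)) X)"

text \<open>The commutator of two left-invariant vector fields, at the identity.\<close>

definition lie_bracket ::
  "('g::group_add, 'a::euclidean_space) chart \<Rightarrow> 'a \<Rightarrow> 'a \<Rightarrow> 'a" where
  "lie_bracket e X Y =
     frechet_derivative (left_inv_field e Y) (at (snd e 0)) X -
     frechet_derivative (left_inv_field e X) (at (snd e 0)) Y"

text \<open>\<open>is_exp \<A> e X x\<close> means \<open>x = exp X\<close>: \<open>x\<close> is the value at time 1 of the one-parameter subgroup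
  with velocity \<open>X\<close>.\<close>

definition is_exp ::
  "('g::{group_add, t2_space, second_countable_topology}, 'a::euclidean_space) chart set \<Rightarrow>
   ('g, 'a) chart \<Rightarrow> 'a \<Rightarrow> 'g \<Rightarrow> bool" where
  "is_exp \<A> e X x \<longleftrightarrow> (\<exists>\<gamma> :: real \<Rightarrow> 'g.
     smooth_map_on euclidean_atlas \<A> UNIV \<gamma> \<and> (\<forall>s t. \<gamma> (s + t) = \<gamma> s + \<gamma> t) \<and>
     ((\<lambda>t. snd e (\<gamma> t)) has_vector_derivative X) (at 0) \<and> \<gamma> 1 = x)"

section \<open>Carnot groups\<close>

text \<open>A stratification of step \<open>s\<close>, with layers \<open>g 1, \<dots>, g s\<close>.\<close>

definition stratification ::
  "('g::group_add, 'a::euclidean_space) chart \<Rightarrow> nat \<Rightarrow> (nat \<Rightarrow> 'a set) \<Rightarrow> bool" where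
  "stratification e s g \<longleftrightarrow> 1 \<le> s \<and>
     (\<forall>j\<in>{1..s}. subspace (g j)) \<and>
     (\<forall>X. \<exists>!f. f \<in> (\<Pi>\<^sub>E j\<in>{1..s}. g j) \<and> X = (\<Sum>j=1..s. f j)) \<and>
     (\<forall>j\<in>{1..<s}. g (Suc j) = span {lie_bracket e X Y | X Y. X \<in> g j \<and> Y \<in> g 1}) \<and>
     g s \<noteq> {0} \<and>
     (\<forall>X\<in>g s. \<forall>Y. lie_bracket e X Y = 0)"

text \<open>\<open>\<delta> r \<circ> exp = exp \<circ> D\<close>, where \<open>D\<close> is multiplication by \<open>r ^ j\<close> on \<open>g j\<close>. Since the group is
  connected, this determines \<open>\<delta> r\<close> for \<open>r > 0\<close>.\<close>

definition dilations ::
  "('g::{group_add, t2_space, second_countable_topology}, 'a::euclidean_space) chart set \<Rightarrow>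
   ('g, 'a) chart \<Rightarrow> nat \<Rightarrow> (nat \<Rightarrow> 'a set) \<Rightarrow> (real \<Rightarrow> 'g \<Rightarrow> 'g) \<Rightarrow> bool" where
  "dilations \<A> e s g \<delta> \<longleftrightarrow> (\<forall>r>0. lie_automorphism \<A> (\<delta> r) \<and>
     (\<exists>D. linear D \<and> (\<forall>j\<in>{1..s}. \<forall>X\<in>g j. D X = r ^ j *\<^sub>R X) \<and>
          (\<forall>X x. is_exp \<A> e X x \<longrightarrow> is_exp \<A> e (D X) (\<delta> r x))))"

definition carnot_group ::
  "('g::{group_add, t2_space, second_countable_topology}, 'a::euclidean_space) chart set \<Rightarrow>
   ('g, 'a) chart \<Rightarrow> nat \<Rightarrow> (nat \<Rightarrow> 'a set) \<Rightarrow> (real \<Rightarrow> 'g \<Rightarrow> 'g) \<Rightarrow> bool" where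
  "carnot_group \<A> e s g \<delta> \<longleftrightarrow>
     lie_group \<A> \<and> e \<in> maximal_atlas \<A> \<and> 0 \<in> fst e \<and>
     connected (UNIV :: 'g set) \<and> simply_connected (UNIV :: 'g set) \<and>
     nilpotent_group TYPE('g) \<and> stratification e s g \<and> dilations \<A> e s g \<delta>"

definition homogeneous_distance ::
  "(real \<Rightarrow> 'g \<Rightarrow> 'g) \<Rightarrow> ('g::{group_add, topological_space} \<Rightarrow> 'g \<Rightarrow> real) \<Rightarrow> bool" where
  "homogeneous_distance \<delta> d \<longleftrightarrow>
     Metric_space UNIV d \<and> Metric_space.mtopology UNIV d = euclidean \<and>
     (\<forall>z x y. d (z + x) (z + y) = d x y) \<and>
     (\<forall>r>0. \<forall>x y. d (\<delta> r x) (\<delta> r y) = r * d x y)"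

definition homogeneous_subgroup ::
  "('g::{group_add, t2_space, second_countable_topology}, 'a::euclidean_space) chart set \<Rightarrow>
   (real \<Rightarrow> 'g \<Rightarrow> 'g) \<Rightarrow> 'g set \<Rightarrow> bool" where
  "homogeneous_subgroup \<A> \<delta> H \<longleftrightarrow> lie_subgroup \<A> H \<and> (\<forall>r>0. \<delta> r ` H \<subseteq> H)"

definition complementary :: "'g::group_add set \<Rightarrow> 'g set \<Rightarrow> bool" where
  "complementary W V \<longleftrightarrow> W \<inter> V = {0} \<and> {w + v | w v. w \<in> W \<and> v \<in> V} = UNIV"

definition horizontal ::
  "('g::{group_add, t2_space, second_countable_topology}, 'a::euclidean_space) chart set \<Rightarrow>
   ('g, 'a) chart \<Rightarrow> (nat \<Rightarrow> 'a set) \<Rightarrow> 'g set \<Rightarrow> bool" where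
  "horizontal \<A> e g V \<longleftrightarrow> V \<subseteq> {x. \<exists>X\<in>g 1. is_exp \<A> e X x}"

section \<open>Intrinsic Lipschitz maps\<close>

definition proj_fst :: "'g::group_add set \<Rightarrow> 'g set \<Rightarrow> 'g \<Rightarrow> 'g" where
  "proj_fst W V x = (THE w. w \<in> W \<and> (\<exists>v\<in>V. x = w + v))"

definition proj_snd :: "'g::group_add set \<Rightarrow> 'g set \<Rightarrow> 'g \<Rightarrow> 'g" where
  "proj_snd W V x = (THE v. v \<in> V \<and> (\<exists>w\<in>W. x = w + v))"

definition intrinsic_cone ::
  "'g::group_add set \<Rightarrow> 'g set \<Rightarrow> ('g \<Rightarrow> 'g \<Rightarrow> real) \<Rightarrow> real \<Rightarrow> 'g set" where
  "intrinsic_cone W V d \<alpha> = {x. d 0 (proj_fst W V x) \<le> \<alpha> * d 0 (proj_snd W V x)}"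

definition intrinsic_graph :: "'g::group_add set \<Rightarrow> ('g \<Rightarrow> 'g) \<Rightarrow> 'g set" where
  "intrinsic_graph A \<phi> = {w + \<phi> w | w. w \<in> A}"

definition cone_condition ::
  "'g::group_add set \<Rightarrow> 'g set \<Rightarrow> ('g \<Rightarrow> 'g \<Rightarrow> real) \<Rightarrow> 'g set \<Rightarrow> ('g \<Rightarrow> 'g) \<Rightarrow> real \<Rightarrow> bool" where
  "cone_condition W V d A \<phi> \<alpha> \<longleftrightarrow> (\<forall>x\<in>intrinsic_graph A \<phi>.
     intrinsic_graph A \<phi> \<inter> (\<lambda>y. x + y) ` intrinsic_cone W V d \<alpha> = {x})"

definition intrinsic_lipschitz ::
  "'g::group_add set \<Rightarrow> 'g set \<Rightarrow> ('g \<Rightarrow> 'g \<Rightarrow> real) \<Rightarrow> 'g set \<Rightarrow> ('g \<Rightarrow> 'g) \<Rightarrow> bool" where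
  "intrinsic_lipschitz W V d A \<phi> \<longleftrightarrow> (\<exists>\<alpha>>0. cone_condition W V d A \<phi> \<alpha>)"

definition intrinsic_lipschitz_const ::
  "'g::group_add set \<Rightarrow> 'g set \<Rightarrow> ('g \<Rightarrow> 'g \<Rightarrow> real) \<Rightarrow> 'g set \<Rightarrow> ('g \<Rightarrow> 'g) \<Rightarrow> real" where
  "intrinsic_lipschitz_const W V d A \<phi> = Inf {1 / \<alpha> | \<alpha>. 0 < \<alpha> \<and> cone_condition W V d A \<phi> \<alpha>}"

end

theory Submission
  imports Defs
begin

text \<open>Since \<open>V\<close> is horizontal, \<open>\<delta>\<^sub>r\<close> acts on \<open>V\<close> linearly, whereas commutators are infinitesimal of higher
  order under dilations. Hence commutators lie in \<open>W\<close>, so \<open>W\<close> is normal and the \<open>V\<close>-component is a smooth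
  homomorphism \<open>h\<close> from the group to a vector space. A set \<open>S\<close> is an intrinsic Lipschitz graph iff
  \<open>\<bar>h (x\<inverse>y)\<bar> \<le> l \<parallel>(x\<inverse>y)\<^sub>W\<parallel>\<close> for all \<open>x, y \<in> S\<close>.

  Take a 1-separated net \<open>I\<close> of such an \<open>S\<close> and a smooth gauge \<open>N\<close> that behaves like
  \<open>max (\<epsilon> \<parallel>x\<^sub>V\<parallel>) (2 l \<parallel>x\<^sub>W\<parallel>)\<close> at large scale, and let \<open>q\<close> be, coordinate by coordinate, a smooth version of
  \<open>min {h p + N (p\<inverse>x) | p \<in> I}\<close>. Then \<open>q\<close> is Lipschitz, it is close to \<open>h\<close> on \<open>S\<close>, and its slope along \<open>V\<close> is
  small, so that \<open>h (x v) = q (x v)\<close> can be solved for \<open>v \<in> V\<close> by contraction. The solutions form a smooth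
  intrinsic Lipschitz graph at bounded distance from \<open>S\<close>. Doing this for \<open>\<delta>\<^sub>r S\<close> and applying \<open>\<delta>\<^bsub>1/r\<^esub>\<close> keeps the
  Lipschitz constant and makes the distance arbitrarily small as \<open>r \<rightarrow> \<infinity>\<close>.\<close>

section \<open>Functions of class \<open>C\<^sup>k\<close>\<close>

text \<open>One-parameter subgroups are available through the points of \<open>V\<close>, since
  horizontality makes each of them an exponential. Elsewhere the group is studied in a single chart
  at the identity, where multiplication is addition up to an arbitrarily small relative error;
  n-fold powers carry estimates from the scale of an element to a fixed scale. The map
  \<open>h\<close> comes from the bare decomposition of an element, so its continuity and smoothness
  have to be proved: it is bounded by the distance, hence differentiable at the identity, and the
  homomorphism property spreads this to every point.

  Two constants of the gauge have a precise origin. The slope along \<open>V\<close> is taken below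
  the reciprocal of the dimension, so that the vector of coordinate minima still contracts. The
  growth is twice the slope bound because half of it pays for the variation of \<open>h\<close>
  along \<open>S\<close>, while the rest leaves room for a properness estimate: only finitely many
  net points matter near a given point.\<close>

abbreviation fd :: "('a::euclidean_space \<Rightarrow> 'b::euclidean_space) \<Rightarrow> 'a \<Rightarrow> 'a \<Rightarrow> 'b" where
  "fd f x \<equiv> frechet_derivative f (at x)"

lemma fd_eqI: "(f has_derivative f') (at x) \<Longrightarrow> fd f x = f'"
  using frechet_derivative_at by fastforce

lemma fd_works: "f differentiable (at x) \<Longrightarrow> (f has_derivative fd f x) (at x)"
  by (simp add: frechet_derivative_works)

lemma Ck_on_subset: "Ck_on k S f \<Longrightarrow> T \<subseteq> S \<Longrightarrow> Ck_on k T f"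
  by (induction k arbitrary: f) (auto intro: continuous_on_subset)

text \<open>Openness of \<open>S\<close> lets equality on \<open>S\<close> determine the
  derivatives, which are taken in the full space.\<close>

lemma Ck_on_cong:
  assumes "open S" "\<And>x. x \<in> S \<Longrightarrow> f x = g x" "Ck_on k S f"
  shows "Ck_on k S g"
  using assms(2,3)
proof (induction k arbitrary: f g)
  case 0
  then show ?case by (auto cong: continuous_on_cong)
next
  case (Suc k)
  have der: "(g has_derivative fd f x) (at x)" if "x \<in> S" for x
    using has_derivative_transform_within_open[OF fd_works assms(1) that, of f g] Suc.prems that
    by auto
  then have "fd g x = fd f x" if "x \<in> S" for x
    using fd_eqI that by blast
  then have "Ck_on k S (\<lambda>x. fd g x v)" for v
    using Suc.IH[of "\<lambda>x. fd f x v" "\<lambda>x. fd g x v"] Suc.prems by simp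
  then show ?case using der by (auto simp: differentiable_def)
qed

lemma Ck_on_local:
  assumes "\<And>x. x \<in> S \<Longrightarrow> \<exists>T. open T \<and> x \<in> T \<and> Ck_on k T f"
  shows "Ck_on k S f"
  using assms
proof (induction k arbitrary: f)
  case 0
  then have "isCont f x" if "x \<in> S" for x
    using that by (fastforce simp: continuous_on_eq_continuous_at)
  then show ?case by (simp add: continuous_at_imp_continuous_on)
next
  case (Suc k)
  have "Ck_on k S (\<lambda>x. fd f x v)" for v
    by (rule Suc.IH) (use Suc.prems in fastforce)
  moreover have "f differentiable (at x)" if "x \<in> S" for x
    using Suc.prems[OF that] by auto
  ultimately show ?case by simp
qed

text \<open>Continuity appears in \<open>Ck_on\<close> only at level 0. There it follows from
  differentiability; higher levels reduce to this by induction on the derivatives.\<close>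

lemma Ck_on_SucD: "Ck_on (Suc k) S f \<Longrightarrow> Ck_on k S f"
proof (induction k arbitrary: f)
  case 0
  then show ?case
    by (auto intro!: continuous_at_imp_continuous_on differentiable_imp_continuous_within)
qed auto

lemma Ck_on_const [simp]: "Ck_on k S (\<lambda>x. c)"
  by (induction k arbitrary: c) auto

lemma Ck_on_bounded_linear:
  assumes "bounded_linear L" shows "Ck_on k S L"
proof (cases k)
  case 0
  then show ?thesis using assms by (simp add: linear_continuous_on)
next
  case (Suc m)
  have der: "(L has_derivative L) (at x)" for x using assms by (rule bounded_linear_imp_has_derivative)
  then have "fd L x = L" for x by (rule fd_eqI)
  then show ?thesis using Suc der by (auto simp: differentiable_def)
qed

lemma Ck_on_add:
  assumes "open S" "Ck_on k S f" "Ck_on k S g"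
  shows "Ck_on k S (\<lambda>x. f x + g x)"
  using assms(2,3)
proof (induction k arbitrary: f g)
  case 0
  then show ?case by (auto intro: continuous_on_add)
next
  case (Suc k)
  have der: "((\<lambda>x. f x + g x) has_derivative (\<lambda>v. fd f x v + fd g x v)) (at x)" if "x \<in> S" for x
    using Suc.prems that by (auto intro!: has_derivative_add fd_works)
  have "Ck_on k S (\<lambda>x. fd f x v + fd g x v)" for v
    using Suc by auto
  then have "Ck_on k S (\<lambda>x. fd (\<lambda>x. f x + g x) x v)" for v
    by (rule Ck_on_cong[OF assms(1), rotated]) (simp add: fd_eqI[OF der])
  then show ?case using der by (auto simp: differentiable_def)
qed

lemma Ck_on_sum:
  assumes "open S" "finite I" "\<And>i. i \<in> I \<Longrightarrow> Ck_on k S (f i)"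
  shows "Ck_on k S (\<lambda>x. \<Sum>i\<in>I. f i x)"
  using assms(2,3) by (induction I) (auto intro: Ck_on_add assms(1))

text \<open>Each term of the product rule is again \<open>B\<close>, applied to one derivative and
  one undifferentiated factor, so the induction closes after lowering the order of the
  latter.\<close>

lemma Ck_on_bilinear:
  assumes "bounded_bilinear B" "open S" "Ck_on k S f" "Ck_on k S g"
  shows "Ck_on k S (\<lambda>x. B (f x) (g x))"
  using assms(3,4)
proof (induction k arbitrary: f g)
  case 0
  then show ?case by (auto intro: bounded_bilinear.continuous_on[OF assms(1)])
next
  case (Suc k)
  have der: "((\<lambda>x. B (f x) (g x)) has_derivative (\<lambda>v. B (f x) (fd g x v) + B (fd f x v) (g x))) (at x)"
    if "x \<in> S" for x
    using Suc.prems that by (auto intro!: bounded_bilinear.FDERIV[OF assms(1)] fd_works)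
  have "Ck_on k S (\<lambda>x. B (f x) (fd g x v) + B (fd f x v) (g x))" for v
    using Suc by (intro Ck_on_add assms(2) Suc.IH) (auto intro: Ck_on_SucD)
  then have "Ck_on k S (\<lambda>x. fd (\<lambda>x. B (f x) (g x)) x v)" for v
    by (rule Ck_on_cong[OF assms(2), rotated]) (simp add: fd_eqI[OF der])
  then show ?case using der by (auto simp: differentiable_def)
qed

lemma Ck_on_linear_comp:
  assumes "bounded_linear L" "open S" "Ck_on k S f"
  shows "Ck_on k S (\<lambda>x. L (f x))"
  using assms(3)
proof (induction k arbitrary: f)
  case 0
  then show ?case by (auto intro: bounded_linear.continuous_on[OF assms(1)])
next
  case (Suc k)
  have der: "((\<lambda>x. L (f x)) has_derivative (\<lambda>v. L (fd f x v))) (at x)" if "x \<in> S" for x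
    using Suc.prems that by (auto intro!: bounded_linear.has_derivative[OF assms(1)] fd_works)
  have "Ck_on k S (\<lambda>x. fd (\<lambda>x. L (f x)) x v)" for v
    by (rule Ck_on_cong[OF assms(2) _ Suc.IH[of "\<lambda>x. fd f x v"]])
      (use Suc.prems in \<open>auto simp: fd_eqI[OF der]\<close>)
  then show ?case using der by (auto simp: differentiable_def)
qed

lemma Ck_on_Pair:
  assumes "open S" "Ck_on k S f" "Ck_on k S g"
  shows "Ck_on k S (\<lambda>x. (f x, g x))"
proof -
  have "Ck_on k S (\<lambda>x. (f x, 0) + (0, g x))"
    by (intro Ck_on_add assms Ck_on_linear_comp[where L = "\<lambda>z. (z, 0)"]
        Ck_on_linear_comp[where L = "\<lambda>z. (0, z)"] bounded_linear_Pair bounded_linear_ident bounded_linear_zero)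
  then show ?thesis by simp
qed

lemma linear_eq_sum_Basis:
  fixes L :: "'a::euclidean_space \<Rightarrow> 'b::real_vector"
  assumes "linear L" shows "L v = (\<Sum>b\<in>Basis. (v \<bullet> b) *\<^sub>R L b)"
proof -
  have "L v = L (\<Sum>b\<in>Basis. (v \<bullet> b) *\<^sub>R b)" by (simp add: euclidean_representation)
  then show ?thesis using assms by (simp add: linear_sum linear_cmul)
qed

lemma linear_fd: "f differentiable (at x) \<Longrightarrow> linear (fd f x)"
  by (rule linear_frechet_derivative)

lemma Ck_on_comp:
  assumes "open S" "open T" "f ` S \<subseteq> T" "Ck_on k S f" "Ck_on k T g"
  shows "Ck_on k S (\<lambda>x. g (f x))"
  using assms(3-)
proof (induction k arbitrary: g)
  case 0
  then show ?case by (auto intro: continuous_on_compose2)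
next
  case (Suc k)
  have der: "((\<lambda>x. g (f x)) has_derivative (\<lambda>v. fd g (f x) (fd f x v))) (at x)" if "x \<in> S" for x
    using Suc.prems that by (auto intro!: has_derivative_compose[where g=g] fd_works)
  \<comment> \<open>The direction \<open>fd f x v\<close> moves with \<open>x\<close>, while
    \<open>Ck_on\<close> controls derivatives in fixed directions. Expanding it in
    \<open>Basis\<close> turns the chain rule into a sum of products to which the induction
    hypothesis applies.\<close>
  have "fd g (f x) (fd f x v) = (\<Sum>b\<in>Basis. (fd f x v \<bullet> b) *\<^sub>R fd g (f x) b)" if "x \<in> S" for x v
    using Suc.prems that by (intro linear_eq_sum_Basis linear_fd) auto
  then have eq: "(\<Sum>b\<in>Basis. (fd f x v \<bullet> b) *\<^sub>R fd g (f x) b) = fd (\<lambda>x. g (f x)) x v" if "x \<in> S" for x v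
    using fd_eqI[OF der[OF that]] that by simp
  have "Ck_on k S (\<lambda>x. \<Sum>b\<in>Basis. (fd f x v \<bullet> b) *\<^sub>R fd g (f x) b)" for v
    using Suc.prems Ck_on_SucD[OF Suc.prems(2)]
    by (intro Ck_on_sum Ck_on_bilinear[OF bounded_bilinear_scaleR] assms(1)
        Ck_on_linear_comp[OF bounded_linear_inner_left] Suc.IH) auto
  then have "Ck_on k S (\<lambda>x. fd (\<lambda>x. g (f x)) x v)" for v
    by (rule Ck_on_cong[OF assms(1), rotated]) (simp add: eq)
  then show ?case using der by (auto simp: differentiable_def)
qed

section \<open>Local estimates from continuous derivatives\<close>

text \<open>\<open>Ck_on\<close> gives continuity one direction at a time; linearity and the finite
  basis turn it into continuity in operator norm. Hence the error allowed per basis vector is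
  \<open>\<eta>\<close> divided by the dimension.\<close>

lemma Ck_on_Suc_continuous_fd:
  assumes "Ck_on (Suc k) S f" "open S" "p \<in> S" "\<eta> > 0"
  shows "\<exists>r>0. ball p r \<subseteq> S \<and> (\<forall>x\<in>ball p r. \<forall>v. norm (fd f x v - fd f p v) \<le> \<eta> * norm v)"
proof -
  have diff: "linear (fd f x)" if "x \<in> S" for x using assms(1) that by (auto intro: linear_fd)
  define \<eta>' where "\<eta>' = \<eta> / real DIM('a)"
  have "\<eta>' > 0" using assms(4) by (simp add: \<eta>'_def)
  have "\<exists>r>0. \<forall>x\<in>ball p r. norm (fd f x b - fd f p b) < \<eta>'" if "b \<in> Basis" for b
  proof -
    have "Ck_on k S (\<lambda>x. fd f x b)" using assms(1) by auto
    then have "Ck_on 0 S (\<lambda>x. fd f x b)" by (induction k) (auto dest: Ck_on_SucD simp del: Ck_on.simps)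
    then have "isCont (\<lambda>x. fd f x b) p"
      using assms(2,3) by (simp add: continuous_on_eq_continuous_at)
    then show ?thesis using \<open>\<eta>' > 0\<close>
      unfolding continuous_at_eps_delta by (metis mem_ball dist_commute dist_norm)
  qed
  then obtain r where r: "\<And>b. b \<in> Basis \<Longrightarrow> r b > 0"
    "\<And>b x. b \<in> Basis \<Longrightarrow> x \<in> ball p (r b) \<Longrightarrow> norm (fd f x b - fd f p b) < \<eta>'" by metis
  obtain r0 where r0: "r0 > 0" "ball p r0 \<subseteq> S" using assms(2,3) open_contains_ball by blast
  define R where "R = Min (insert r0 (r ` Basis))"
  have R: "R > 0" "R \<le> r0" using r0 r by (auto simp: R_def)
  have Rb: "R \<le> r b" if "b \<in> Basis" for b
    unfolding R_def by (rule Min_le) (use that in auto)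
  have "norm (fd f x v - fd f p v) \<le> \<eta> * norm v" if x: "x \<in> ball p R" for x v
  proof -
    have "x \<in> S" using R r0 x by auto
    have "fd f x v - fd f p v = (\<Sum>b\<in>Basis. (v \<bullet> b) *\<^sub>R (fd f x b - fd f p b))"
      using linear_eq_sum_Basis[OF diff[OF \<open>x\<in>S\<close>], of v] linear_eq_sum_Basis[OF diff[OF \<open>p\<in>S\<close>], of v]
      by (simp add: sum_subtractf scaleR_diff_right)
    also have "norm \<dots> \<le> (\<Sum>b\<in>(Basis::'a set). norm v * \<eta>')"
    proof (intro sum_norm_le)
      fix b :: 'a assume b: "b \<in> Basis"
      then have "norm (fd f x b - fd f p b) \<le> \<eta>'"
        using r(2)[OF b, of x] Rb[OF b] x by auto
      then show "norm ((v \<bullet> b) *\<^sub>R (fd f x b - fd f p b)) \<le> norm v * \<eta>'"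
        using Basis_le_norm[OF b, of v] by (auto intro: mult_mono)
    qed
    also have "\<dots> = \<eta> * norm v" by (simp add: \<eta>'_def)
    finally show ?thesis .
  qed
  then show ?thesis using R r0(2) subset_ball[of R r0 p] by blast
qed

text \<open>The mean value inequality is applied to \<open>f\<close> minus its linear part at
  \<open>p\<close>, whose derivative is small near \<open>p\<close>.\<close>

lemma Ck_on_strictly_differentiable:
  assumes "Ck_on (Suc k) S f" "open S" "p \<in> S" "\<eta> > 0"
  shows "\<exists>r>0. ball p r \<subseteq> S \<and>
    (\<forall>x\<in>ball p r. \<forall>y\<in>ball p r. norm (f x - f y - fd f p (x - y)) \<le> \<eta> * norm (x - y))"
proof -
  obtain r where r: "r > 0" "ball p r \<subseteq> S"
    "\<And>x v. x \<in> ball p r \<Longrightarrow> norm (fd f x v - fd f p v) \<le> \<eta> * norm v"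
    using Ck_on_Suc_continuous_fd[OF assms] by blast
  have lin: "bounded_linear (fd f p)"
    using assms by (auto intro: linear_fd simp: linear_conv_bounded_linear[symmetric])
  have "norm (f x - f y - fd f p (x - y)) \<le> \<eta> * norm (x - y)" if "x \<in> ball p r" "y \<in> ball p r" for x y
  proof -
    have "norm ((f x - fd f p x) - (f y - fd f p y)) \<le> \<eta> * norm (x - y)"
    proof (rule differentiable_bound[where S = "ball p r"])
      show "((\<lambda>x. f x - fd f p x) has_derivative (\<lambda>v. fd f z v - fd f p v)) (at z within ball p r)"
        if "z \<in> ball p r" for z
        using assms(1) r(2) that
        by (intro has_derivative_diff has_derivative_at_withinI[OF fd_works]
            has_derivative_at_withinI[OF bounded_linear_imp_has_derivative[OF lin]]) auto
      show "onorm (\<lambda>v. fd f z v - fd f p v) \<le> \<eta>" if "z \<in> ball p r" for z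
        by (rule onorm_le) (use r(3) that in auto)
    qed (use that in auto)
    moreover have "f x - f y - fd f p (x - y) = (f x - fd f p x) - (f y - fd f p y)"
      unfolding linear_diff[OF bounded_linear.linear[OF lin], of x y] by simp
    ultimately show ?thesis by (simp only:)
  qed
  then show ?thesis using r by blast
qed

lemma Ck_on_locally_lipschitz:
  assumes "Ck_on (Suc k) S f" "open S" "p \<in> S"
  shows "\<exists>r>0. \<exists>L>0. ball p r \<subseteq> S \<and>
    (\<forall>x\<in>ball p r. \<forall>y\<in>ball p r. norm (f x - f y) \<le> L * norm (x - y))"
proof -
  obtain r where r: "r > 0" "ball p r \<subseteq> S"
    "\<And>x y. x \<in> ball p r \<Longrightarrow> y \<in> ball p r \<Longrightarrow> norm (f x - f y - fd f p (x - y)) \<le> 1 * norm (x - y)"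
    using Ck_on_strictly_differentiable[OF assms, of 1] by auto
  have "linear (fd f p)" using assms by (auto intro: linear_fd)
  then obtain B where B: "B > 0" "\<And>v. norm (fd f p v) \<le> B * norm v"
    using linear_bounded_pos by blast
  have "norm (f x - f y) \<le> (B + 1) * norm (x - y)" if "x \<in> ball p r" "y \<in> ball p r" for x y
    using r(3)[OF that] B(2)[of "x - y"] norm_triangle_ineq2[of "f x - f y" "fd f p (x - y)"]
    by (simp add: algebra_simps)
  then show ?thesis using r B(1) by (metis add_pos_pos zero_less_one)
qed

lemma Ck_on_continuous: "Ck_on k S f \<Longrightarrow> continuous_on S f"
  by (induction k) (auto dest: Ck_on_SucD simp del: Ck_on.simps(2))

section \<open>Implicit functions\<close>

text \<open>Along the solution \<open>F\<close> stays 0, so its linear part at the increment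
  \<open>(u, v)\<close> is o(|u| + |v|). Inverting the partial derivative in the second variable
  first yields |v| \<le> M |u|; the error is then o(|u|), which is differentiability of
  \<open>y\<close>.\<close>

lemma implicit_derivative:
  fixes F :: "'a::euclidean_space \<times> 'b::euclidean_space \<Rightarrow> 'b"
  assumes F: "(F has_derivative F') (at (x, y x))"
    and inj: "\<And>v. F' (0, v) = 0 \<Longrightarrow> v = 0"
    and y: "isCont y x" and U: "open U" "x \<in> U" "\<And>z. z \<in> U \<Longrightarrow> F (z, y z) = 0"
  shows "y differentiable (at x) \<and> (\<forall>u. F' (u, fd y x u) = 0)"
proof -
  have linF: "linear F'" using F by (rule has_derivative_linear)
  have split: "F' (u, v) = F' (u, 0) + F' (0, v)" for u v
    using linear_add[OF linF, of "(u, 0)" "(0, v)"] by simp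
  have linA: "linear (\<lambda>u. F' (u, 0))"
    by (rule linear_compose[OF _ linF, unfolded o_def]) (auto intro!: linearI)
  have linB: "linear (\<lambda>v. F' (0, v))"
    by (rule linear_compose[OF _ linF, unfolded o_def]) (auto intro!: linearI)
  have "inj (\<lambda>v. F' (0, v))"
    using inj linear_injective_0[OF linB] by blast
  then obtain Bi where Bi: "linear Bi" "\<And>v. Bi (F' (0, v)) = v" "\<And>v. F' (0, Bi v) = v"
    using linear_injective_isomorphism[OF linB] by blast
  obtain K where K: "K > 0" "\<And>v. norm (Bi v) \<le> K * norm v"
    using linear_bounded_pos[OF Bi(1)] by blast
  obtain A0 where A0: "A0 > 0" "\<And>u. norm (F' (u, 0)) \<le> A0 * norm u"
    using linear_bounded_pos[OF linA] by blast
  define M where "M = 1 + 2 * K * A0"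
  have "M > 0" using K A0 by (simp add: M_def add_pos_pos)
  define y' where "y' = (\<lambda>u. - Bi (F' (u, 0)))"
  have eq0: "F' (u, y' u) = 0" for u
    using split[of u "y' u"] linear_neg[OF linB, of "Bi (F' (u,0))"] by (simp add: y'_def Bi(3))
  have "bounded_linear y'"
    unfolding y'_def using linA Bi(1)
    using linear_compose[OF linA Bi(1), unfolded o_def]
    by (intro bounded_linear_minus) (simp add: linear_conv_bounded_linear[symmetric])
  moreover have "\<exists>d>0. \<forall>z. norm (z - x) < d \<longrightarrow> norm (y z - y x - y' (z - x)) \<le> e * norm (z - x)"
    if "e > 0" for e
  proof -
    \<comment> \<open>The first bound allows \<open>norm v\<close> on the right-hand side to be
      absorbed; the second keeps the final error below \<open>e * norm (z - x)\<close>.\<close>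
    define \<epsilon> where "\<epsilon> = min (1 / (2 * K)) (e / (K * (1 + M)))"
    have \<epsilon>: "\<epsilon> > 0" "K * \<epsilon> \<le> 1 / 2" "K * (\<epsilon> * (1 + M)) \<le> e"
    proof -
      show "\<epsilon> > 0" using K \<open>M > 0\<close> that by (simp add: \<epsilon>_def)
      show "K * \<epsilon> \<le> 1 / 2"
        using mult_left_mono[of \<epsilon> "1 / (2 * K)" K] K by (simp add: \<epsilon>_def)
      have "K * (1 + M) * \<epsilon> \<le> K * (1 + M) * (e / (K * (1 + M)))"
        using K \<open>M > 0\<close> by (intro mult_left_mono) (auto simp: \<epsilon>_def)
      moreover have "K * (1 + M) * (e / (K * (1 + M))) = e" using K \<open>M > 0\<close> by simp
      ultimately have "K * (1 + M) * \<epsilon> \<le> e" by (simp only:)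
      then show "K * (\<epsilon> * (1 + M)) \<le> e" by (simp only: mult.assoc mult.commute[of \<epsilon>])
    qed
    obtain d1 where d1: "d1 > 0"
      "\<And>w. norm (w - (x, y x)) < d1 \<Longrightarrow> norm (F w - F (x, y x) - F' (w - (x, y x))) \<le> \<epsilon> * norm (w - (x, y x))"
      using F \<epsilon>(1) unfolding has_derivative_at_alt by blast
    obtain d2 where d2: "d2 > 0" "\<And>z. norm (z - x) < d2 \<Longrightarrow> norm (y z - y x) < d1 / 2"
      using y d1(1) unfolding continuous_at_eps_delta by (metis dist_norm half_gt_zero)
    obtain d3 where d3: "d3 > 0" "ball x d3 \<subseteq> U" using U open_contains_ball by blast
    define d where "d = min (d1 / 2) (min d2 d3)"
    have "norm (y z - y x - y' (z - x)) \<le> e * norm (z - x)" if z: "norm (z - x) < d" for z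
    proof -
      define u v where "u = z - x" and "v = y z - y x"
      have wz: "(z, y z) - (x, y x) = (u, v)" by (simp add: u_def v_def)
      have "norm (u, v) \<le> norm u + norm v" by (rule norm_Pair_le)
      moreover have "norm u < d1 / 2" "norm v < d1 / 2"
        using z d2(2)[of z] by (auto simp: u_def v_def d_def)
      ultimately have "norm ((z, y z) - (x, y x)) < d1" unfolding wz by linarith
      moreover have "z \<in> U" using d3(2) z by (auto simp: d_def dist_norm norm_minus_commute)
      ultimately have "norm (F' (u, v)) \<le> \<epsilon> * norm (u, v)"
        using d1(2)[of "(z, y z)"] U(3)[of z] U(3)[OF U(2)] unfolding wz by simp
      also have "\<dots> \<le> \<epsilon> * (norm u + norm v)"
        using \<epsilon>(1) by (intro mult_left_mono norm_Pair_le) auto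
      finally have b: "norm (F' (u, v)) \<le> \<epsilon> * (norm u + norm v)" .
      have "v = Bi (F' (u, v) - F' (u, 0))" by (simp add: split[of u v] Bi(2))
      then have "norm v \<le> K * norm (F' (u, v) - F' (u, 0))" using K(2) by metis
      also have "\<dots> \<le> K * (\<epsilon> * (norm u + norm v) + A0 * norm u)"
        using b A0(2)[of u] K(1) norm_triangle_ineq4[of "F' (u, v)" "F' (u, 0)"]
        by (intro mult_left_mono) auto
      also have "\<dots> = K * \<epsilon> * (norm u + norm v) + K * A0 * norm u"
        by (simp add: algebra_simps)
      also have "\<dots> \<le> 1 / 2 * (norm u + norm v) + K * A0 * norm u"
        using \<epsilon>(2) by (intro add_right_mono mult_right_mono) auto
      finally have v: "norm v \<le> M * norm u" by (simp add: M_def field_simps)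
      have "v - y' u = Bi (F' (u, v))"
        by (simp add: y'_def split[of u v] linear_add[OF Bi(1)] Bi(2))
      then have "norm (v - y' u) \<le> K * (\<epsilon> * (norm u + norm v))"
        using order_trans[OF K(2)[of "F' (u, v)"] mult_left_mono[OF b]] K(1) by simp
      also have "\<dots> \<le> K * (\<epsilon> * (norm u + M * norm u))"
        using K(1) \<epsilon>(1) v by (intro mult_left_mono add_left_mono) auto
      also have "\<dots> = K * (\<epsilon> * (1 + M)) * norm u" by (simp add: algebra_simps)
      also have "\<dots> \<le> e * norm u" by (intro mult_right_mono \<epsilon>) auto
      finally show ?thesis by (simp add: u_def v_def)
    qed
    moreover have "d > 0" using d1 d2 d3 by (simp add: d_def)
    ultimately show ?thesis by blast
  qed
  ultimately have "(y has_derivative y') (at x)" unfolding has_derivative_at_alt by blast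
  then show ?thesis using eq0 fd_eqI differentiableI by metis
qed

text \<open>An injective linear map is bounded below by some \<open>c0\<close>, and nearby maps keep
  the bound \<open>c0 / 2\<close>. Applied to \<open>Y z - Y x\<close>, whose image is
  \<open>c z - B z (Y x)\<close>, this gives convergence.\<close>

lemma isCont_linear_solve:
  fixes B :: "'a::euclidean_space \<Rightarrow> 'b::euclidean_space \<Rightarrow> 'b"
  assumes lin: "\<And>z. z \<in> U \<Longrightarrow> linear (B z)" and inj: "\<And>v. B x v = 0 \<Longrightarrow> v = 0"
    and B: "\<And>v. isCont (\<lambda>z. B z v) x" and c: "isCont c x"
    and U: "open U" "x \<in> U" and eq: "\<And>z. z \<in> U \<Longrightarrow> B z (Y z) = c z"
  shows "isCont Y x"
proof -
  have "inj (B x)" using inj linear_injective_0[OF lin[OF U(2)]] by blast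
  then obtain c0 where c0: "c0 > 0" "\<And>v. c0 * norm v \<le> norm (B x v)"
    using linear_inj_bounded_below_pos[OF lin[OF U(2)]] by blast
  have "((\<lambda>z. \<Sum>b\<in>Basis. norm (B z b - B x b)) \<longlongrightarrow> (\<Sum>b\<in>(Basis::'b set). norm (B x b - B x b))) (at x)"
    using B by (intro tendsto_sum tendsto_norm tendsto_diff tendsto_const) (simp add: isCont_def)
  then have "\<forall>\<^sub>F z in at x. (\<Sum>b\<in>Basis. norm (B z b - B x b)) < c0 / 2"
    using c0(1) by (intro order_tendstoD) auto
  moreover have "\<forall>\<^sub>F z in at x. z \<in> U" using U by (simp add: eventually_at_in_open')
  ultimately have "\<forall>\<^sub>F z in at x. norm (Y z - Y x) \<le> (2 / c0) * norm (c z - B z (Y x))"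
  proof eventually_elim
    case (elim z)
    define v where "v = Y z - Y x"
    have "B z v - B x v = (\<Sum>b\<in>Basis. (v \<bullet> b) *\<^sub>R (B z b - B x b))"
      using linear_eq_sum_Basis[OF lin[OF elim(2)], of v] linear_eq_sum_Basis[OF lin[OF U(2)], of v]
      by (simp add: sum_subtractf scaleR_diff_right)
    also have "norm \<dots> \<le> (\<Sum>b\<in>Basis. norm v * norm (B z b - B x b))"
      by (intro sum_norm_le) (auto intro!: mult_right_mono Basis_le_norm)
    also have "\<dots> \<le> norm v * (c0 / 2)"
      unfolding sum_distrib_left[symmetric] using elim(1) by (intro mult_left_mono) auto
    finally have "norm (B z v - B x v) \<le> c0 / 2 * norm v" by (simp add: mult.commute)
    then have "c0 / 2 * norm v \<le> norm (B z v)"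
      using c0(2)[of v] norm_triangle_ineq2[of "B x v" "B z v"] by (simp add: norm_minus_commute)
    also have "B z v = c z - B z (Y x)"
      using lin[OF elim(2)] eq[OF elim(2)] by (simp add: v_def linear_diff)
    finally show ?case using c0(1) unfolding v_def[symmetric] by (simp add: field_simps)
  qed
  moreover have "((\<lambda>z. (2 / c0) * norm (c z - B z (Y x))) \<longlongrightarrow> (2 / c0) * norm (c x - B x (Y x))) (at x)"
    using B[of "Y x"] c by (intro tendsto_mult tendsto_norm tendsto_diff tendsto_const) (simp_all add: isCont_def)
  then have "((\<lambda>z. (2 / c0) * norm (c z - B z (Y x))) \<longlongrightarrow> 0) (at x)" using eq[OF U(2)] by simp
  ultimately have "((\<lambda>z. Y z - Y x) \<longlongrightarrow> 0) (at x)" by (rule Lim_null_comparison)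
  then show ?thesis by (simp add: isCont_def LIM_zero_iff)
qed

text \<open>The derivative \<open>Y = D y(x) u\<close> of an implicit function is itself an implicit function, given by
  \<open>D F(x, y x) (u, Y) = 0\<close>. This drives the induction on the order of smoothness.\<close>

lemma Ck_on_implicit:
  fixes F :: "'a::euclidean_space \<times> 'b::euclidean_space \<Rightarrow> 'b"
  assumes "open S" "open U" "Ck_on (Suc k) S F" "continuous_on U y"
    and "\<And>x. x \<in> U \<Longrightarrow> (x, y x) \<in> S" "\<And>x. x \<in> U \<Longrightarrow> F (x, y x) = 0"
    and "\<And>x v. x \<in> U \<Longrightarrow> fd F (x, y x) (0, v) = 0 \<Longrightarrow> v = 0"
  shows "Ck_on (Suc k) U y"
  using assms
proof (induction k arbitrary: S F y)
  case (0 S F y)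
  note prems = 0
  have diffF: "F differentiable (at (x, y x))" if "x \<in> U" for x
    using prems(3) prems(5)[OF that] by simp
  have contY: "isCont y x" if "x \<in> U" for x
    using prems(2,4) that by (simp add: continuous_on_eq_continuous_at)
  have y': "y differentiable (at x) \<and> (\<forall>u. fd F (x, y x) (u, fd y x u) = 0)" if "x \<in> U" for x
    by (rule implicit_derivative[OF fd_works[OF diffF[OF that]] prems(7)[OF that] contY[OF that] prems(2) that prems(6)])
  then have y: "y differentiable (at x)" "\<And>u. fd F (x, y x) (u, fd y x u) = 0" if "x \<in> U" for x
    using that by blast+
  have lin: "linear (fd F (x, y x))" if "x \<in> U" for x
    using diffF[OF that] by (rule linear_fd)
  have cont: "isCont (\<lambda>x. fd F (x, y x) w) x" if "x \<in> U" for x w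
  proof -
    have "continuous_on S (\<lambda>z. fd F z w)" using prems(3) by (cases w) simp
    then have "continuous_on U (\<lambda>x. fd F (x, y x) w)"
      by (rule continuous_on_compose2)
        (use prems in \<open>auto intro!: continuous_intros\<close>)
    then show ?thesis using that prems(2) by (simp add: continuous_on_eq_continuous_at)
  qed
  \<comment> \<open>The derivative solves a linear equation whose coefficients are continuous in
    \<open>x\<close>.\<close>
  have "isCont (\<lambda>x. fd y x u) x" if x: "x \<in> U" for x u
  proof (rule isCont_linear_solve[where U = U and B = "\<lambda>x v. fd F (x, y x) (0, v)" and c = "\<lambda>x. - fd F (x, y x) (u, 0)"])
    show "linear (\<lambda>v. fd F (z, y z) (0, v))" if "z \<in> U" for z
      by (rule linear_compose[OF _ lin[OF that], unfolded o_def]) (auto intro!: linearI)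
    show "fd F (z, y z) (0, fd y z u) = - fd F (z, y z) (u, 0)" if "z \<in> U" for z
      using linear_add[OF lin[OF that], of "(u, 0)" "(0, fd y z u)"] y(2)[OF that, of u]
      by (simp add: eq_neg_iff_add_eq_0 add.commute)
    show "v = 0" if "fd F (x, y x) (0, v) = 0" for v using prems(7)[OF x that] .
  qed (use cont[OF x] prems(2) x in \<open>simp_all add: continuous_minus\<close>)
  then show ?case using y by (auto simp: continuous_at_imp_continuous_on)
next
  case (Suc k S F y)
  note prems = Suc.prems
  have Ck: "Ck_on (Suc k) U y"
    by (rule Suc.IH[OF prems(1,2) Ck_on_SucD[OF prems(3)] prems(4-7)])
  have diffF: "F differentiable (at (x, y x))" if "x \<in> U" for x
    using prems(3) prems(5)[OF that] unfolding Ck_on.simps(2)[of "Suc k"] by blast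
  have contY: "isCont y x" if "x \<in> U" for x
    using prems(2,4) that by (simp add: continuous_on_eq_continuous_at)
  have y': "y differentiable (at x) \<and> (\<forall>u. fd F (x, y x) (u, fd y x u) = 0)" if "x \<in> U" for x
    by (rule implicit_derivative[OF fd_works[OF diffF[OF that]] prems(7)[OF that] contY[OF that] prems(2) that prems(6)])
  then have y: "y differentiable (at x)" "\<And>u. fd F (x, y x) (u, fd y x u) = 0" if "x \<in> U" for x
    using that by blast+
  have lin: "linear (fd F (x, y x))" if "x \<in> U" for x
    using diffF[OF that] by (rule linear_fd)
  have CkD: "Ck_on (Suc k) U (\<lambda>x. fd F (x, y x) w)" for w
  proof (rule Ck_on_comp[where f = "\<lambda>x. (x, y x)" and g = "\<lambda>z. fd F z w" and T = S])
    show "Ck_on (Suc k) U (\<lambda>x. (x, y x))"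
      by (intro Ck_on_Pair Ck_on_bounded_linear bounded_linear_ident prems Ck)
    show "Ck_on (Suc k) S (\<lambda>z. fd F z w)"
      using prems(3) unfolding Ck_on.simps(2)[of "Suc k"] by blast
  qed (use prems(1,2,5) in auto)
  have "Ck_on (Suc k) U (\<lambda>x. fd y x u)" for u
  proof (rule Suc.IH)
    \<comment> \<open>\<open>Y\<close> is now a variable, so it is expanded in \<open>Basis\<close>:
      \<open>Ck_on (Suc k)\<close> is known for derivatives in fixed directions.\<close>
    define F2 where "F2 = (\<lambda>(x, Y). (\<Sum>b\<in>Basis. (Y \<bullet> b) *\<^sub>R fd F (x, y x) (0, b)) + fd F (x, y x) (u, 0))"
    show op: "open (U \<times> (UNIV :: 'b set))" "open U" using prems(2) by (auto intro: open_Times)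
    have CkD2: "Ck_on (Suc k) (U \<times> (UNIV :: 'b set)) (\<lambda>z. fd F (fst z, y (fst z)) w)" for w
      by (rule Ck_on_comp[where f = fst and T = U and g = "\<lambda>x. fd F (x, y x) w"])
        (use op CkD in \<open>auto intro: Ck_on_bounded_linear bounded_linear_fst simp del: Ck_on.simps\<close>)
    have snd: "Ck_on (Suc k) (U \<times> UNIV) (\<lambda>z. snd z \<bullet> b)" for b :: 'b
      by (rule Ck_on_linear_comp[OF bounded_linear_inner_left op(1) Ck_on_bounded_linear[OF bounded_linear_snd]])
    show Ck2: "Ck_on (Suc k) (U \<times> UNIV) F2"
      unfolding F2_def case_prod_beta
      by (intro Ck_on_add Ck_on_sum Ck_on_bilinear[OF bounded_bilinear_scaleR] op snd CkD2 finite_Basis)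

    have F2: "F2 (x, Y) = fd F (x, y x) (u, Y)" if "x \<in> U" for x Y
    proof -
      have "(0::'a, Y) = (\<Sum>b\<in>Basis. (Y \<bullet> b) *\<^sub>R (0, b))"
        by (simp add: scaleR_Pair sum_prod euclidean_representation)
      then have "fd F (x, y x) (0, Y) = (\<Sum>b\<in>Basis. (Y \<bullet> b) *\<^sub>R fd F (x, y x) (0, b))"
        using lin[OF that] by (simp add: linear_sum linear_cmul del: scaleR_Pair)
      then show ?thesis using linear_add[OF lin[OF that], of "(u, 0)" "(0, Y)"] by (simp add: F2_def)
    qed
    show "continuous_on U (\<lambda>x. fd y x u)"
      using Ck by (auto intro: Ck_on_continuous)
    show "F2 (x, fd y x u) = 0" if "x \<in> U" for x using F2 y that by simp
    \<comment> \<open>\<open>F2\<close> is affine in \<open>Y\<close> with linear part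
      \<open>fd F (x, y x) (0, _)\<close>, so the injectivity hypothesis on \<open>F\<close> passes
      to \<open>F2\<close> unchanged.\<close>
    show "v = 0" if x: "x \<in> U" and v: "fd F2 (x, fd y x u) (0, v) = 0" for x v
    proof -
      have "F2 differentiable (at (x, fd y x u))" using Ck2 x by auto
      then have "((\<lambda>Y. F2 (x, Y)) has_derivative (\<lambda>v. fd F2 (x, fd y x u) (0, v))) (at (fd y x u))"
        by (intro has_derivative_compose[where f = "\<lambda>Y. (x, Y)" and g = F2] fd_works has_derivative_Pair
            has_derivative_const has_derivative_ident)
      moreover have "((\<lambda>Y. F2 (x, Y)) has_derivative (\<lambda>v. fd F (x, y x) (0, v))) (at (fd y x u))"
      proof -
        have "bounded_linear (\<lambda>v. fd F (x, y x) (0, v))"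
          using bounded_linear_compose[OF has_derivative_bounded_linear[OF fd_works[OF diffF[OF x]]]
              bounded_linear_Pair[OF bounded_linear_zero bounded_linear_ident]] by simp
        then have "((\<lambda>Y. fd F (x, y x) (u, 0) + fd F (x, y x) (0, Y)) has_derivative
            (\<lambda>v. 0 + fd F (x, y x) (0, v))) (at (fd y x u))"
          by (intro has_derivative_add has_derivative_const bounded_linear_imp_has_derivative)
        moreover have "(\<lambda>Y. F2 (x, Y)) = (\<lambda>Y. fd F (x, y x) (u, 0) + fd F (x, y x) (0, Y))"
        proof
          fix Y show "F2 (x, Y) = fd F (x, y x) (u, 0) + fd F (x, y x) (0, Y)"
            using F2[OF x, of Y] linear_add[OF lin[OF x], of "(u, 0)" "(0, Y)"] by simp
        qed
        ultimately show ?thesis by (simp only: add_0_left)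
      qed
      ultimately have "fd F (x, y x) (0, v) = 0"
        using has_derivative_unique v by metis
      then show "v = 0" using prems(7)[OF x] by blast
    qed
  qed auto
  then show ?case using y unfolding Ck_on.simps(2)[of "Suc k"] by blast
qed

section \<open>Smooth functions on Euclidean spaces\<close>

lemma smooth_on_Ck: "smooth_on S f \<Longrightarrow> Ck_on k S f"
  by (simp add: smooth_on_def)

lemma smooth_on_subset: "smooth_on S f \<Longrightarrow> T \<subseteq> S \<Longrightarrow> smooth_on T f"
  by (auto simp: smooth_on_def intro: Ck_on_subset)

lemma smooth_on_cong: "open S \<Longrightarrow> (\<And>x. x \<in> S \<Longrightarrow> f x = g x) \<Longrightarrow> smooth_on S f \<Longrightarrow> smooth_on S g"
  unfolding smooth_on_def using Ck_on_cong by blast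

lemma smooth_on_local:
  assumes "\<And>x. x \<in> S \<Longrightarrow> \<exists>T. open T \<and> x \<in> T \<and> smooth_on T f"
  shows "smooth_on S f"
  unfolding smooth_on_def using assms by (intro allI Ck_on_local) (meson smooth_on_Ck)

lemma smooth_on_comp:
  assumes "open S" "open T" "f ` S \<subseteq> T" "smooth_on S f" "smooth_on T g"
  shows "smooth_on S (\<lambda>x. g (f x))"
  using assms Ck_on_comp unfolding smooth_on_def by blast

lemma smooth_on_continuous: "smooth_on S f \<Longrightarrow> continuous_on S f"
  using smooth_on_Ck[of S f 0] by simp

section \<open>Smooth maps between manifolds\<close>

lemma is_chartD:
  assumes "is_chart (U, \<kappa>)"
  shows "open U" "open (\<kappa> ` U)" "continuous_on U \<kappa>" "continuous_on (\<kappa> ` U) (inv_into U \<kappa>)" "inj_on \<kappa> U"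
    "\<And>x. x \<in> U \<Longrightarrow> inv_into U \<kappa> (\<kappa> x) = x"
proof -
  have h: "homeomorphism U (\<kappa> ` U) \<kappa> (inv_into U \<kappa>)" using assms by (simp add: is_chart_def)
  then show "inj_on \<kappa> U" unfolding homeomorphism_def by (metis inj_on_inverseI)
  then show "\<And>x. x \<in> U \<Longrightarrow> inv_into U \<kappa> (\<kappa> x) = x" by simp
qed (use assms in \<open>auto simp: is_chart_def homeomorphism_def\<close>)

lemma open_chart_image:
  assumes "is_chart (U, \<kappa>)" "open T" "T \<subseteq> U"
  shows "open (\<kappa> ` T)"
proof -
  have "\<kappa> ` T = \<kappa> ` U \<inter> inv_into U \<kappa> -` T"
    using is_chartD(6)[OF assms(1)] assms(3) by force
  then show ?thesis
    using continuous_open_preimage[OF is_chartD(4,2)[OF assms(1)] assms(2)] by simp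
qed

text \<open>An atlas without compatibility of its charts. Composition, pairing and locality of
  smooth maps hold at this level, so product atlases need no discussion of transition maps.\<close>

definition pre_atlas :: "('m::topological_space, 'a::euclidean_space) chart set \<Rightarrow> bool" where
  "pre_atlas \<A> \<longleftrightarrow> (\<forall>c\<in>\<A>. is_chart c) \<and> (\<forall>x. \<exists>c\<in>\<A>. x \<in> fst c)"

lemma pre_atlasD:
  assumes "pre_atlas \<A>"
  shows "(U, \<kappa>) \<in> \<A> \<Longrightarrow> is_chart (U, \<kappa>)" "\<exists>U \<kappa>. (U, \<kappa>) \<in> \<A> \<and> x \<in> U"
  using assms by (auto simp: pre_atlas_def) (metis fst_conv surj_pair)

lemma pre_atlas_smooth_atlas: "smooth_atlas \<A> \<Longrightarrow> pre_atlas \<A>"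
  unfolding smooth_atlas_def pre_atlas_def by blast

lemma is_chart_ident [simp]: "is_chart (UNIV, \<lambda>x. x)"
  by (simp add: is_chart_def homeomorphism_def)

lemma pre_atlas_euclidean [simp]: "pre_atlas euclidean_atlas"
  by (auto simp: pre_atlas_def)

lemma inv_into_map_prod:
  assumes "inj_on f A" "inj_on g B" "p \<in> A" "q \<in> B"
  shows "inv_into (A \<times> B) (map_prod f g) (f p, g q) = (p, q)"
  using inv_into_f_f[OF map_prod_inj_on[OF assms(1,2)], of "(p, q)"] assms(3,4) by simp

lemma is_chart_prod:
  assumes "is_chart (U, \<kappa>)" "is_chart (U', \<kappa>')"
  shows "is_chart (U \<times> U', map_prod \<kappa> \<kappa>')"
proof -
  note c = is_chartD[OF assms(1)] and c' = is_chartD[OF assms(2)]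
  have im: "map_prod \<kappa> \<kappa>' ` (U \<times> U') = \<kappa> ` U \<times> \<kappa>' ` U'" by auto
  have inv: "inv_into (U \<times> U') (map_prod \<kappa> \<kappa>') p = (inv_into U \<kappa> (fst p), inv_into U' \<kappa>' (snd p))"
    if "p \<in> \<kappa> ` U \<times> \<kappa>' ` U'" for p
    using that inv_into_map_prod[OF c(5) c'(5)] c(6) c'(6) by auto
  have "continuous_on (\<kappa> ` U \<times> \<kappa>' ` U') (\<lambda>p. (inv_into U \<kappa> (fst p), inv_into U' \<kappa>' (snd p)))"
    by (intro continuous_on_Pair continuous_on_compose2[OF c(4)] continuous_on_compose2[OF c'(4)]
        continuous_on_fst continuous_on_snd continuous_on_id) auto
  then have ci: "continuous_on (\<kappa> ` U \<times> \<kappa>' ` U') (inv_into (U \<times> U') (map_prod \<kappa> \<kappa>'))"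
    using inv by (simp cong: continuous_on_cong)
  have "continuous_on (U \<times> U') (\<lambda>p. (\<kappa> (fst p), \<kappa>' (snd p)))"
    by (intro continuous_on_Pair continuous_on_compose2[OF c(3)] continuous_on_compose2[OF c'(3)]
        continuous_on_fst continuous_on_snd continuous_on_id) auto
  then have cf: "continuous_on (U \<times> U') (map_prod \<kappa> \<kappa>')"
    by (simp add: map_prod_def case_prod_beta')
  have inv2: "inv_into (U \<times> U') (map_prod \<kappa> \<kappa>') ` (\<kappa> ` U \<times> \<kappa>' ` U') = U \<times> U'"
    by (simp add: im[symmetric] inv_into_image_cancel map_prod_inj_on c(5) c'(5))
  show ?thesis
    unfolding is_chart_def prod.case homeomorphism_def im inv2
    using c(1,2) c'(1,2) ci cf
    by (auto intro!: open_Times simp: inv_into_map_prod c(5) c'(5) c(6) c'(6))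
qed

lemma pre_atlas_prod:
  assumes "pre_atlas \<A>" "pre_atlas \<B>"
  shows "pre_atlas (prod_atlas \<A> \<B>)"
proof -
  have "\<exists>c\<in>prod_atlas \<A> \<B>. x \<in> fst c" for x
  proof -
    obtain U \<kappa> U' \<kappa>' where "(U, \<kappa>) \<in> \<A>" "fst x \<in> U" "(U', \<kappa>') \<in> \<B>" "snd x \<in> U'"
      using assms pre_atlasD(2) by metis
    then show ?thesis
      by (intro bexI[of _ "(U \<times> U', map_prod \<kappa> \<kappa>')"]) (auto simp: prod_atlas_def mem_Times_iff)
  qed
  then show ?thesis
    using assms by (auto simp: pre_atlas_def prod_atlas_def intro: is_chart_prod)
qed

lemma prod_atlas_euclidean [simp]:
  "prod_atlas euclidean_atlas euclidean_atlas = (euclidean_atlas :: ('a::euclidean_space \<times> 'b::euclidean_space, _) chart set)"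
  by (auto simp: prod_atlas_def map_prod_def)

lemma smooth_map_on_subset: "smooth_map_on \<A> \<B> S f \<Longrightarrow> T \<subseteq> S \<Longrightarrow> smooth_map_on \<A> \<B> T f"
  unfolding smooth_map_on_def
  by (fastforce intro: continuous_on_subset smooth_on_subset)

lemma open_chart_preimage:
  assumes "is_chart (U, \<kappa>)" "open S" "open U'" "continuous_on S f"
  shows "open (\<kappa> ` (S \<inter> U \<inter> f -` U'))"
proof -
  have "S \<inter> U \<inter> f -` U' = U \<inter> (S \<inter> f -` U')" by blast
  then show ?thesis
    using open_Int[OF is_chartD(1)[OF assms(1)] continuous_open_preimage[OF assms(4,2,3)]]
    by (intro open_chart_image[OF assms(1)]) auto
qed

lemma smooth_map_on_cong:
  assumes "pre_atlas \<A>" "pre_atlas \<B>" "open S" "\<And>x. x \<in> S \<Longrightarrow> f x = g x" "smooth_map_on \<A> \<B> S f"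
  shows "smooth_map_on \<A> \<B> S g"
  unfolding smooth_map_on_def
proof (intro conjI ballI, safe)
  have f: "continuous_on S f" using assms(5) by (simp add: smooth_map_on_def)
  then show g: "continuous_on S g" using assms(4) by (simp cong: continuous_on_cong)
  fix U \<kappa> U' \<kappa>' assume c: "(U, \<kappa>) \<in> \<A>" "(U', \<kappa>') \<in> \<B>"
  have eq: "S \<inter> U \<inter> f -` U' = S \<inter> U \<inter> g -` U'" using assms(4) by auto
  note ch = pre_atlasD(1)[OF assms(1) c(1)]
  show "smooth_on (\<kappa> ` (S \<inter> U \<inter> g -` U')) (\<kappa>' \<circ> g \<circ> inv_into U \<kappa>)"
  proof (rule smooth_on_cong)
    show "open (\<kappa> ` (S \<inter> U \<inter> g -` U'))"
      by (intro open_chart_preimage ch assms(3) g is_chartD(1)[OF pre_atlasD(1)[OF assms(2) c(2)]])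
    show "smooth_on (\<kappa> ` (S \<inter> U \<inter> g -` U')) (\<kappa>' \<circ> f \<circ> inv_into U \<kappa>)"
      using assms(5) c unfolding smooth_map_on_def eq[symmetric] by auto
  qed (use is_chartD(6)[OF ch] assms(4) in auto)
qed

text \<open>Near each point the composite is read through a chart of \<open>\<B>\<close> around
  \<open>f x\<close>. Such a chart may cover only part of the image, so smoothness is obtained
  locally and then patched.\<close>

lemma smooth_map_on_comp:
  assumes "pre_atlas \<A>" "pre_atlas \<B>" "pre_atlas \<C>" "open S" "open T" "f ` S \<subseteq> T"
    and f: "smooth_map_on \<A> \<B> S f" and g: "smooth_map_on \<B> \<C> T g"
  shows "smooth_map_on \<A> \<C> S (\<lambda>x. g (f x))"
  unfolding smooth_map_on_def
proof (intro conjI ballI, safe)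
  have cf: "continuous_on S f" and cg: "continuous_on T g"
    using f g by (auto simp: smooth_map_on_def)
  then show cgf: "continuous_on S (\<lambda>x. g (f x))"
    using assms(6) by (auto intro: continuous_on_compose2)
  fix U \<kappa> U' \<kappa>' assume c: "(U, \<kappa>) \<in> \<A>" "(U', \<kappa>') \<in> \<C>"
  note chA = pre_atlasD(1)[OF assms(1) c(1)] and chC = pre_atlasD(1)[OF assms(3) c(2)]
  show "smooth_on (\<kappa> ` (S \<inter> U \<inter> (\<lambda>x. g (f x)) -` U')) (\<kappa>' \<circ> (\<lambda>x. g (f x)) \<circ> inv_into U \<kappa>)"
  proof (rule smooth_on_local)
    fix X assume "X \<in> \<kappa> ` (S \<inter> U \<inter> (\<lambda>x. g (f x)) -` U')"
    then obtain x where x: "x \<in> S" "x \<in> U" "g (f x) \<in> U'" "X = \<kappa> x" by auto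
    obtain U2 \<kappa>2 where c2: "(U2, \<kappa>2) \<in> \<B>" "f x \<in> U2" using pre_atlasD(2)[OF assms(2)] by blast
    note chB = pre_atlasD(1)[OF assms(2) c2(1)]
    define V where "V = T \<inter> U2 \<inter> g -` U'"
    have "V = U2 \<inter> (T \<inter> g -` U')" by (auto simp: V_def)
    then have "open V"
      using is_chartD(1)[OF chB] continuous_open_preimage[OF cg assms(5) is_chartD(1)[OF chC]] by auto
    have "open (\<kappa>2 ` V)" using \<open>open V\<close> by (intro open_chart_image[OF chB]) (auto simp: V_def)
    define Q where "Q = \<kappa> ` (S \<inter> U \<inter> f -` V)"
    have "open Q" unfolding Q_def by (intro open_chart_preimage chA assms(4) cf \<open>open V\<close>)
    have 1: "smooth_on Q (\<kappa>2 \<circ> f \<circ> inv_into U \<kappa>)"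
      using f c(1) c2(1) unfolding smooth_map_on_def
      by (intro smooth_on_subset[where T = Q and S = "\<kappa> ` (S \<inter> U \<inter> f -` U2)"])
        (auto simp: Q_def V_def)
    have 2: "smooth_on (\<kappa>2 ` V) (\<kappa>' \<circ> g \<circ> inv_into U2 \<kappa>2)"
      using g c(2) c2(1) unfolding smooth_map_on_def V_def by auto
    have "smooth_on Q (\<lambda>X. (\<kappa>' \<circ> g \<circ> inv_into U2 \<kappa>2) ((\<kappa>2 \<circ> f \<circ> inv_into U \<kappa>) X))"
      by (rule smooth_on_comp[OF \<open>open Q\<close> \<open>open (\<kappa>2 ` V)\<close> _ 1 2])
        (auto simp: Q_def is_chartD(6)[OF chA])
    then have "smooth_on Q (\<kappa>' \<circ> (\<lambda>x. g (f x)) \<circ> inv_into U \<kappa>)"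
      by (rule smooth_on_cong[OF \<open>open Q\<close>, rotated])
        (auto simp: Q_def V_def is_chartD(6)[OF chA] is_chartD(6)[OF chB])
    moreover have "X \<in> Q" using x c2 assms(6) by (auto simp: Q_def V_def)
    ultimately show "\<exists>T. open T \<and> X \<in> T \<and> smooth_on T (\<kappa>' \<circ> (\<lambda>x. g (f x)) \<circ> inv_into U \<kappa>)"
      using \<open>open Q\<close> by blast
  qed
qed

lemma smooth_map_onD:
  assumes "smooth_map_on \<A> \<B> S f" "(U, \<kappa>) \<in> \<A>" "(U', \<kappa>') \<in> \<B>"
  shows "smooth_on (\<kappa> ` (S \<inter> U \<inter> f -` U')) (\<kappa>' \<circ> f \<circ> inv_into U \<kappa>)"
  using assms unfolding smooth_map_on_def by fast

lemma smooth_map_on_Pair: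
  assumes "pre_atlas \<A>" "pre_atlas \<B>" "pre_atlas \<C>" "open S"
    and f: "smooth_map_on \<A> \<B> S f" and g: "smooth_map_on \<A> \<C> S g"
  shows "smooth_map_on \<A> (prod_atlas \<B> \<C>) S (\<lambda>x. (f x, g x))"
  unfolding smooth_map_on_def
proof (intro conjI ballI, safe)
  have cf: "continuous_on S f" and cg: "continuous_on S g"
    using f g by (auto simp: smooth_map_on_def)
  then show cfg: "continuous_on S (\<lambda>x. (f x, g x))" by (intro continuous_on_Pair)
  fix U \<kappa> V \<kappa>' assume c: "(U, \<kappa>) \<in> \<A>" "(V, \<kappa>') \<in> prod_atlas \<B> \<C>"
  then obtain U1 \<kappa>1 U2 \<kappa>2 where c12: "V = U1 \<times> U2" "\<kappa>' = map_prod \<kappa>1 \<kappa>2" "(U1, \<kappa>1) \<in> \<B>" "(U2, \<kappa>2) \<in> \<C>"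
    by (auto simp: prod_atlas_def)
  note chA = pre_atlasD(1)[OF assms(1) c(1)]
  have "open V" using is_chartD(1)[OF pre_atlasD(1)[OF pre_atlas_prod[OF assms(2,3)] c(2)]] .
  define Q where "Q = \<kappa> ` (S \<inter> U \<inter> (\<lambda>x. (f x, g x)) -` V)"
  have "open Q" unfolding Q_def by (intro open_chart_preimage chA assms(4) cfg \<open>open V\<close>)
  have "smooth_on Q (\<kappa>1 \<circ> f \<circ> inv_into U \<kappa>)"
    by (rule smooth_on_subset[OF smooth_map_onD[OF f c(1) c12(3)]]) (auto simp: Q_def c12(1))
  moreover have "smooth_on Q (\<kappa>2 \<circ> g \<circ> inv_into U \<kappa>)"
    by (rule smooth_on_subset[OF smooth_map_onD[OF g c(1) c12(4)]]) (auto simp: Q_def c12(1))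
  ultimately have "smooth_on Q (\<lambda>X. ((\<kappa>1 \<circ> f \<circ> inv_into U \<kappa>) X, (\<kappa>2 \<circ> g \<circ> inv_into U \<kappa>) X))"
    using \<open>open Q\<close> unfolding smooth_on_def by (blast intro: Ck_on_Pair)
  then show "smooth_on (\<kappa> ` (S \<inter> U \<inter> (\<lambda>x. (f x, g x)) -` V)) (\<kappa>' \<circ> (\<lambda>x. (f x, g x)) \<circ> inv_into U \<kappa>)"
    unfolding Q_def[symmetric] by (simp add: c12 o_def)
qed

section \<open>Smoothness at a point\<close>

text \<open>The pointwise form removes domains from composition arguments;
  \<open>smooth_map_onI_smooth_at\<close> recovers smoothness on a set.\<close>

definition smooth_at ::
  "('m::topological_space, 'a::euclidean_space) chart set \<Rightarrow>
   ('n::topological_space, 'b::euclidean_space) chart set \<Rightarrow> ('m \<Rightarrow> 'n) \<Rightarrow> 'm \<Rightarrow> bool" where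
  "smooth_at \<A> \<B> f x \<longleftrightarrow> (\<exists>S. open S \<and> x \<in> S \<and> smooth_map_on \<A> \<B> S f)"

lemma smooth_at_if_smooth_map_on: "smooth_map_on \<A> \<B> S f \<Longrightarrow> open S \<Longrightarrow> x \<in> S \<Longrightarrow> smooth_at \<A> \<B> f x"
  by (auto simp: smooth_at_def)

lemma smooth_map_onI_smooth_at:
  fixes \<A> :: "('m::t2_space, 'a::euclidean_space) chart set"
  assumes "pre_atlas \<A>" "pre_atlas \<B>" "\<And>x. x \<in> S \<Longrightarrow> smooth_at \<A> \<B> f x"
  shows "smooth_map_on \<A> \<B> S f"
  unfolding smooth_map_on_def
proof (intro conjI ballI, safe)
  have "isCont f x" if "x \<in> S" for x
    using assms(3)[OF that] unfolding smooth_at_def smooth_map_on_def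
    by (auto simp: continuous_on_eq_continuous_at)
  then show "continuous_on S f" by (simp add: continuous_at_imp_continuous_on)
  fix U \<kappa> U' \<kappa>' assume c: "(U, \<kappa>) \<in> \<A>" "(U', \<kappa>') \<in> \<B>"
  note ch = pre_atlasD(1)[OF assms(1) c(1)]
  show "smooth_on (\<kappa> ` (S \<inter> U \<inter> f -` U')) (\<kappa>' \<circ> f \<circ> inv_into U \<kappa>)"
  proof (rule smooth_on_local)
    fix X assume "X \<in> \<kappa> ` (S \<inter> U \<inter> f -` U')"
    then obtain x where x: "x \<in> S" "x \<in> U" "f x \<in> U'" "X = \<kappa> x" by auto
    obtain T where T: "open T" "x \<in> T" "smooth_map_on \<A> \<B> T f"
      using assms(3)[OF x(1)] by (auto simp: smooth_at_def)
    have "open (\<kappa> ` (T \<inter> U \<inter> f -` U'))"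
      using T by (intro open_chart_preimage ch is_chartD(1)[OF pre_atlasD(1)[OF assms(2) c(2)]])
        (auto simp: smooth_map_on_def)
    moreover have "smooth_on (\<kappa> ` (T \<inter> U \<inter> f -` U')) (\<kappa>' \<circ> f \<circ> inv_into U \<kappa>)"
      using T(3) c unfolding smooth_map_on_def by auto
    moreover have "X \<in> \<kappa> ` (T \<inter> U \<inter> f -` U')" using x T by auto
    ultimately show "\<exists>T. open T \<and> X \<in> T \<and> smooth_on T (\<kappa>' \<circ> f \<circ> inv_into U \<kappa>)" by blast
  qed
qed

lemma smooth_at_isCont:
  fixes \<A> :: "('m::t2_space, 'a::euclidean_space) chart set"
  shows "smooth_at \<A> \<B> f x \<Longrightarrow> isCont f x"
  unfolding smooth_at_def smooth_map_on_def by (auto simp: continuous_on_eq_continuous_at)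

lemma smooth_at_comp:
  assumes "pre_atlas \<A>" "pre_atlas \<B>" "pre_atlas \<C>" "smooth_at \<A> \<B> f x" "smooth_at \<B> \<C> g (f x)"
  shows "smooth_at \<A> \<C> (\<lambda>x. g (f x)) x"
proof -
  obtain S T where S: "open S" "x \<in> S" "smooth_map_on \<A> \<B> S f"
    and T: "open T" "f x \<in> T" "smooth_map_on \<B> \<C> T g"
    using assms(4,5) unfolding smooth_at_def by blast
  have "open (S \<inter> f -` T)"
    using S T by (intro continuous_open_preimage) (auto simp: smooth_map_on_def)
  moreover have "smooth_map_on \<A> \<C> (S \<inter> f -` T) (\<lambda>x. g (f x))"
    by (rule smooth_map_on_comp[OF assms(1-3) \<open>open (S \<inter> f -` T)\<close> T(1) _ smooth_map_on_subset[OF S(3)] T(3)]) auto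
  ultimately show ?thesis using S T unfolding smooth_at_def by blast
qed

lemma smooth_at_Pair:
  assumes "pre_atlas \<A>" "pre_atlas \<B>" "pre_atlas \<C>" "smooth_at \<A> \<B> f x" "smooth_at \<A> \<C> g x"
  shows "smooth_at \<A> (prod_atlas \<B> \<C>) (\<lambda>x. (f x, g x)) x"
proof -
  obtain S T where S: "open S" "x \<in> S" "smooth_map_on \<A> \<B> S f"
    and T: "open T" "x \<in> T" "smooth_map_on \<A> \<C> T g"
    using assms(4,5) unfolding smooth_at_def by blast
  have "smooth_map_on \<A> \<B> (S \<inter> T) f" using S(3) by (rule smooth_map_on_subset) simp
  moreover have "smooth_map_on \<A> \<C> (S \<inter> T) g" using T(3) by (rule smooth_map_on_subset) simp
  ultimately have "smooth_map_on \<A> (prod_atlas \<B> \<C>) (S \<inter> T) (\<lambda>x. (f x, g x))"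
    by (rule smooth_map_on_Pair[OF assms(1-3) open_Int[OF S(1) T(1)]])
  then show ?thesis using S T unfolding smooth_at_def by blast
qed

lemma smooth_at_cong:
  assumes "pre_atlas \<A>" "pre_atlas \<B>" "smooth_at \<A> \<B> f x" "open T" "x \<in> T" "\<And>z. z \<in> T \<Longrightarrow> f z = g z"
  shows "smooth_at \<A> \<B> g x"
proof -
  obtain S where S: "open S" "x \<in> S" "smooth_map_on \<A> \<B> S f"
    using assms(3) unfolding smooth_at_def by blast
  have "smooth_map_on \<A> \<B> (S \<inter> T) g"
    by (rule smooth_map_on_cong[OF assms(1,2) open_Int[OF S(1) assms(4)] _ smooth_map_on_subset[OF S(3)]])
      (use assms(6) in auto)
  then show ?thesis using S assms unfolding smooth_at_def by blast
qed

lemma smooth_at_const [simp]: "smooth_at \<A> \<B> (\<lambda>x. c) x"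
  unfolding smooth_at_def smooth_map_on_def smooth_on_def by (auto intro!: exI[of _ UNIV] simp: o_def)

lemma smooth_at_euclidean_iff:
  "smooth_at euclidean_atlas euclidean_atlas f x \<longleftrightarrow> (\<exists>S. open S \<and> x \<in> S \<and> smooth_on S f)"
  unfolding smooth_at_def smooth_map_on_def by (auto simp: o_def intro: smooth_on_continuous)

lemma smooth_at_euclideanI:
  "smooth_on S f \<Longrightarrow> open S \<Longrightarrow> x \<in> S \<Longrightarrow> smooth_at euclidean_atlas euclidean_atlas f x"
  by (auto simp: smooth_at_euclidean_iff)

text \<open>Compatibility with \<open>\<A>\<close> is the form in which a chart of the maximal
  atlas, such as \<open>e\<close>, is given.\<close>

lemma smooth_at_compatible_chart:
  assumes "pre_atlas \<A>" "is_chart (U, \<kappa>)" "\<And>c'. c' \<in> \<A> \<Longrightarrow> compatible (U, \<kappa>) c'" "x \<in> U"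
  shows "smooth_at \<A> euclidean_atlas \<kappa> x"
proof -
  have "smooth_map_on \<A> euclidean_atlas U \<kappa>"
    using assms(2,3) unfolding smooth_map_on_def compatible_def
    by (fastforce simp: is_chartD(3) o_def Int_commute)
  then show ?thesis using assms(4) is_chartD(1)[OF assms(2)] unfolding smooth_at_def by blast
qed

lemma smooth_at_inv_compatible_chart:
  assumes "pre_atlas \<A>" "is_chart (U, \<kappa>)" "\<And>c'. c' \<in> \<A> \<Longrightarrow> compatible (U, \<kappa>) c'" "X \<in> \<kappa> ` U"
  shows "smooth_at euclidean_atlas \<A> (inv_into U \<kappa>) X"
proof -
  have "smooth_map_on euclidean_atlas \<A> (\<kappa> ` U) (inv_into U \<kappa>)"
    unfolding smooth_map_on_def
  proof (intro conjI ballI, safe)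
    show "continuous_on (\<kappa> ` U) (inv_into U \<kappa>)" using assms(2) by (rule is_chartD)
    fix U' and \<kappa>' :: "'a \<Rightarrow> 'b" assume "(U', \<kappa>') \<in> \<A>"
    then have "smooth_on (\<kappa> ` (U \<inter> U')) (\<kappa>' \<circ> inv_into U \<kappa>)"
      using assms(3) unfolding compatible_def by fastforce
    moreover have "(\<lambda>x. x) ` (\<kappa> ` U \<inter> UNIV \<inter> inv_into U \<kappa> -` U') = \<kappa> ` (U \<inter> U')"
      using is_chartD(6)[OF assms(2)] by auto
    ultimately show "smooth_on ((\<lambda>x. x) ` (\<kappa> ` U \<inter> UNIV \<inter> inv_into U \<kappa> -` U'))
        (\<kappa>' \<circ> inv_into U \<kappa> \<circ> inv_into UNIV (\<lambda>x. x))"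
      by (simp add: o_def)
  qed
  then show ?thesis using assms(4) is_chartD(2)[OF assms(2)] unfolding smooth_at_def by blast
qed

text \<open>Near \<open>x\<close> the identity is a chart followed by its inverse. Here the
  compatibility of the charts of \<open>\<A>\<close> with one another enters.\<close>

lemma smooth_at_ident:
  assumes "smooth_atlas \<A>" shows "smooth_at \<A> \<A> (\<lambda>x. x) x"
proof -
  have pre: "pre_atlas \<A>" using assms by (rule pre_atlas_smooth_atlas)
  obtain U \<kappa> where c: "(U, \<kappa>) \<in> \<A>" "x \<in> U" using pre_atlasD(2)[OF pre] by blast
  note ch = pre_atlasD(1)[OF pre c(1)]
  have comp: "compatible (U, \<kappa>) c'" if "c' \<in> \<A>" for c'
    using assms c that unfolding smooth_atlas_def by blast
  have "smooth_at \<A> \<A> (\<lambda>x. inv_into U \<kappa> (\<kappa> x)) x"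
    by (rule smooth_at_comp[OF pre pre_atlas_euclidean pre
        smooth_at_compatible_chart[OF pre ch comp c(2)] smooth_at_inv_compatible_chart[OF pre ch comp imageI[OF c(2)]]])
  then show ?thesis
    by (rule smooth_at_cong[OF pre pre _ is_chartD(1)[OF ch] c(2)]) (simp add: is_chartD(6)[OF ch])
qed

lemma smooth_at_euclidean_comp:
  assumes "pre_atlas \<A>" "smooth_at \<A> euclidean_atlas f x" "smooth_on S F" "open S" "f x \<in> S"
  shows "smooth_at \<A> euclidean_atlas (\<lambda>x. F (f x)) x"
  by (rule smooth_at_comp[OF assms(1) _ _ assms(2) smooth_at_euclideanI[OF assms(3-5)]]) auto

lemma smooth_at_linear:
  assumes "pre_atlas \<A>" "smooth_at \<A> euclidean_atlas f x" "bounded_linear L"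
  shows "smooth_at \<A> euclidean_atlas (\<lambda>x. L (f x)) x"
  by (rule smooth_at_euclidean_comp[OF assms(1,2), of UNIV])
    (auto simp: smooth_on_def intro: Ck_on_bounded_linear assms(3))

lemma smooth_at_Pair_euclidean:
  assumes "pre_atlas \<A>" "smooth_at \<A> euclidean_atlas f x" "smooth_at \<A> euclidean_atlas g x"
  shows "smooth_at \<A> euclidean_atlas (\<lambda>x. (f x, g x)) x"
  using smooth_at_Pair[OF assms(1) pre_atlas_euclidean pre_atlas_euclidean assms(2,3)] by simp

lemma smooth_at_add_euclidean:
  assumes "pre_atlas \<A>" "smooth_at \<A> euclidean_atlas f x" "smooth_at \<A> euclidean_atlas g x"
  shows "smooth_at \<A> euclidean_atlas (\<lambda>x. f x + g x) x"
proof -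
  have "smooth_at \<A> euclidean_atlas (\<lambda>x. (\<lambda>p. fst p + snd p) (f x, g x)) x"
    by (rule smooth_at_linear[OF assms(1) smooth_at_Pair_euclidean[OF assms]])
      (intro bounded_linear_add bounded_linear_fst bounded_linear_snd)
  then show ?thesis by simp
qed

lemma smooth_at_diff_euclidean:
  assumes "pre_atlas \<A>" "smooth_at \<A> euclidean_atlas f x" "smooth_at \<A> euclidean_atlas g x"
  shows "smooth_at \<A> euclidean_atlas (\<lambda>x. f x - g x) x"
proof -
  have "smooth_at \<A> euclidean_atlas (\<lambda>x. (\<lambda>p. fst p - snd p) (f x, g x)) x"
    by (rule smooth_at_linear[OF assms(1) smooth_at_Pair_euclidean[OF assms]])
      (intro bounded_linear_sub bounded_linear_fst bounded_linear_snd)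
  then show ?thesis by simp
qed

lemma smooth_at_bilinear_euclidean:
  assumes "pre_atlas \<A>" "smooth_at \<A> euclidean_atlas f x" "smooth_at \<A> euclidean_atlas g x" "bounded_bilinear B"
  shows "smooth_at \<A> euclidean_atlas (\<lambda>x. B (f x) (g x)) x"
proof -
  have "smooth_on UNIV (\<lambda>p. B (fst p) (snd p))"
    unfolding smooth_on_def
    by (intro allI Ck_on_bilinear[OF assms(4) open_UNIV, where f = fst and g = snd]
        Ck_on_bounded_linear bounded_linear_fst bounded_linear_snd)
  then have "smooth_at \<A> euclidean_atlas (\<lambda>x. (\<lambda>p. B (fst p) (snd p)) (f x, g x)) x"
    by (rule smooth_at_euclidean_comp[OF assms(1) smooth_at_Pair_euclidean[OF assms(1-3)]]) auto
  then show ?thesis by simp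
qed

lemma smooth_at_sum_euclidean:
  assumes "pre_atlas \<A>" "finite I" "\<And>i. i \<in> I \<Longrightarrow> smooth_at \<A> euclidean_atlas (f i) x"
  shows "smooth_at \<A> euclidean_atlas (\<lambda>x. \<Sum>i\<in>I. f i x) x"
  using assms(2,3) by (induction I) (auto intro: smooth_at_add_euclidean[OF assms(1)])

section \<open>Cutoff functions on the real line\<close>

text \<open>The family is closed under differentiation up to linear combinations: the derivative of
  \<open>flat n\<close> involves \<open>flat (n + 2)\<close> and \<open>flat (n + 1)\<close>. This
  lets \<open>Ck_on_flat\<close> run by induction for all \<open>n\<close> at once.\<close>

definition flat :: "nat \<Rightarrow> real \<Rightarrow> real" where
  "flat n x = (if x > 0 then exp (- (1 / x)) / x ^ n else 0)"

lemma flat_nonneg: "flat n x \<ge> 0" by (simp add: flat_def)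

lemma flat_nonpos [simp]: "x \<le> 0 \<Longrightarrow> flat n x = 0" by (simp add: flat_def)

text \<open>From (1 + y/m)^m \<le> exp y with m = n + 2 and y = 1/x. Quadratic decay makes the
  difference quotient at 0 vanish in the limit.\<close>

lemma flat_le_square: "flat n x \<le> real (n + 2) ^ (n + 2) * x\<^sup>2"
proof (cases "x > 0")
  case True
  have "(1 / x / real (n + 2)) ^ (n + 2) \<le> (1 + 1 / x / real (n + 2)) ^ (n + 2)"
    using True by (intro power_mono) auto
  also have "\<dots> \<le> exp (1 / x)"
    using True exp_ge_one_plus_x_over_n_power_n[of "n + 2" "1 / x"] by (simp add: order_trans[of _ 0])
  finally have "inverse (exp (1 / x)) \<le> inverse ((1 / x / real (n + 2)) ^ (n + 2))"
    using True by (intro le_imp_inverse_le) auto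
  also have "\<dots> = (real (n + 2) * x) ^ (n + 2)" using True by (simp add: power_inverse[symmetric] field_simps)
  also have "\<dots> = real (n + 2) ^ (n + 2) * x\<^sup>2 * x ^ n" by (simp add: power_mult_distrib power_add power2_eq_square)
  finally have "exp (- (1 / x)) \<le> real (n + 2) ^ (n + 2) * x\<^sup>2 * x ^ n" by (simp add: exp_minus)
  then show ?thesis using True by (simp add: flat_def pos_divide_le_eq)
qed simp

lemma flat_has_real_derivative:
  "(flat n has_real_derivative flat (n + 2) x - real n * flat (n + 1) x) (at x)"
proof (cases "x = 0")
  case True
  define C where "C = real (n + 2) ^ (n + 2)"
  have "((\<lambda>h. (flat n (0 + h) - flat n 0) / h) \<longlongrightarrow> 0) (at 0)"
  proof (rule Lim_null_comparison)
    have "norm (flat n h / h) \<le> C * \<bar>h\<bar>" for h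
    proof (cases "h = 0")
      case False
      then show ?thesis using flat_le_square[of n h] flat_nonneg[of n h]
        by (simp add: C_def field_simps power2_eq_square abs_mult_self_eq)
    qed simp
    then show "\<forall>\<^sub>F h in at 0. norm ((flat n (0 + h) - flat n 0) / h) \<le> C * \<bar>h\<bar>" by simp
    show "((\<lambda>h. C * \<bar>h\<bar>) \<longlongrightarrow> 0) (at 0)"
      by (rule tendsto_eq_intros tendsto_rabs | simp)+
  qed
  then show ?thesis using True by (simp add: DERIV_def)
next
  case False
  show ?thesis
  proof (cases "x > 0")
    case True
    have "((\<lambda>x. exp (- (1 / x)) / x ^ n) has_real_derivative flat (n + 2) x - real n * flat (n + 1) x) (at x)"
    proof (cases n)
      case 0
      then show ?thesis using True
        by (auto intro!: derivative_eq_intros simp: flat_def field_simps power2_eq_square)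
    next
      case (Suc m)
      have "m * (x * x ^ (m - Suc 0)) = m * x ^ m" by (cases m) auto
      then show ?thesis using True Suc power_minus_mult[of m x]
        by (auto intro!: derivative_eq_intros simp: flat_def field_simps power2_eq_square)
    qed
    then show ?thesis
      by (rule has_field_derivative_transform_within_open[where S = "{0<..}"]) (use True in \<open>auto simp: flat_def\<close>)
  next
    case neg: False
    have "((\<lambda>x. 0) has_real_derivative flat (n + 2) x - real n * flat (n + 1) x) (at x)"
      using neg by simp
    then show ?thesis
      by (rule has_field_derivative_transform_within_open[where S = "{..<0}"]) (use neg False in auto)
  qed
qed

lemma Ck_on_flat: "Ck_on k UNIV (flat n)"
proof (induction k arbitrary: n)
  case 0
  then show ?case
    using DERIV_isCont[OF flat_has_real_derivative] by (auto simp: continuous_at_imp_continuous_on)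
next
  case (Suc k)
  have der: "(flat n has_derivative (\<lambda>v. (flat (n + 2) x - real n * flat (n + 1) x) * v)) (at x)" for x n
    using flat_has_real_derivative by (simp add: has_field_derivative_def)
  have "Ck_on k UNIV (\<lambda>x. flat (n + 2) x + (- real n) * flat (n + 1) x)"
    by (intro Ck_on_add Suc.IH open_UNIV Ck_on_linear_comp[OF bounded_linear_mult_right])
  then have "Ck_on k UNIV (\<lambda>x. (flat (n + 2) x - real n * flat (n + 1) x) * v)" for v
    by (intro Ck_on_linear_comp[OF bounded_linear_mult_left]) auto
  then show ?case using der by (auto simp: differentiable_def fd_eqI[OF der])
qed

lemma flat_0_mono: "x \<le> y \<Longrightarrow> flat 0 x \<le> flat 0 y"
  by (auto simp: flat_def frac_le)

lemma flat_0_strict_mono: "0 < y \<Longrightarrow> x < y \<Longrightarrow> flat 0 x < flat 0 y"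
  by (auto simp: flat_def frac_less2)

text \<open>A cutoff built from \<open>flat 0\<close> without integration: since
  \<open>flat 0 1 = exp (- 1)\<close>, the inner difference has its full value
  \<open>exp (- 1)\<close> for t \<le> 0 and is nonpositive for t \<ge> 1.\<close>

definition step :: "real \<Rightarrow> real" where
  "step t = flat 0 (exp (- 1) - flat 0 t) / flat 0 (exp (- 1))"

lemma flat_exp_pos: "flat 0 (exp (- 1)) > 0" by (simp add: flat_def)

lemma step_eq_1: "t \<le> 0 \<Longrightarrow> step t = 1"
  using flat_exp_pos by (simp add: step_def)

lemma step_eq_0: "t \<ge> 1 \<Longrightarrow> step t = 0"
  using flat_0_mono[of 1 t] by (simp add: step_def flat_def[of 0 1])

lemma step_bounds: "0 \<le> step t" "step t \<le> 1"
  using flat_exp_pos flat_nonneg[of 0] flat_0_mono[of "exp (- 1) - flat 0 t" "exp (- 1)"]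
  by (auto simp: step_def)

lemma smooth_on_step: "smooth_on UNIV step"
proof -
  have *: "Ck_on k UNIV (\<lambda>t. exp (- 1) + (- 1) * flat 0 t)" for k
    by (intro Ck_on_add Ck_on_const Ck_on_linear_comp[OF bounded_linear_mult_right] Ck_on_flat open_UNIV)
  have "Ck_on k UNIV (\<lambda>t. flat 0 (exp (- 1) + (- 1) * flat 0 t) / flat 0 (exp (- 1)))" for k
    by (rule Ck_on_linear_comp[OF bounded_linear_divide open_UNIV
          Ck_on_comp[OF open_UNIV open_UNIV subset_UNIV * Ck_on_flat]])
  then show ?thesis by (simp add: smooth_on_def step_def[abs_def])
qed

text \<open>The factor \<open>exp 1\<close> normalises the value at 0 to 1, so a single term at
  distance 0 already reaches the level 1 that will define the soft minimum, while terms at distance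
  at least 1 vanish.\<close>

definition weight :: "real \<Rightarrow> real" where
  "weight s = exp 1 * flat 0 (1 - s)"

lemma weight_eq_0: "s \<ge> 1 \<Longrightarrow> weight s = 0" by (simp add: weight_def)

lemma weight_nonneg: "weight s \<ge> 0" by (simp add: weight_def flat_nonneg)

lemma weight_ge_1: assumes "s \<le> 0" shows "weight s \<ge> 1"
proof -
  have "exp 1 * flat 0 1 \<le> weight s"
    unfolding weight_def using assms by (intro mult_left_mono flat_0_mono) auto
  then show ?thesis by (simp add: flat_def exp_minus)
qed

lemma weight_antimono: "s \<le> t \<Longrightarrow> weight t \<le> weight s"
  by (simp add: weight_def flat_0_mono)

lemma weight_strict_antimono: "s < 1 \<Longrightarrow> s < t \<Longrightarrow> weight t < weight s"
  by (simp add: weight_def flat_0_strict_mono)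

lemma weight_has_real_derivative:
  "\<exists>c. (weight has_real_derivative c) (at s) \<and> c \<le> 0 \<and> (s < 1 \<longrightarrow> c < 0)"
proof -
  have "((\<lambda>s. exp 1 * flat 0 (1 - s)) has_real_derivative exp 1 * (flat 2 (1 - s) * (- 1))) (at s)"
    using flat_has_real_derivative[of 0 "1 - s"]
    by (intro DERIV_cmult DERIV_chain2[where f = "flat 0"] derivative_eq_intros) (auto simp: numeral_2_eq_2)
  then have "(weight has_real_derivative - (exp 1 * flat 2 (1 - s))) (at s)"
    by (simp add: weight_def[abs_def])
  moreover have "flat 2 (1 - s) > 0" if "s < 1" using that by (simp add: flat_def)
  ultimately show ?thesis using flat_nonneg[of 2 "1 - s"] by (intro exI conjI) auto
qed

lemma smooth_on_weight: "smooth_on UNIV weight"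
proof -
  have *: "Ck_on k UNIV (\<lambda>t::real. 1 + (- 1) * t)" for k
    by (intro Ck_on_add Ck_on_const Ck_on_bounded_linear bounded_linear_mult_right open_UNIV)
  have "Ck_on k UNIV (\<lambda>t. exp 1 * flat 0 (1 + (- 1) * t))" for k
    by (rule Ck_on_linear_comp[OF bounded_linear_mult_right open_UNIV
          Ck_on_comp[OF open_UNIV open_UNIV subset_UNIV * Ck_on_flat]])
  then show ?thesis by (simp add: smooth_on_def weight_def[abs_def])
qed

lemma smooth_on_if_smooth_at:
  "(\<And>x. x \<in> S \<Longrightarrow> smooth_at euclidean_atlas euclidean_atlas f x) \<Longrightarrow> smooth_on S f"
  by (rule smooth_on_local) (simp add: smooth_at_euclidean_iff)

lemma continuous_on_weight: "continuous_on S weight"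
  using smooth_on_continuous[OF smooth_on_weight] by (rule continuous_on_subset) simp

section \<open>Almost additive and expanding maps\<close>

text \<open>Additivity gives homogeneity for integer factors. For real \<open>r\<close>, write n r
  as an integer plus a fraction in [0, 1]: n times the defect is bounded independently of n, hence
  the defect is 0.\<close>

lemma linear_if_additive_bounded:
  fixes T :: "'a::real_normed_vector \<Rightarrow> 'b::real_normed_vector"
  assumes add: "\<And>x y. T (x + y) = T x + T y" and bnd: "\<And>x. norm (T x) \<le> C * norm x"
  shows "bounded_linear T"
proof (rule bounded_linear_intro[where K = C])
  have T0: "T 0 = 0" using add[of 0 0] by simp
  have Tneg: "T (- x) = - T x" for x using add[of x "- x"] T0 by (simp add: eq_neg_iff_add_eq_0 add.commute)
  have Tnat: "T (of_nat n *\<^sub>R x) = of_nat n *\<^sub>R T x" for n x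
    by (induction n) (auto simp: T0 add scaleR_add_left)
  have Tint: "T (of_int m *\<^sub>R x) = of_int m *\<^sub>R T x" for m x
    by (cases m) (use Tnat[of _ x] Tneg Tnat[of "Suc _" x] in \<open>auto simp del: of_nat_Suc\<close>)
  show "T (r *\<^sub>R x) = r *\<^sub>R T x" for r x
  proof -
    have C0: "0 \<le> C * norm x" using bnd[of x] norm_ge_zero order_trans by blast
    have le: "norm (T (r *\<^sub>R x) - r *\<^sub>R T x) \<le> 2 * (C * norm x) / n" if "n > 0" for n :: nat
    proof -
      define m where "m = \<lfloor>n * r\<rfloor>"
      define f where "f = n * r - of_int m"
      have f: "0 \<le> f" "f \<le> 1" by (auto simp: f_def m_def) linarith
      have nr: "n * r = of_int m + f" by (simp add: f_def)
      have "n *\<^sub>R (T (r *\<^sub>R x) - r *\<^sub>R T x) = T ((n * r) *\<^sub>R x) - (n * r) *\<^sub>R T x"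
        using Tnat[of n "r *\<^sub>R x"] by (simp add: scaleR_diff_right)
      also have "\<dots> = T (f *\<^sub>R x) - f *\<^sub>R T x"
        unfolding nr scaleR_add_left add Tint by simp
      finally have eq: "n * norm (T (r *\<^sub>R x) - r *\<^sub>R T x) = norm (T (f *\<^sub>R x) - f *\<^sub>R T x)"
        by (metis norm_scaleR abs_of_nat)
      have "norm (T (f *\<^sub>R x) - f *\<^sub>R T x) \<le> norm (T (f *\<^sub>R x)) + norm (f *\<^sub>R T x)"
        by (rule norm_triangle_ineq4)
      also have "\<dots> \<le> f * (C * norm x) + f * (C * norm x)"
        using bnd[of "f *\<^sub>R x"] mult_left_mono[OF bnd[of x] f(1)] f(1)
        by (intro add_mono) (auto simp: ac_simps)
      also have "\<dots> \<le> 1 * (C * norm x) + 1 * (C * norm x)"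
        using f C0 by (intro add_mono mult_right_mono) auto
      finally show ?thesis using eq that by (simp add: field_simps)
    qed
    have "\<forall>\<^sub>F n in sequentially. norm (T (r *\<^sub>R x) - r *\<^sub>R T x) \<le> 2 * (C * norm x) / n"
      using eventually_gt_at_top[of 0] by eventually_elim (rule le)
    then have "norm (T (r *\<^sub>R x) - r *\<^sub>R T x) \<le> 0"
      by (intro tendsto_lowerbound[OF lim_const_over_n[of "2 * (C * norm x)"]]) auto
    then show ?thesis by simp
  qed
qed (use add bnd in \<open>auto simp: mult.commute\<close>)

text \<open>The derivative is the limit of \<open>n q(Y/n)\<close>, a Cauchy sequence.\<close>

lemma almost_additive_differentiable:
  fixes q :: "'a::euclidean_space \<Rightarrow> 'b::euclidean_space"
  assumes A: "\<And>\<eta>. \<eta> > 0 \<Longrightarrow> \<exists>\<rho>>0. \<forall>Y Z. norm Y < \<rho> \<longrightarrow> norm Z < \<rho> \<longrightarrow> norm (q (Y + Z) - q Y - q Z) \<le> \<eta> * norm Z"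
    and C: "\<rho>0 > 0" "\<And>Y. norm Y < \<rho>0 \<Longrightarrow> norm (q Y) \<le> C * norm Y"
  shows "\<exists>T. (q has_derivative T) (at 0)"
proof -
  define T where "T n Y = n *\<^sub>R q (Y /\<^sub>R n)" for n :: nat and Y
  have q0: "q 0 = 0" using C(2)[of 0] C(1) by simp
  \<comment> \<open>Telescoping: adding one more copy of \<open>Y\<close> to a multiple of
    \<open>Y\<close> costs at most \<open>\<eta> * norm Y\<close>.\<close>
  have B: "\<exists>\<rho>>0. \<forall>Y. \<forall>n::nat. n * norm Y < \<rho> \<longrightarrow> norm (n *\<^sub>R q Y - q (n *\<^sub>R Y)) \<le> \<eta> * (n * norm Y)"
    if \<eta>: "\<eta> > 0" for \<eta>
  proof -
    obtain \<rho> where \<rho>: "\<rho> > 0"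
      "\<And>Y Z. norm Y < \<rho> \<Longrightarrow> norm Z < \<rho> \<Longrightarrow> norm (q (Y + Z) - q Y - q Z) \<le> \<eta> * norm Z"
      using A[OF \<eta>] by blast
    have "norm (n *\<^sub>R q Y - q (n *\<^sub>R Y)) \<le> \<eta> * (n * norm Y)" if "n * norm Y < \<rho>" for Y and n :: nat
      using that
    proof (induction n)
      case 0
      then show ?case by (simp add: q0)
    next
      case (Suc n)
      have "real n * norm Y \<le> Suc n * norm Y" "1 * norm Y \<le> Suc n * norm Y" by (intro mult_right_mono; simp)+
      then have small: "n * norm Y < \<rho>" "norm Y < \<rho>" using Suc.prems by auto
      have "norm ((n *\<^sub>R q Y - q (n *\<^sub>R Y)) - (q (n *\<^sub>R Y + Y) - q (n *\<^sub>R Y) - q Y)) \<le> \<eta> * (n * norm Y) + \<eta> * norm Y"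
      proof (rule order_trans[OF norm_triangle_ineq4 add_mono[OF Suc.IH[OF small(1)]]])
        show "norm (q (n *\<^sub>R Y + Y) - q (n *\<^sub>R Y) - q Y) \<le> \<eta> * norm Y" using small by (intro \<rho>(2)) auto
      qed
      then show ?case by (simp add: algebra_simps)
    qed
    then show ?thesis using \<rho>(1) by blast
  qed
  \<comment> \<open>\<open>T n\<close> and \<open>T m\<close> are both compared with the common
    refinement \<open>T (n * m)\<close>.\<close>
  have close: "\<exists>\<rho>>0. \<forall>Y n m. 0 < n \<longrightarrow> 0 < m \<longrightarrow> norm Y < \<rho> * n \<longrightarrow> norm Y < \<rho> * m \<longrightarrow> norm (T n Y - T m Y) \<le> 2 * \<eta> * norm Y"
    if \<eta>: "\<eta> > 0" for \<eta>
  proof -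
    obtain \<rho> where \<rho>: "\<rho> > 0"
      "\<And>Y n. real n * norm Y < \<rho> \<Longrightarrow> norm (n *\<^sub>R q Y - q (n *\<^sub>R Y)) \<le> \<eta> * (n * norm Y)"
      using B[OF \<eta>] by blast
    have half: "norm (T (n * m) Y - T n Y) \<le> \<eta> * norm Y" if "0 < n" "0 < m" "norm Y < \<rho> * n" for n m Y
    proof -
      define Z where "Z = Y /\<^sub>R (n * m)"
      have Z: "m *\<^sub>R Z = Y /\<^sub>R n" "m * norm Z = norm Y / n" using that by (auto simp: Z_def divide_inverse)
      have "norm (m *\<^sub>R q Z - q (m *\<^sub>R Z)) \<le> \<eta> * (m * norm Z)"
        using that by (intro \<rho>(2)) (simp add: Z(2) field_simps)
      then have "n * norm (m *\<^sub>R q Z - q (m *\<^sub>R Z)) \<le> n * (\<eta> * (m * norm Z))" by (intro mult_left_mono) auto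
      also have "\<dots> = \<eta> * norm Y" using that by (simp add: Z(2))
      also have "n * norm (m *\<^sub>R q Z - q (m *\<^sub>R Z)) = norm (T (n * m) Y - T n Y)"
      proof -
        have "T (n * m) Y - T n Y = n *\<^sub>R (m *\<^sub>R q Z - q (m *\<^sub>R Z))"
          by (simp add: T_def Z(1) scaleR_diff_right) (simp add: Z_def)
        then show ?thesis by simp
      qed
      finally show ?thesis .
    qed
    have "norm (T n Y - T m Y) \<le> 2 * \<eta> * norm Y"
      if "0 < n" "0 < m" "norm Y < \<rho> * n" "norm Y < \<rho> * m" for n m Y
      using half[of n m Y] half[of m n Y] that norm_triangle_ineq4[of "T (n * m) Y - T n Y" "T (m * n) Y - T m Y"]
      by (simp add: mult.commute[of m n] norm_minus_commute)
    then show ?thesis using \<rho>(1) by blast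
  qed
  have ev: "\<forall>\<^sub>F n in sequentially. 0 < n \<and> norm Y < \<rho> * real n" if "\<rho> > 0" for \<rho> and Y :: 'a
  proof -
    obtain N :: nat where N: "norm Y / \<rho> < N" using reals_Archimedean2 by blast
    show ?thesis
      using eventually_gt_at_top[of 0] eventually_ge_at_top[of N]
    proof eventually_elim
      case (elim n)
      then have "norm Y / \<rho> < n" using N by linarith
      then show ?case using elim that by (simp add: field_simps)
    qed
  qed
  have "Cauchy (\<lambda>n. T n Y)" for Y
  proof (rule CauchyI)
    fix \<epsilon> :: real assume "\<epsilon> > 0"
    define D where "D = norm Y + 1"
    have nY: "D > 0" "norm Y \<le> D" unfolding D_def by (smt (verit) norm_ge_zero)+
    define \<eta> where "\<eta> = \<epsilon> / (4 * D)"
    have \<eta>: "\<eta> > 0" using \<open>\<epsilon> > 0\<close> nY by (simp add: \<eta>_def)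
    obtain \<rho> where \<rho>: "\<rho> > 0" "\<And>Y n m. 0 < n \<Longrightarrow> 0 < m \<Longrightarrow> norm Y < \<rho> * real n \<Longrightarrow> norm Y < \<rho> * real m \<Longrightarrow> norm (T n Y - T m Y) \<le> 2 * \<eta> * norm Y"
      using close[OF \<eta>] by blast
    obtain N where N: "\<And>n. n \<ge> N \<Longrightarrow> 0 < n \<and> norm Y < \<rho> * real n"
      using ev[OF \<rho>(1)] unfolding eventually_sequentially by blast
    have "2 * \<eta> * norm Y \<le> 2 * \<eta> * D" using \<eta> nY by simp
    also have "\<dots> = \<epsilon> / 2" using nY by (simp add: \<eta>_def)
    also have "\<dots> < \<epsilon>" using \<open>\<epsilon> > 0\<close> by simp
    finally have "2 * \<eta> * norm Y < \<epsilon>" .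
    then show "\<exists>M. \<forall>m\<ge>M. \<forall>n\<ge>M. norm (T m Y - T n Y) < \<epsilon>"
      using N \<rho>(2) by (meson le_less_trans)
  qed
  then have "\<exists>L. (\<lambda>n. T n Y) \<longlonglongrightarrow> L" for Y by (simp add: Cauchy_convergent convergent_def[symmetric])
  then obtain L where L: "\<And>Y. (\<lambda>n. T n Y) \<longlonglongrightarrow> L Y" by metis
  \<comment> \<open>\<open>T 1 Y\<close> is \<open>q Y\<close>, so the Cauchy estimate between index
    1 and an index tending to infinity bounds \<open>q Y - L Y\<close>.\<close>
  have Lclose: "\<exists>\<rho>>0. \<forall>Y. norm Y < \<rho> \<longrightarrow> norm (q Y - L Y) \<le> \<epsilon> * norm Y" if \<epsilon>: "\<epsilon> > 0" for \<epsilon>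
  proof -
    obtain \<rho> where \<rho>: "\<rho> > 0" "\<And>Y n m. 0 < n \<Longrightarrow> 0 < m \<Longrightarrow> norm Y < \<rho> * real n \<Longrightarrow> norm Y < \<rho> * real m \<Longrightarrow> norm (T n Y - T m Y) \<le> 2 * (\<epsilon> / 2) * norm Y"
      using close[OF half_gt_zero[OF \<epsilon>]] by blast
    have "norm (q Y - L Y) \<le> \<epsilon> * norm Y" if "norm Y < \<rho>" for Y
    proof -
      have "\<forall>\<^sub>F m in sequentially. norm (T 1 Y - T m Y) \<le> \<epsilon> * norm Y"
        using ev[OF \<rho>(1), of Y] by eventually_elim (use \<rho>(2)[of 1 _ Y] that in auto)
      moreover have "(\<lambda>m. norm (T 1 Y - T m Y)) \<longlonglongrightarrow> norm (T 1 Y - L Y)" by (intro tendsto_intros L)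
      ultimately have "norm (T 1 Y - L Y) \<le> \<epsilon> * norm Y" by (intro tendsto_upperbound) auto
      then show ?thesis by (simp add: T_def)
    qed
    then show ?thesis using \<rho>(1) by blast
  qed
  have "bounded_linear L"
  proof (rule linear_if_additive_bounded)
    show "norm (L Y) \<le> C * norm Y" for Y
    proof (rule tendsto_upperbound[OF tendsto_norm[OF L[of Y]]])
      show "\<forall>\<^sub>F n in sequentially. norm (T n Y) \<le> C * norm Y"
        using ev[OF C(1), of Y]
      proof eventually_elim
        case (elim n)
        then have "norm (Y /\<^sub>R n) < \<rho>0" by (simp add: field_simps)
        from C(2)[OF this] show ?case using elim by (simp add: T_def field_simps)
      qed
    qed simp
    show "L (Y + Z) = L Y + L Z" for Y Z
    proof -
      have "(\<lambda>n. T n (Y + Z) - T n Y - T n Z) \<longlonglongrightarrow> 0"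
        unfolding tendsto_iff
      proof (intro allI impI)
        fix \<epsilon> :: real assume "\<epsilon> > 0"
        define D where "D = norm Z + 1"
        have nZ: "D > 0" "norm Z \<le> D" unfolding D_def by (smt (verit) norm_ge_zero)+
        define \<eta> where "\<eta> = \<epsilon> / (2 * D)"
        have \<eta>: "\<eta> > 0" using \<open>\<epsilon> > 0\<close> nZ by (simp add: \<eta>_def)
        have "\<eta> * norm Z \<le> \<eta> * D" using \<eta> nZ by simp
        also have "\<dots> = \<epsilon> / 2" using nZ by (simp add: \<eta>_def)
        also have "\<dots> < \<epsilon>" using \<open>\<epsilon> > 0\<close> by simp
        finally have \<eta>Z: "\<eta> * norm Z < \<epsilon>" .
        obtain \<rho> where \<rho>: "\<rho> > 0"
          "\<And>Y Z. norm Y < \<rho> \<Longrightarrow> norm Z < \<rho> \<Longrightarrow> norm (q (Y + Z) - q Y - q Z) \<le> \<eta> * norm Z"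
          using A[OF \<eta>] by blast
        show "\<forall>\<^sub>F n in sequentially. dist (T n (Y + Z) - T n Y - T n Z) 0 < \<epsilon>"
          using ev[OF \<rho>(1), of Y] ev[OF \<rho>(1), of Z]
        proof eventually_elim
          case (elim n)
          have "norm (q (Y /\<^sub>R n + Z /\<^sub>R n) - q (Y /\<^sub>R n) - q (Z /\<^sub>R n)) \<le> \<eta> * norm (Z /\<^sub>R n)"
            using elim by (intro \<rho>(2)) (auto simp: field_simps)
          then have "n * norm (q (Y /\<^sub>R n + Z /\<^sub>R n) - q (Y /\<^sub>R n) - q (Z /\<^sub>R n)) \<le> n * (\<eta> * norm (Z /\<^sub>R n))"
            by (intro mult_left_mono) auto
          also have "\<dots> = \<eta> * norm Z" using elim by simp
          also have "n * norm (q (Y /\<^sub>R n + Z /\<^sub>R n) - q (Y /\<^sub>R n) - q (Z /\<^sub>R n)) = norm (T n (Y + Z) - T n Y - T n Z)"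
          proof -
            have "T n (Y + Z) - T n Y - T n Z = n *\<^sub>R (q (Y /\<^sub>R n + Z /\<^sub>R n) - q (Y /\<^sub>R n) - q (Z /\<^sub>R n))"
              by (simp add: T_def scaleR_diff_right scaleR_add_right)
            then show ?thesis by simp
          qed
          finally show ?case using \<eta>Z by simp
        qed
      qed
      moreover have "(\<lambda>n. T n (Y + Z) - T n Y - T n Z) \<longlonglongrightarrow> L (Y + Z) - L Y - L Z"
        by (intro tendsto_intros L)
      ultimately have "L (Y + Z) - L Y - L Z = 0" using LIMSEQ_unique by blast
      then show ?thesis by (simp add: algebra_simps)
    qed
  qed
  then have "(q has_derivative L) (at 0)"
    unfolding has_derivative_at_alt using Lclose by (simp add: q0)
  then show ?thesis by blast
qed

text \<open>Along a kernel direction \<open>f\<close> would move by less than any fixed multiple of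
  the step, against the lower bound. For the identity minus a contraction this supplies the
  injectivity required by the implicit function theorem.\<close>

lemma lower_lipschitz_derivative:
  fixes f :: "'a::real_normed_vector \<Rightarrow> 'b::real_normed_vector"
  assumes f: "(f has_derivative D) (at x)" and c: "c > 0" "\<And>y z. c * norm (y - z) \<le> norm (f y - f z)" and D: "D w = 0"
  shows "w = 0"
proof (rule ccontr)
  assume w: "w \<noteq> 0"
  obtain r where r: "r > 0" "\<And>y. norm (y - x) < r \<Longrightarrow> norm (f y - f x - D (y - x)) \<le> c / 2 * norm (y - x)"
    using f c(1) unfolding has_derivative_at_alt by (meson half_gt_zero)
  define t where "t = r / (2 * norm w)"
  have t: "t > 0" "norm (t *\<^sub>R w) < r" using r(1) w by (auto simp: t_def)
  have "D (t *\<^sub>R w) = 0" using D linear_cmul[OF has_derivative_linear[OF f]] by simp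
  then have "norm (f (x + t *\<^sub>R w) - f x) \<le> c / 2 * norm (t *\<^sub>R w)" using r(2)[of "x + t *\<^sub>R w"] t(2) by simp
  then have "c * norm (t *\<^sub>R w) \<le> c / 2 * norm (t *\<^sub>R w)" using c(2)[of "x + t *\<^sub>R w" x] by simp
  then show False using c(1) t(1) w by simp
qed

section \<open>Dyadic sums\<close>

text \<open>Any two exponents in the window differ by at most \<open>M\<close>, wherever the window
  lies.\<close>

lemma dyadic_card:
  fixes a :: real
  assumes "a > 0"
  shows "finite {j::nat. a \<le> 2 ^ j \<and> 2 ^ j \<le> 2 ^ M * a}" "card {j::nat. a \<le> 2 ^ j \<and> 2 ^ j \<le> 2 ^ M * a} \<le> M + 1"
proof -
  let ?S = "{j::nat. a \<le> 2 ^ j \<and> 2 ^ j \<le> 2 ^ M * a}"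
  have "finite ?S \<and> card ?S \<le> M + 1"
  proof (cases "?S = {}")
    case False
    define j0 where "j0 = (LEAST j. j \<in> ?S)"
    have j0: "j0 \<in> ?S" unfolding j0_def by (rule LeastI_ex) (use False in blast)
    have "?S \<subseteq> {j0..j0 + M}"
    proof
      fix j assume j: "j \<in> ?S"
      have "(2::real) ^ j \<le> 2 ^ M * a" using j by simp
      also have "\<dots> \<le> 2 ^ M * 2 ^ j0" using j0 by (intro mult_left_mono) auto
      finally have "(2::real) ^ j \<le> 2 ^ (j0 + M)" by (simp add: power_add mult.commute)
      then have "j \<le> j0 + M" by (rule power_le_imp_le_exp[rotated]) simp
      moreover have "j0 \<le> j" unfolding j0_def using j by (rule Least_le)
      ultimately show "j \<in> {j0..j0 + M}" by simp
    qed
    then show ?thesis using card_mono[of "{j0..j0 + M}" ?S] finite_subset[of ?S "{j0..j0 + M}"] by simp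
  next
    case True
    show ?thesis unfolding True by simp
  qed
  then show "finite ?S" "card ?S \<le> M + 1" by auto
qed

lemma dyadic_sum_le:
  fixes t :: real
  assumes "t \<ge> 0" shows "(\<Sum>j<n. if 2 ^ j \<le> t then 2 ^ j else 0) \<le> 2 * t"
proof (induction n)
  case (Suc n)
  show ?case
  proof (cases "2 ^ n \<le> t")
    case True
    have "(\<Sum>j<Suc n. if 2 ^ j \<le> t then 2 ^ j else 0) \<le> (\<Sum>j<Suc n. (2::real) ^ j)"
      by (intro sum_mono) auto
    also have "\<dots> = 2 ^ Suc n - 1" by (subst geometric_sum) auto
    also have "\<dots> \<le> 2 * t" using True by simp
    finally show ?thesis .
  qed (use Suc in simp)
qed (use assms in simp)

lemma dyadic_sum_ge:
  fixes t :: real and c :: "nat \<Rightarrow> real"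
  assumes "\<And>j. c j \<ge> 0" "\<And>j. 2 ^ j \<le> t \<Longrightarrow> c j = 1"
  shows "min (2 ^ n) t - 1 \<le> (\<Sum>j<n. 2 ^ j * c j)"
proof (induction n)
  case (Suc n)
  show ?case
  proof (cases "2 ^ n \<le> t")
    case True
    have "min (2 ^ Suc n) t - 1 \<le> (2 ^ n - 1) + 2 ^ n" by simp
    also have "\<dots> \<le> (\<Sum>j<Suc n. 2 ^ j * c j)" using Suc True assms(2)[OF True] by simp
    finally show ?thesis .
  next
    case False
    have "0 \<le> 2 ^ n * c n" using assms(1) by simp
    then show ?thesis using Suc False by simp
  qed
qed simp

text \<open>Bounds the change of a sum over dyadic scales without a logarithmic loss. If
  \<open>s' \<le> 2 * s\<close>, at most \<open>m + 2\<close> scales contribute, each at most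
  \<open>L * D\<close>. Otherwise \<open>D\<close> exceeds \<open>s' / 2\<close>, and the terms, at
  most \<open>2 ^ j\<close> with \<open>2 ^ j \<le> s' / r0\<close>, are dominated by a geometric
  sum.\<close>

lemma dyadic_difference_sum:
  fixes T :: "nat \<Rightarrow> real"
  assumes pos: "r0 > 0" "R0 > 0" "R0 \<le> 2 ^ m * r0" "L \<ge> 0" "0 \<le> s" "s \<le> s'" "s' \<le> s + D"
    and T: "\<And>j. 0 \<le> T j" "\<And>j. T j \<le> L * D" "\<And>j. T j \<le> 2 ^ j"
      "\<And>j. T j \<noteq> 0 \<Longrightarrow> r0 * 2 ^ j \<le> s' \<and> s \<le> R0 * 2 ^ j"
  shows "(\<Sum>j<n. T j) \<le> ((real m + 2) * L + 4 / r0) * D"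
proof -
  have D: "D \<ge> 0" using pos by simp
  have e: "((real m + 2) * L + 4 / r0) * D = (real m + 2) * (L * D) + 4 * D / r0" by (simp add: algebra_simps)
  have LD: "0 \<le> (real m + 2) * (L * D)" "0 \<le> 4 * D / r0" using pos D by auto
  show ?thesis
  proof (cases "s' \<le> 2 * s")
    case True
    show ?thesis
    proof (cases "s = 0")
      case True
      then have "T j = 0" for j
        using T(4)[of j] \<open>s' \<le> 2 * s\<close> pos(1) by (smt (verit) mult_pos_pos zero_less_power)
      then show ?thesis using e LD by simp
    next
      case False
      define a where "a = s / R0"
      have a: "a > 0" using False pos by (simp add: a_def)
      let ?S = "{j::nat. a \<le> 2 ^ j \<and> 2 ^ j \<le> 2 ^ (m + 1) * a}"
      note S = dyadic_card[OF a, of "m + 1"]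
      have sub: "j \<in> ?S" if "T j \<noteq> 0" for j
      proof -
        from T(4)[OF that] have 1: "r0 * 2 ^ j \<le> s'" "s \<le> R0 * 2 ^ j" by auto
        have "R0 * 2 ^ j \<le> 2 ^ m * r0 * 2 ^ j" using pos by (intro mult_right_mono) auto
        also have "\<dots> = 2 ^ m * (r0 * 2 ^ j)" by simp
        also have "\<dots> \<le> 2 ^ m * (2 * s)" using 1 True by (intro mult_left_mono) auto
        finally have "R0 * 2 ^ j \<le> 2 ^ (m + 1) * s" by simp
        then show ?thesis using 1 pos(2) by (simp add: a_def field_simps)
      qed
      have "(\<Sum>j<n. T j) \<le> (\<Sum>j\<in>?S. T j)"
      proof -
        have "(\<Sum>j<n. T j) = (\<Sum>j\<in>{..<n} \<inter> ?S. T j)"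
          by (rule sum.mono_neutral_right) (use sub in auto)
        also have "\<dots> \<le> (\<Sum>j\<in>?S. T j)" using S(1) T(1) by (intro sum_mono2) auto
        finally show ?thesis .
      qed
      also have "\<dots> \<le> (\<Sum>j\<in>?S. L * D)" by (intro sum_mono T)
      also have "\<dots> = real (card ?S) * (L * D)" by simp
      also have "\<dots> \<le> (real m + 2) * (L * D)" using S(2) pos(4) D by (intro mult_right_mono) auto
      also have "\<dots> \<le> ((real m + 2) * L + 4 / r0) * D" using e LD by simp
      finally show ?thesis .
    qed
  next
    case False
    have t: "s' / r0 \<ge> 0" using pos by simp
    have "(\<Sum>j<n. T j) \<le> (\<Sum>j<n. if 2 ^ j \<le> s' / r0 then 2 ^ j else 0)"
    proof (intro sum_mono)
      fix j
      show "T j \<le> (if 2 ^ j \<le> s' / r0 then 2 ^ j else 0)"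
        using T(3)[of j] T(4)[of j] pos(1) by (cases "T j = 0") (auto simp: field_simps)
    qed
    also have "\<dots> \<le> 2 * (s' / r0)" using t by (rule dyadic_sum_le)
    also have "\<dots> \<le> 4 * D / r0" using False pos by (simp add: divide_right_mono)
    also have "\<dots> \<le> ((real m + 2) * L + 4 / r0) * D" using e LD by simp
    finally show ?thesis .
  qed
qed

section \<open>Distance and dilations\<close>

locale carnot_splitting =
  fixes \<A> :: "('g::{group_add, t2_space, second_countable_topology}, 'a::euclidean_space) chart set"
    and e :: "('g, 'a) chart"
    and s :: nat
    and g :: "nat \<Rightarrow> 'a set"
    and \<delta> :: "real \<Rightarrow> 'g \<Rightarrow> 'g"
    and d :: "'g \<Rightarrow> 'g \<Rightarrow> real"
    and W V :: "'g set"
  assumes carnot: "carnot_group \<A> e s g \<delta>"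
    and homdist: "homogeneous_distance \<delta> d"
    and W: "homogeneous_subgroup \<A> \<delta> W"
    and V: "homogeneous_subgroup \<A> \<delta> V"
    and WV: "complementary W V"
    and Vnz: "V \<noteq> {0}"
    and Vhor: "horizontal \<A> e g V"
begin

abbreviation nrm :: "'g \<Rightarrow> real" where "nrm x \<equiv> d 0 x"
abbreviation EU :: "('b::euclidean_space, 'b) chart set" where "EU \<equiv> euclidean_atlas"

sublocale dm: Metric_space UNIV d
  using homdist by (simp add: homogeneous_distance_def)

lemma mtop: "dm.mtopology = euclidean"
  using homdist by (simp add: homogeneous_distance_def)

lemma d_translate: "d (z + x) (z + y) = d x y"
  using homdist by (simp add: homogeneous_distance_def)

lemma d_nrm: "d x y = nrm (- x + y)"
  using d_translate[of "- x" x y] by simp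

lemma nrm_nonneg: "nrm x \<ge> 0" by simp

lemma nrm_uminus [simp]: "nrm (- x) = nrm x"
  using d_translate[of x 0 "- x"] by (simp add: dm.commute)

lemma nrm_add: "nrm (x + y) \<le> nrm x + nrm y"
  using dm.triangle[of 0 x "x + y"] d_translate[of x 0 y] by simp

lemma nrm_diff: "\<bar>nrm x - nrm y\<bar> \<le> d x y"
  using dm.triangle[of 0 x y] dm.triangle[of 0 y x] by (simp add: dm.commute)

lemma nrm_delta: "r > 0 \<Longrightarrow> nrm (\<delta> r x) = r * nrm x"
proof -
  assume r: "r > 0"
  have "\<delta> r (0 + 0) = \<delta> r 0 + \<delta> r 0"
    using carnot r unfolding carnot_group_def dilations_def lie_automorphism_def by blast
  then have "\<delta> r 0 = 0" by (metis add.right_neutral add_left_cancel)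
  moreover have "d (\<delta> r 0) (\<delta> r x) = r * d 0 x"
    using homdist r unfolding homogeneous_distance_def by blast
  ultimately show ?thesis by simp
qed

lemma open_iff: "open S \<longleftrightarrow> (\<forall>x\<in>S. \<exists>r>0. \<forall>y. d x y < r \<longrightarrow> y \<in> S)"
proof -
  have "open S \<longleftrightarrow> openin dm.mtopology S" by (simp add: mtop open_openin[symmetric])
  then show ?thesis by (auto simp: dm.openin_mtopology subset_iff)
qed

lemma open_ball_d: "open {y. d x y < r}"
  unfolding open_iff
proof
  fix y assume "y \<in> {y. d x y < r}"
  then show "\<exists>ra>0. \<forall>z. d y z < ra \<longrightarrow> z \<in> {y. d x y < r}"
    using dm.triangle[of x y] by (intro exI[of _ "r - d x y"]) (smt (verit) mem_Collect_eq UNIV_I)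
qed

lemma nrm_ball_subset:
  assumes "open S" "0 \<in> S" obtains r where "r > 0" "\<And>y. nrm y < r \<Longrightarrow> y \<in> S"
  using assms unfolding open_iff by blast

lemma tendsto_iff_d: "(f \<longlongrightarrow> l) F \<longleftrightarrow> ((\<lambda>z. d l (f z)) \<longlongrightarrow> 0) F"
proof
  assume f: "(f \<longlongrightarrow> l) F"
  show "((\<lambda>z. d l (f z)) \<longlongrightarrow> 0) F"
    unfolding tendsto_iff using topological_tendstoD[OF f open_ball_d[of l]]
    by (auto simp: dist_real_def)
next
  assume f: "((\<lambda>z. d l (f z)) \<longlongrightarrow> 0) F"
  show "(f \<longlongrightarrow> l) F"
  proof (rule topological_tendstoI)
    fix S assume "open S" "l \<in> S"
    then obtain r where r: "r > 0" "\<And>y. d l y < r \<Longrightarrow> y \<in> S" unfolding open_iff by blast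
    have "\<forall>\<^sub>F z in F. d l (f z) < r" using order_tendstoD(2)[OF f r(1)] .
    then show "\<forall>\<^sub>F z in F. f z \<in> S" by eventually_elim (rule r)
  qed
qed

lemma tendsto_nrm: "(f \<longlongrightarrow> l) F \<Longrightarrow> ((\<lambda>z. nrm (f z)) \<longlongrightarrow> nrm l) F"
proof -
  assume "(f \<longlongrightarrow> l) F"
  then have "((\<lambda>z. d l (f z)) \<longlongrightarrow> 0) F" by (simp add: tendsto_iff_d)
  moreover have "norm (nrm (f z) - nrm l) \<le> d l (f z)" for z
    using nrm_diff[of l "f z"] by (simp add: abs_le_iff)
  then have "\<forall>\<^sub>F z in F. norm (nrm (f z) - nrm l) \<le> d l (f z)" by simp
  ultimately have "((\<lambda>z. nrm (f z) - nrm l) \<longlongrightarrow> 0) F"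
    by (rule Lim_null_comparison[rotated])
  then show ?thesis by (simp add: LIM_zero_iff)
qed

section \<open>Smoothness of the group operations and dilations\<close>

lemma is_lie_group: "lie_group \<A>" using carnot by (simp add: carnot_group_def)

lemma is_smooth_atlas: "smooth_atlas \<A>" using is_lie_group by (simp add: lie_group_def)
lemma is_pre_atlas: "pre_atlas \<A>" using is_smooth_atlas by (rule pre_atlas_smooth_atlas)

lemma smooth_at_mult:
  assumes "pre_atlas \<B>" "smooth_at \<B> \<A> f x" "smooth_at \<B> \<A> h x"
  shows "smooth_at \<B> \<A> (\<lambda>x. f x + h x) x"
proof -
  have "smooth_at (prod_atlas \<A> \<A>) \<A> (\<lambda>(x, y). x + y) (f x, h x)"
    using is_lie_group by (auto simp: lie_group_def intro: smooth_at_if_smooth_map_on)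
  from smooth_at_comp[OF assms(1) pre_atlas_prod[OF is_pre_atlas is_pre_atlas] is_pre_atlas smooth_at_Pair[OF assms(1) is_pre_atlas is_pre_atlas assms(2,3)] this]
  show ?thesis by simp
qed

lemma smooth_at_uminus:
  assumes "pre_atlas \<B>" "smooth_at \<B> \<A> f x"
  shows "smooth_at \<B> \<A> (\<lambda>x. - f x) x"
proof -
  have "smooth_at \<A> \<A> uminus (f x)"
    using is_lie_group by (auto simp: lie_group_def intro: smooth_at_if_smooth_map_on)
  from smooth_at_comp[OF assms(1) is_pre_atlas is_pre_atlas assms(2) this] show ?thesis .
qed

lemma delta_auto: "r > 0 \<Longrightarrow> lie_automorphism \<A> (\<delta> r)"
  using carnot by (simp add: carnot_group_def dilations_def)

lemma delta_add: "r > 0 \<Longrightarrow> \<delta> r (x + y) = \<delta> r x + \<delta> r y"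
  using delta_auto by (simp add: lie_automorphism_def)

lemma delta_0: "r > 0 \<Longrightarrow> \<delta> r 0 = 0"
  using delta_add[of r 0 0] by (metis add.right_neutral add_left_cancel)

lemma delta_uminus: "r > 0 \<Longrightarrow> \<delta> r (- x) = - \<delta> r x"
  using delta_add[of r x "- x"] delta_0[of r] by (metis add.right_inverse add_eq_0_iff)

lemma bij_delta: "r > 0 \<Longrightarrow> bij (\<delta> r)"
  using delta_auto by (simp add: lie_automorphism_def)

lemma smooth_at_delta:
  assumes "r > 0" "pre_atlas \<B>" "smooth_at \<B> \<A> f x"
  shows "smooth_at \<B> \<A> (\<lambda>x. \<delta> r (f x)) x"
proof -
  have "smooth_at \<A> \<A> (\<delta> r) (f x)"
    using delta_auto[OF assms(1)] by (auto simp: lie_automorphism_def intro: smooth_at_if_smooth_map_on)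
  from smooth_at_comp[OF assms(2) is_pre_atlas is_pre_atlas assms(3) this] show ?thesis .
qed

lemma tendsto_group_add:
  assumes "(f \<longlongrightarrow> (a::'g)) F" "(h \<longlongrightarrow> b) F" shows "((\<lambda>z. f z + h z) \<longlongrightarrow> a + b) F"
proof -
  have "continuous_on UNIV (\<lambda>p::'g \<times> 'g. fst p + snd p)"
    using is_lie_group by (simp add: lie_group_def smooth_map_on_def case_prod_beta')
  then have "isCont (\<lambda>p::'g \<times> 'g. fst p + snd p) (a, b)" by (simp add: continuous_on_eq_continuous_at)
  from isCont_tendsto_compose[OF this tendsto_Pair[OF assms]] show ?thesis by simp
qed

lemma tendsto_group_uminus: "(f \<longlongrightarrow> (a::'g)) F \<Longrightarrow> ((\<lambda>z. - f z) \<longlongrightarrow> - a) F"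
proof -
  assume f: "(f \<longlongrightarrow> a) F"
  have "continuous_on UNIV (uminus :: 'g \<Rightarrow> 'g)"
    using is_lie_group by (simp add: lie_group_def smooth_map_on_def)
  then have "isCont uminus a" by (simp add: continuous_on_eq_continuous_at)
  from isCont_tendsto_compose[OF this f] show ?thesis .
qed

section \<open>The group in coordinates around the identity\<close>

text \<open>\<open>k\<close> is the coordinate map \<open>e\<close>, translated such that \<open>k 0 = 0\<close>; \<open>B r\<close> is a ball in these coordinates.\<close>

definition U where "U = fst e"
definition k where "k x = snd e x - snd e 0"
definition k' where "k' X = inv_into (fst e) (snd e) (X + snd e 0)"
definition K where "K = k ` U"
definition B where "B r = {x\<in>U. norm (k x) < r}"

lemma e_chart: "is_chart (U, snd e)" "\<And>c'. c' \<in> \<A> \<Longrightarrow> compatible (U, snd e) c'" "0 \<in> U"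
  using carnot by (auto simp: carnot_group_def maximal_atlas_def U_def)

lemma open_U: "open U" using is_chartD(1)[OF e_chart(1)] .

lemma K_eq: "K = (\<lambda>X. X - snd e 0) ` (snd e ` U)"
  by (auto simp: K_def k_def)

lemma open_K: "open K"
  unfolding K_eq using open_translation_subtract[OF is_chartD(2)[OF e_chart(1)]] .

lemma k_0 [simp]: "k 0 = 0" by (simp add: k_def)

lemma zero_in_K: "0 \<in> K" using e_chart(3) k_0 unfolding K_def by (metis imageI)

lemma k'_k: "x \<in> U \<Longrightarrow> k' (k x) = x"
  using is_chartD(6)[OF e_chart(1)] by (simp add: k'_def k_def U_def)

lemma k_k': "X \<in> K \<Longrightarrow> k (k' X) = X" and k'_in_U: "X \<in> K \<Longrightarrow> k' X \<in> U"
  using k'_k by (auto simp: K_def)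

lemma k_eq_0: "x \<in> U \<Longrightarrow> k x = 0 \<Longrightarrow> x = 0"
  using k'_k e_chart(3) k_0 by metis

lemma k'_0 [simp]: "k' 0 = 0" using k'_k[OF e_chart(3)] by simp

lemma smooth_at_k:
  assumes "pre_atlas \<B>" "smooth_at \<B> \<A> f x" "f x \<in> U"
  shows "smooth_at \<B> EU (\<lambda>x. k (f x)) x"
proof -
  have "smooth_at \<A> EU (snd e) (f x)"
    by (rule smooth_at_compatible_chart[OF is_pre_atlas e_chart(1,2) assms(3)])
  from smooth_at_comp[OF assms(1) is_pre_atlas pre_atlas_euclidean assms(2) this]
  show ?thesis unfolding k_def by (intro smooth_at_diff_euclidean assms(1)) auto
qed

lemma smooth_at_k':
  assumes "pre_atlas \<B>" "smooth_at \<B> EU f x" "f x \<in> K"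
  shows "smooth_at \<B> \<A> (\<lambda>x. k' (f x)) x"
proof -
  have "f x + snd e 0 \<in> snd e ` U" using assms(3) by (auto simp: K_eq)
  then have inv: "smooth_at EU \<A> (inv_into U (snd e)) (f x + snd e 0)"
    using smooth_at_inv_compatible_chart[OF is_pre_atlas e_chart(1)] e_chart(2) by blast
  from smooth_at_comp[OF assms(1) pre_atlas_euclidean is_pre_atlas smooth_at_add_euclidean[OF assms(1,2) smooth_at_const] inv]
  show ?thesis unfolding k'_def U_def .
qed

lemma smooth_at_EU_ident: "smooth_at EU EU (\<lambda>x. x) x"
  by (rule smooth_at_euclideanI[of UNIV]) (auto simp: smooth_on_def intro: Ck_on_bounded_linear)

lemma smooth_at_EU_fst: "smooth_at EU EU fst x" and smooth_at_EU_snd: "smooth_at EU EU snd x"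
  by (auto intro!: smooth_at_euclideanI[of UNIV] Ck_on_bounded_linear bounded_linear_fst bounded_linear_snd
      simp: smooth_on_def)

lemma smooth_at_G_ident: "smooth_at \<A> \<A> (\<lambda>x. x) x" using is_smooth_atlas by (rule smooth_at_ident)

lemma isCont_k: "x \<in> U \<Longrightarrow> isCont k x"
  using smooth_at_k[OF is_pre_atlas smooth_at_G_ident] by (rule smooth_at_isCont)

lemma isCont_k': "X \<in> K \<Longrightarrow> isCont k' X"
  using smooth_at_k'[OF pre_atlas_euclidean smooth_at_EU_ident] by (rule smooth_at_isCont)

lemma open_B: "open (B r)"
proof -
  have "open (U \<inter> k -` ball 0 r)"
    by (rule continuous_open_preimage)
      (auto simp: open_U intro: continuous_at_imp_continuous_on isCont_k)
  moreover have "U \<inter> k -` ball 0 r = B r" by (auto simp: B_def)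
  ultimately show ?thesis by simp
qed

lemma zero_in_B: "r > 0 \<Longrightarrow> 0 \<in> B r" by (simp add: B_def e_chart(3))

lemma B_mono: "r \<le> r' \<Longrightarrow> B r \<subseteq> B r'" by (auto simp: B_def)

lemma B_D: "x \<in> B r \<Longrightarrow> x \<in> U" "x \<in> B r \<Longrightarrow> norm (k x) < r" by (auto simp: B_def)

lemma nbhd_contains_B:
  assumes "open S" "0 \<in> S" obtains r where "r > 0" "B r \<subseteq> S"
proof -
  have "open (K \<inter> k' -` S)"
    by (rule continuous_open_preimage) (auto simp: open_K assms intro: continuous_at_imp_continuous_on isCont_k')
  moreover have "0 \<in> K \<inter> k' -` S" using assms zero_in_K by simp
  ultimately obtain r where r: "r > 0" "ball 0 r \<subseteq> K \<inter> k' -` S" unfolding open_contains_ball by blast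
  have "B r \<subseteq> S"
  proof
    fix x assume "x \<in> B r"
    then have "k x \<in> ball 0 r" "x \<in> U" by (auto simp: B_def)
    then show "x \<in> S" using r(2) k'_k by fastforce
  qed
  then show thesis using that r by blast
qed

section \<open>First-order expansion of the group law and of powers\<close>

text \<open>In coordinates the differential of multiplication at the identity is addition, because 0
  is neutral on either side. Strict differentiability makes the approximation uniform over pairs of
  nearby points.\<close>

lemma mult_strictly_differentiable:
  assumes "\<eta> > 0"
  obtains r where "r > 0" "\<And>x y. x \<in> B r \<Longrightarrow> y \<in> B r \<Longrightarrow> x + y \<in> U"
    "\<And>x y x' y'. x \<in> B r \<Longrightarrow> y \<in> B r \<Longrightarrow> x' \<in> B r \<Longrightarrow> y' \<in> B r \<Longrightarrow>
      norm (k (x + y) - k (x' + y') - ((k x - k x') + (k y - k y'))) \<le> \<eta> * (norm (k x - k x') + norm (k y - k y'))"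
proof -
  define m where "m p = k (k' (fst p) + k' (snd p))" for p :: "'a \<times> 'a"
  have "smooth_at EU EU m (0, 0)"
    unfolding m_def
    by (intro smooth_at_k smooth_at_mult smooth_at_k' pre_atlas_euclidean smooth_at_EU_fst smooth_at_EU_snd)
      (auto simp: zero_in_K e_chart)
  then obtain S where S: "open S" "(0, 0) \<in> S" "smooth_on S m" unfolding smooth_at_euclidean_iff by blast
  have Ck: "Ck_on (Suc 0) S m" using S(3) by (rule smooth_on_Ck)
  have der: "(m has_derivative fd m (0, 0)) (at (0, 0))"
    using Ck S(2) by (intro fd_works) auto
  \<comment> \<open>Restricting \<open>m\<close> to either factor gives the identity near 0, which
    determines both partial derivatives.\<close>
  have "((\<lambda>X. m (X, 0)) has_derivative (\<lambda>u. fd m (0, 0) (u, 0))) (at 0)"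
    using der by (intro has_derivative_compose[where f = "\<lambda>X. (X, 0)" and g = m] has_derivative_Pair
        has_derivative_ident has_derivative_const) auto
  then have "((\<lambda>X. X) has_derivative (\<lambda>u. fd m (0, 0) (u, 0))) (at 0)"
    by (rule has_derivative_transform_within_open[OF _ open_K zero_in_K]) (simp add: m_def k_k')
  then have D1: "fd m (0, 0) (u, 0) = u" for u
    using has_derivative_unique[OF has_derivative_ident] by metis
  have "((\<lambda>X. m (0, X)) has_derivative (\<lambda>u. fd m (0, 0) (0, u))) (at 0)"
    using der by (intro has_derivative_compose[where f = "\<lambda>X. (0, X)" and g = m] has_derivative_Pair
        has_derivative_ident has_derivative_const) auto
  then have "((\<lambda>X. X) has_derivative (\<lambda>u. fd m (0, 0) (0, u))) (at 0)"
    by (rule has_derivative_transform_within_open[OF _ open_K zero_in_K]) (simp add: m_def k_k')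
  then have D2: "fd m (0, 0) (0, u) = u" for u
    using has_derivative_unique[OF has_derivative_ident] by metis
  have D: "fd m (0, 0) (u, v) = u + v" for u v
    using linear_add[OF has_derivative_linear[OF der], of "(u, 0)" "(0, v)"] by (simp add: D1 D2)
  obtain r1 where r1: "r1 > 0" "ball (0, 0) r1 \<subseteq> S"
    "\<And>p q. p \<in> ball (0, 0) r1 \<Longrightarrow> q \<in> ball (0, 0) r1 \<Longrightarrow> norm (m p - m q - fd m (0, 0) (p - q)) \<le> \<eta> * norm (p - q)"
    using Ck_on_strictly_differentiable[OF Ck S(1,2) assms] by blast
  have "isCont (\<lambda>p::'g \<times> 'g. fst p + snd p) (0, 0)"
    unfolding isCont_def
    using tendsto_group_add[OF tendsto_fst[OF tendsto_ident_at] tendsto_snd[OF tendsto_ident_at], of "(0, 0)"] by simp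
  then have "\<exists>T. open T \<and> (0, 0) \<in> T \<and> (\<forall>p\<in>T. fst p + snd p \<in> U)"
    using open_U e_chart(3) unfolding continuous_at_open by auto
  then obtain T where T: "open T" "(0, 0) \<in> T" "\<And>p. p \<in> T \<Longrightarrow> fst p + snd p \<in> U" by blast
  obtain T1 T2 where T12: "open T1" "open T2" "(0, 0) \<in> T1 \<times> T2" "T1 \<times> T2 \<subseteq> T"
    using open_prod_elim[OF T(1,2)] by blast
  have T12_add: "x + y \<in> U" if "x \<in> T1" "y \<in> T2" for x y
    using T(3)[of "(x, y)"] T12(4) that by auto
  obtain r2 where r2: "r2 > 0" "B r2 \<subseteq> T1 \<inter> T2" using nbhd_contains_B[of "T1 \<inter> T2"] T12 by auto
  define r where "r = min r2 (r1 / 2)"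
  show thesis
  proof
    show "r > 0" using r1 r2 by (simp add: r_def)
    show "x + y \<in> U" if "x \<in> B r" "y \<in> B r" for x y
    proof -
      have "B r \<subseteq> B r2" by (rule B_mono) (simp add: r_def)
      then have "x \<in> T1" "y \<in> T2" using that r2(2) by blast+
      then show ?thesis by (rule T12_add)
    qed
    fix x y x' y' assume x: "x \<in> B r" "y \<in> B r" "x' \<in> B r" "y' \<in> B r"
    have ball: "(k x, k y) \<in> ball (0, 0) r1" if "x \<in> B r" "y \<in> B r" for x y
    proof -
      have "norm (k x, k y) \<le> norm (k x) + norm (k y)" by (rule norm_Pair_le)
      also have "\<dots> < r1" using that[unfolded B_def] by (auto simp: r_def)
      finally show ?thesis by (simp add: dist_prod_def norm_prod_def)
    qed
    have m: "m (k x, k y) = k (x + y)" if "x \<in> B r" "y \<in> B r" for x y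
      using that by (simp add: m_def k'_k B_D)
    have "norm (k (x + y) - k (x' + y') - ((k x - k x') + (k y - k y'))) \<le> \<eta> * norm (k x - k x', k y - k y')"
      using r1(3)[OF ball[OF x(1,2)] ball[OF x(3,4)]] by (simp add: m x D)
    also have "\<dots> \<le> \<eta> * (norm (k x - k x') + norm (k y - k y'))"
      using assms by (intro mult_left_mono norm_Pair_le) auto
    finally show "norm (k (x + y) - k (x' + y') - ((k x - k x') + (k y - k y'))) \<le> \<dots>" .
  qed
qed

primrec gpow :: "nat \<Rightarrow> 'g \<Rightarrow> 'g" where
  "gpow 0 x = 0"
| "gpow (Suc n) x = gpow n x + x"

lemma nrm_gpow: "nrm (gpow n x) \<le> n * nrm x"
proof (induction n)
  case (Suc n)
  then show ?case using nrm_add[of "gpow n x" x] by (simp add: algebra_simps)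
qed simp

text \<open>Each further factor adds \<open>k x\<close> up to a relative error
  \<open>\<eta>\<close>. The factor 2 in the hypothesis keeps all intermediate powers in
  \<open>B r\<close>, since their coordinates have norm at most 1 + \<eta> \<le> 2 times
  \<open>n * norm (k x)\<close>.\<close>

lemma k_gpow:
  assumes "0 < \<eta>" "\<eta> \<le> 1"
  obtains r where "r > 0"
    "\<And>x n. x \<in> U \<Longrightarrow> 2 * n * norm (k x) < r \<Longrightarrow>
       gpow n x \<in> B r \<and> norm (k (gpow n x) - n *\<^sub>R k x) \<le> \<eta> * n * norm (k x)"
proof -
  obtain r where r: "r > 0" "\<And>x y. x \<in> B r \<Longrightarrow> y \<in> B r \<Longrightarrow> x + y \<in> U"
    "\<And>x y x' y'. x \<in> B r \<Longrightarrow> y \<in> B r \<Longrightarrow> x' \<in> B r \<Longrightarrow> y' \<in> B r \<Longrightarrow>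
      norm (k (x + y) - k (x' + y') - ((k x - k x') + (k y - k y'))) \<le> \<eta> * (norm (k x - k x') + norm (k y - k y'))"
    using mult_strictly_differentiable[OF assms(1)] by blast
  have "gpow n x \<in> B r \<and> norm (k (gpow n x) - n *\<^sub>R k x) \<le> \<eta> * n * norm (k x)"
    if "x \<in> U" "2 * n * norm (k x) < r" for x n
    using that(2)
  proof (induction n)
    case 0
    then show ?case using r(1) zero_in_B by simp
  next
    case (Suc n)
    have "2 * real n * norm (k x) \<le> 2 * real (Suc n) * norm (k x)" by (intro mult_right_mono) auto
    then have IH: "gpow n x \<in> B r" "norm (k (gpow n x) - n *\<^sub>R k x) \<le> \<eta> * n * norm (k x)"
      using Suc by auto
    have "1 * norm (k x) \<le> 2 * real (Suc n) * norm (k x)" by (intro mult_right_mono) auto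
    then have x: "x \<in> B r" using that(1) Suc.prems by (simp add: B_def)
    have "norm (k (gpow n x + x) - k (gpow n x + 0) - k x) \<le> \<eta> * norm (k x)"
      using r(3)[OF IH(1) x IH(1) zero_in_B[OF r(1)]] by simp
    then have "norm ((k (gpow n x + x) - k (gpow n x) - k x) + (k (gpow n x) - n *\<^sub>R k x))
        \<le> \<eta> * norm (k x) + \<eta> * n * norm (k x)"
      by (intro norm_triangle_le add_mono IH) auto
    also have "(k (gpow n x + x) - k (gpow n x) - k x) + (k (gpow n x) - n *\<^sub>R k x)
        = k (gpow (Suc n) x) - Suc n *\<^sub>R k x" by (simp add: algebra_simps)
    also have "\<eta> * norm (k x) + \<eta> * n * norm (k x) = \<eta> * Suc n * norm (k x)" by (simp add: algebra_simps)
    finally have b: "norm (k (gpow (Suc n) x) - Suc n *\<^sub>R k x) \<le> \<eta> * Suc n * norm (k x)" .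
    have "norm (k (gpow (Suc n) x)) \<le> norm (Suc n *\<^sub>R k x) + \<eta> * Suc n * norm (k x)"
      using b norm_triangle_ineq2[of "k (gpow (Suc n) x)" "Suc n *\<^sub>R k x"] by linarith
    also have "\<dots> = Suc n * norm (k x) + \<eta> * (Suc n * norm (k x))" by simp
    also have "\<dots> \<le> Suc n * norm (k x) + 1 * (Suc n * norm (k x))"
      using assms(2) by (intro add_left_mono mult_right_mono) auto
    also have "\<dots> < r" using Suc.prems by (simp only: mult_1 mult_2 distrib_right mult.assoc)
    finally have "norm (k (gpow (Suc n) x)) < r" .
    moreover have "gpow (Suc n) x \<in> U" using r(2)[OF IH(1) x] by simp
    ultimately show ?case using b by (simp add: B_def)
  qed
  then show thesis using that r(1) by blast
qed

text \<open>Comparing the sizes of an element and its powers replaces the exponential map, whose existence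
  on the whole Lie algebra is not needed.\<close>

lemma gpow_reach:
  obtains r where "r > 0"
    "\<And>\<rho> x. 0 < \<rho> \<Longrightarrow> \<rho> \<le> r \<Longrightarrow> x \<in> B (\<rho> / 8) \<Longrightarrow> x \<noteq> 0 \<Longrightarrow>
      \<exists>n\<ge>1. gpow n x \<in> B \<rho> \<and> norm (k (gpow n x)) \<ge> \<rho> / 8 \<and> \<rho> / 4 \<le> n * norm (k x) \<and> n * norm (k x) \<le> \<rho>"
proof -
  obtain r where r: "r > 0"
    "\<And>x n. x \<in> U \<Longrightarrow> 2 * n * norm (k x) < r \<Longrightarrow>
       gpow n x \<in> B r \<and> norm (k (gpow n x) - n *\<^sub>R k x) \<le> 1 / 2 * n * norm (k x)"
    using k_gpow[of "1 / 2"] by auto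
  have "\<exists>n\<ge>1. gpow n x \<in> B \<rho> \<and> norm (k (gpow n x)) \<ge> \<rho> / 8 \<and> \<rho> / 4 \<le> n * norm (k x) \<and> n * norm (k x) \<le> \<rho>"
    if \<rho>: "0 < \<rho>" "\<rho> \<le> r" and x: "x \<in> B (\<rho> / 8)" "x \<noteq> 0" for x \<rho>
  proof -
    define t where "t = norm (k x)"
    have t: "t > 0" "t < \<rho> / 8" using x k_eq_0 by (auto simp: t_def B_def)
    \<comment> \<open>This choice puts \<open>n * t\<close> between \<rho>/4 and \<rho>/2, so a
      relative error of 1/2 leaves the power between \<rho>/8 and \<rho>.\<close>
    define n where "n = nat \<lceil>\<rho> / (4 * t)\<rceil>"
    have p: "\<rho> / (4 * t) > 2" using t by (simp add: field_simps)
    have n1: "\<rho> / (4 * t) \<le> n" by (simp add: n_def real_nat_ceiling_ge)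
    have "real n < \<rho> / (4 * t) + 1"
      using p ceiling_correct[of "\<rho> / (4 * t)"] by (simp add: n_def)
    also have "\<dots> < \<rho> / (4 * t) + \<rho> / (4 * t)" using p by simp
    finally have n2: "2 * n * t < \<rho>" using t by (simp add: field_simps)
    have n3: "\<rho> / 4 \<le> n * t" using n1 t by (simp add: field_simps)
    have gp: "gpow n x \<in> B r" "norm (k (gpow n x) - n *\<^sub>R k x) \<le> 1 / 2 * n * t"
      using r(2)[of x n] x n2 \<rho> by (auto simp: t_def B_def)
    have nt: "norm (n *\<^sub>R k x) = n * t" by (simp add: t_def)
    have n2': "2 * (real n * t) < \<rho>" "0 \<le> real n * t" using n2 t by auto
    have gp': "norm (k (gpow n x) - n *\<^sub>R k x) \<le> 1 / 2 * (real n * t)" using gp(2) by simp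
    have "norm (n *\<^sub>R k x) - norm (k (gpow n x)) \<le> 1 / 2 * n * t"
      using gp(2) norm_triangle_ineq2[of "n *\<^sub>R k x" "k (gpow n x)"] by (simp add: norm_minus_commute)
    then have "norm (k (gpow n x)) \<ge> \<rho> / 8" using n3 nt by linarith
    moreover have "norm (k (gpow n x)) < \<rho>"
      using gp' norm_triangle_ineq2[of "k (gpow n x)" "n *\<^sub>R k x"] n2' nt by linarith
    then have "gpow n x \<in> B \<rho>" using gp(1) by (simp add: B_def)
    moreover have "n \<ge> 1" using n1 p by (cases n) auto
    moreover have "n * t \<le> \<rho>" using n2' by linarith
    ultimately show ?thesis using n3 unfolding t_def by (intro exI[of _ n]) auto
  qed
  then show thesis using that r(1) by blast
qed

text \<open>A suitable power of \<open>x\<close> leaves a fixed neighbourhood of 0 and so has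
  \<open>nrm\<close> at least \<open>c\<close>, while \<open>nrm\<close> of an n-th power is at most
  n times \<open>nrm x\<close>.\<close>

lemma norm_k_le_nrm:
  obtains r C where "r > 0" "C > 0" "\<And>x. x \<in> B r \<Longrightarrow> norm (k x) \<le> C * nrm x"
proof -
  obtain r where r: "r > 0"
    "\<And>\<rho> x. 0 < \<rho> \<Longrightarrow> \<rho> \<le> r \<Longrightarrow> x \<in> B (\<rho> / 8) \<Longrightarrow> x \<noteq> 0 \<Longrightarrow>
      \<exists>n\<ge>1. gpow n x \<in> B \<rho> \<and> norm (k (gpow n x)) \<ge> \<rho> / 8 \<and> \<rho> / 4 \<le> n * norm (k x) \<and> n * norm (k x) \<le> \<rho>"
    using gpow_reach by blast
  obtain c where c: "c > 0" "\<And>y. nrm y < c \<Longrightarrow> y \<in> B (r / 8)"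
    using nrm_ball_subset[OF open_B zero_in_B, of "r / 8"] r(1) by auto
  show thesis
  proof
    show "r / 8 > 0" "r / c > 0" using r(1) c(1) by auto
    fix x assume x: "x \<in> B (r / 8)"
    show "norm (k x) \<le> r / c * nrm x"
    proof (cases "x = 0")
      case False
      from r(2)[OF r(1) order_refl x False] obtain n :: nat where n: "n \<ge> 1" "norm (k (gpow n x)) \<ge> r / 8" "n * norm (k x) \<le> r"
        by blast
      have "\<not> nrm (gpow n x) < c" using c(2)[of "gpow n x"] n(2) by (auto simp: B_def)
      then have "c \<le> n * nrm x" using nrm_gpow[of n x] by linarith
      have "c * (n * norm (k x)) \<le> (n * nrm x) * r"
        using \<open>c \<le> n * nrm x\<close> n(3) c(1) by (intro mult_mono) auto
      then have "n * (c * norm (k x)) \<le> n * (r * nrm x)" by (simp add: ac_simps)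
      then have "c * norm (k x) \<le> r * nrm x" using n(1) by simp
      then show ?thesis using c(1) by (simp add: field_simps)
    qed simp
  qed
qed

section \<open>Compactness of closed balls\<close>

lemma closed_nrm_ball: "closed {x. nrm x \<le> R}"
proof -
  have "open {x. R < nrm x}"
    unfolding open_iff
  proof (intro ballI exI conjI allI impI)
    fix x y assume "x \<in> {x. R < nrm x}"
    then show "nrm x - R > 0" by simp
    assume "d x y < nrm x - R"
    then show "y \<in> {x. R < nrm x}" using nrm_diff[of x y] by simp
  qed
  then show ?thesis by (simp add: closed_def Compl_eq not_le)
qed

text \<open>A small ball lies in the image of a compact coordinate ball; a dilation carries it onto
  the ball of radius \<open>R\<close>.\<close>

lemma compact_nrm_ball: "compact {x. nrm x \<le> R}"
proof (cases "R > 0")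
  case True
  obtain \<rho> where \<rho>: "\<rho> > 0" "cball 0 \<rho> \<subseteq> K"
    using open_K zero_in_K open_contains_cball by blast
  have cont: "continuous_on (cball 0 \<rho>) k'"
    using \<rho>(2) isCont_k' by (auto intro!: continuous_at_imp_continuous_on)
  have comp: "compact (k' ` cball 0 \<rho>)" by (rule compact_continuous_image[OF cont]) simp
  obtain c where c: "c > 0" "\<And>y. nrm y < c \<Longrightarrow> y \<in> B \<rho>"
    using nrm_ball_subset[OF open_B zero_in_B] \<rho>(1) by blast
  have "{x. nrm x \<le> c / 2} \<subseteq> k' ` cball 0 \<rho>"
  proof
    fix x assume "x \<in> {x. nrm x \<le> c / 2}"
    then have "x \<in> B \<rho>" using c by auto
    then have "k' (k x) = x" "k x \<in> cball 0 \<rho>" by (auto simp: k'_k B_def)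
    then show "x \<in> k' ` cball 0 \<rho>" by (metis imageI)
  qed
  then have comp2: "compact {x. nrm x \<le> c / 2}"
    using compact_Int_closed[OF comp closed_nrm_ball[of "c / 2"]] by (simp add: Int_absorb1)
  define t where "t = R / (c / 2)"
  have "t > 0" using True c(1) by (simp add: t_def)
  have "continuous_on UNIV (\<delta> t)"
    using delta_auto[OF \<open>t > 0\<close>] by (simp add: lie_automorphism_def smooth_map_on_def)
  then have "compact (\<delta> t ` {x. nrm x \<le> c / 2})"
    using comp2 by (intro compact_continuous_image) (auto intro: continuous_on_subset)
  moreover have "\<delta> t ` {x. nrm x \<le> c / 2} = {x. nrm x \<le> R}"
  proof -
    have *: "nrm (\<delta> t x) \<le> R \<longleftrightarrow> nrm x \<le> c / 2" for x
      unfolding nrm_delta[OF \<open>t > 0\<close>] using c(1) True by (simp add: t_def field_simps)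
    have "\<exists>x. y = \<delta> t x" for y
      using bij_delta[OF \<open>t > 0\<close>] unfolding bij_def surj_def by blast
    then show ?thesis using * by (auto simp: image_iff) (metis)
  qed
  ultimately show ?thesis by simp
next
  case False
  have "x = 0" if "nrm x \<le> R" for x
  proof -
    have "nrm x = 0" using False that nrm_nonneg[of x] by linarith
    then show ?thesis by simp
  qed
  then have "{x. nrm x \<le> R} \<subseteq> {0}" by auto
  then show ?thesis by (meson finite.emptyI finite_imp_compact finite_insert finite_subset)
qed

lemma bounded_subseq:
  fixes X :: "nat \<Rightarrow> 'g"
  assumes "\<And>n. nrm (X n) \<le> R"
  obtains l r where "strict_mono (r :: nat \<Rightarrow> nat)" "(\<lambda>n. X (r n)) \<longlonglongrightarrow> l"
proof -
  have "seq_compact {x. nrm x \<le> R}" by (rule compact_imp_seq_compact[OF compact_nrm_ball])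
  then obtain l r where "strict_mono (r :: nat \<Rightarrow> nat)" "(X \<circ> r) \<longlonglongrightarrow> l"
    using assms unfolding seq_compact_def by blast
  then show thesis using that by (simp add: o_def)
qed

section \<open>The two subgroups and the closedness of \<open>W\<close>\<close>

lemma W_subgroup: "0 \<in> W" "x \<in> W \<Longrightarrow> y \<in> W \<Longrightarrow> x + y \<in> W" "x \<in> W \<Longrightarrow> - x \<in> W"
  using W by (auto simp: homogeneous_subgroup_def lie_subgroup_def is_subgroup_def)

lemma V_subgroup: "0 \<in> V" "x \<in> V \<Longrightarrow> y \<in> V \<Longrightarrow> x + y \<in> V" "x \<in> V \<Longrightarrow> - x \<in> V"
  using V by (auto simp: homogeneous_subgroup_def lie_subgroup_def is_subgroup_def)

lemma W_delta: "r > 0 \<Longrightarrow> x \<in> W \<Longrightarrow> \<delta> r x \<in> W"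
  using W by (auto simp: homogeneous_subgroup_def)

lemma V_delta: "r > 0 \<Longrightarrow> x \<in> V \<Longrightarrow> \<delta> r x \<in> V"
  using V by (auto simp: homogeneous_subgroup_def)

lemma W_Int_V: "x \<in> W \<Longrightarrow> x \<in> V \<Longrightarrow> x = 0"
  using WV by (auto simp: complementary_def)

text \<open>In a chart at 0 the submanifold \<open>W\<close> is an affine slice, hence closed there.
  The subgroup property moves the question to 0: translating by the inverse of a late term
  \<open>X N\<close> brings the limit into that chart.\<close>

lemma W_closed:
  assumes "\<And>n. X n \<in> W" "X \<longlonglongrightarrow> l"
  shows "l \<in> W"
proof -
  have "embedded_submanifold \<A> W" using W by (simp add: homogeneous_subgroup_def lie_subgroup_def)
  then have "\<exists>c\<in>maximal_atlas \<A>. \<exists>S. 0 \<in> fst c \<and> affine S \<and> snd c ` (fst c \<inter> W) = snd c ` fst c \<inter> S"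
    using W_subgroup(1) unfolding embedded_submanifold_def case_prod_beta by blast
  then obtain c S where c: "c \<in> maximal_atlas \<A>" "0 \<in> fst c" "affine S"
    "snd c ` (fst c \<inter> W) = snd c ` fst c \<inter> S" by blast
  obtain U' \<kappa> where c': "c = (U', \<kappa>)" by (cases c)
  have ch: "is_chart (U', \<kappa>)" using c(1) by (simp add: maximal_atlas_def c')
  have eq: "\<kappa> ` (U' \<inter> W) = \<kappa> ` U' \<inter> S" using c(4) c' by simp
  have mem: "x \<in> W \<longleftrightarrow> \<kappa> x \<in> S" if "x \<in> U'" for x
  proof
    assume "\<kappa> x \<in> S"
    then have "\<kappa> x \<in> \<kappa> ` (U' \<inter> W)" using eq that by blast
    then show "x \<in> W" using inj_onD[OF is_chartD(5)[OF ch]] that by blast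
  qed (use eq that in blast)
  have "closed S" using c(3) by (rule affine_closed)
  have "0 \<in> U'" using c(2) c' by simp
  obtain r where r: "r > 0" "\<And>y. nrm y < r \<Longrightarrow> y \<in> U'"
    using nrm_ball_subset[OF is_chartD(1)[OF ch] \<open>0 \<in> U'\<close>] by blast
  have "(\<lambda>n. d l (X n)) \<longlonglongrightarrow> 0" using assms(2) by (simp add: tendsto_iff_d)
  then have "\<forall>\<^sub>F n in sequentially. d l (X n) < r" using r(1) by (rule order_tendstoD)
  then obtain N where N: "d l (X N) < r" using eventually_sequentially by auto
  define Y where "Y n = - X N + X n" for n
  have YW: "Y n \<in> W" for n unfolding Y_def using assms(1) W_subgroup by blast
  have Y: "Y \<longlonglongrightarrow> - X N + l" unfolding Y_def by (intro tendsto_group_add assms(2) tendsto_const)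
  have "nrm (- X N + l) < r" using N d_nrm[of "X N" l] dm.commute[of l "X N"] by simp
  then have lU: "- X N + l \<in> U'" by (rule r)
  have "isCont \<kappa> (- X N + l)"
    using is_chartD(1,3)[OF ch] lU by (simp add: continuous_on_eq_continuous_at)
  then have lim: "(\<lambda>n. \<kappa> (Y n)) \<longlonglongrightarrow> \<kappa> (- X N + l)" using Y by (rule isCont_tendsto_compose)
  have "\<forall>\<^sub>F n in sequentially. Y n \<in> U'"
    using topological_tendstoD[OF Y is_chartD(1)[OF ch] lU] .
  then have "\<forall>\<^sub>F n in sequentially. \<kappa> (Y n) \<in> S"
    by eventually_elim (use mem YW in blast)
  then have "\<kappa> (- X N + l) \<in> S"
    using Lim_in_closed_set[OF \<open>closed S\<close> _ _ lim] by simp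
  then have "- X N + l \<in> W" using mem lU by blast
  then have "X N + (- X N + l) \<in> W" using assms(1) W_subgroup(2) by blast
  then show ?thesis by (simp add: add.assoc[symmetric])
qed

section \<open>Perturbation of powers\<close>

lemma tendsto_0_if_k:
  assumes "\<forall>\<^sub>F n in F. y n \<in> U" "((\<lambda>n. k (y n)) \<longlongrightarrow> 0) F"
  shows "(y \<longlongrightarrow> 0) F"
proof -
  have "((\<lambda>n. k' (k (y n))) \<longlongrightarrow> k' 0) F"
    by (rule isCont_tendsto_compose[OF isCont_k'[OF zero_in_K] assms(2)])
  moreover have "\<forall>\<^sub>F n in F. k' (k (y n)) = y n" using assms(1) by eventually_elim (rule k'_k)
  ultimately show ?thesis by (simp add: tendsto_cong)
qed

lemma eventually_in_B: "(y \<longlongrightarrow> 0) F \<Longrightarrow> r > 0 \<Longrightarrow> \<forall>\<^sub>F n in F. y n \<in> B r"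
  using topological_tendstoD[OF _ open_B zero_in_B] by blast

lemma tendsto_group_diff:
  assumes "(f \<longlongrightarrow> (a::'g)) F" "(h \<longlongrightarrow> b) F" shows "((\<lambda>z. f z - h z) \<longlongrightarrow> a - b) F"
  using tendsto_group_add[OF assms(1) tendsto_group_uminus[OF assms(2)]] by simp

text \<open>Comparing (x - y) + y with 0 + y, additivity up to relative error 1/2 gives the factor
  2.\<close>

lemma k_diff_le:
  obtains r where "r > 0"
    "\<And>x y. x \<in> B r \<Longrightarrow> y \<in> B r \<Longrightarrow> x - y \<in> B r \<Longrightarrow> norm (k (x - y)) \<le> 2 * norm (k x - k y)"
proof -
  obtain r where r: "r > 0"
    "\<And>x y x' y'. x \<in> B r \<Longrightarrow> y \<in> B r \<Longrightarrow> x' \<in> B r \<Longrightarrow> y' \<in> B r \<Longrightarrow>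
      norm (k (x + y) - k (x' + y') - ((k x - k x') + (k y - k y'))) \<le> 1 / 2 * (norm (k x - k x') + norm (k y - k y'))"
    by (rule mult_strictly_differentiable[of "1 / 2"]) (simp, blast)
  have "norm (k (x - y)) \<le> 2 * norm (k x - k y)" if "x \<in> B r" "y \<in> B r" "x - y \<in> B r" for x y
  proof -
    have "norm (k x - k y - k (x - y)) \<le> 1 / 2 * norm (k (x - y))"
      using r(2)[OF that(3,2) zero_in_B[OF r(1)] that(2)] by simp
    then show ?thesis using norm_triangle_ineq2[of "k (x - y)" "k x - k y"] by (simp add: norm_minus_commute)
  qed
  then show thesis using that r(1) by blast
qed

text \<open>Conjugation is smooth in the coordinates of \<open>b\<close> and \<open>y\<close>, hence
  Lipschitz near the identity, and it sends \<open>y = 0\<close> to 0 for every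
  \<open>b\<close>.\<close>

lemma k_conj_le:
  obtains r L where "r > 0" "L > 0"
    "\<And>b y. b \<in> B r \<Longrightarrow> y \<in> B r \<Longrightarrow> b + y - b \<in> U \<and> norm (k (b + y - b)) \<le> L * norm (k y)"
proof -
  define m where "m p = k (k' (fst p) + k' (snd p) - k' (fst p))" for p :: "'a \<times> 'a"
  have "smooth_at EU EU (\<lambda>p. k (k' (fst p) + k' (snd p) + - k' (fst p))) (0, 0)"
    by (intro smooth_at_k smooth_at_mult smooth_at_uminus smooth_at_k' pre_atlas_euclidean smooth_at_EU_fst smooth_at_EU_snd)
      (auto simp: zero_in_K e_chart)
  then have "smooth_at EU EU m (0, 0)" unfolding m_def[abs_def] by simp
  then obtain S where S: "open S" "(0, 0) \<in> S" "smooth_on S m" unfolding smooth_at_euclidean_iff by blast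
  obtain r1 L where r1: "r1 > 0" "L > 0"
    "\<And>p q. p \<in> ball (0, 0) r1 \<Longrightarrow> q \<in> ball (0, 0) r1 \<Longrightarrow> norm (m p - m q) \<le> L * norm (p - q)"
    using Ck_on_locally_lipschitz[OF smooth_on_Ck[OF S(3)] S(1,2)] by blast
  have "((\<lambda>p::'g \<times> 'g. fst p + snd p - fst p) \<longlongrightarrow> 0 + 0 - 0) (nhds (0, 0))"
    by (intro tendsto_group_diff tendsto_group_add)
      (auto intro!: tendsto_fst[of _ "(0, 0)", simplified] tendsto_snd[of _ "(0, 0)", simplified] filterlim_ident)
  then have "\<forall>\<^sub>F p in nhds (0, 0). fst p + snd p - fst p \<in> U"
    using topological_tendstoD[OF _ open_U] e_chart(3) by fastforce
  then obtain T where T: "open T" "(0, 0) \<in> T" "\<And>p. p \<in> T \<Longrightarrow> fst p + snd p - fst p \<in> U"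
    unfolding eventually_nhds by blast
  obtain T1 T2 where T12: "open T1" "open T2" "(0, 0) \<in> T1 \<times> T2" "T1 \<times> T2 \<subseteq> T"
    using open_prod_elim[OF T(1,2)] by blast
  obtain r2 where r2: "r2 > 0" "B r2 \<subseteq> T1 \<inter> T2" using nbhd_contains_B[of "T1 \<inter> T2"] T12 by auto
  define r where "r = min r2 (r1 / 2)"
  have "b + y - b \<in> U \<and> norm (k (b + y - b)) \<le> L * norm (k y)" if "b \<in> B r" "y \<in> B r" for b y
  proof
    have "B r \<subseteq> B r2" by (rule B_mono) (simp add: r_def)
    then have "(b, y) \<in> T" using that r2(2) T12(4) by blast
    then show "b + y - b \<in> U" using T(3) by fastforce
    have ball: "(k b, k z) \<in> ball (0, 0) r1" if "z \<in> B r" for z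
    proof -
      have "norm (k b, k z) \<le> norm (k b) + norm (k z)" by (rule norm_Pair_le)
      also have "\<dots> < r1" using that \<open>b \<in> B r\<close> unfolding B_def by (auto simp: r_def)
      finally show ?thesis by (simp add: dist_prod_def norm_prod_def)
    qed
    have "0 \<in> B r" using r1 r2 by (intro zero_in_B) (simp add: r_def)
    have "norm (m (k b, k y) - m (k b, k 0)) \<le> L * norm ((k b, k y) - (k b, k 0))"
      by (rule r1(3)[OF ball[OF that(2)] ball[OF \<open>0 \<in> B r\<close>]])
    then show "norm (k (b + y - b)) \<le> L * norm (k y)"
      using that by (simp add: m_def k'_k B_D norm_prod_def)
  qed
  moreover have "r > 0" using r1 r2 by (simp add: r_def)
  ultimately show thesis using that r1(2) by blast
qed

text \<open>If \<open>a = y\<^sub>n + \<gamma>(1/n)\<close>, then passing from \<open>a\<^sup>j \<gamma>(j/n)\<^sup>-\<^sup>1\<close> to its successor costs only a conjugate of \<open>y\<^sub>n\<close>.\<close>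

lemma gpow_perturb:
  obtains r where "r > 0"
    "\<And>\<gamma> y. (\<And>s t :: real. \<gamma> (s + t) = \<gamma> s + \<gamma> t) \<Longrightarrow> (\<And>t. 0 \<le> t \<Longrightarrow> t \<le> 1 \<Longrightarrow> \<gamma> t \<in> B r) \<Longrightarrow>
      (y \<longlongrightarrow> 0) sequentially \<Longrightarrow> (\<lambda>n. n * norm (k (y n))) \<longlonglongrightarrow> 0 \<Longrightarrow>
      (\<lambda>n. gpow n (y n + \<gamma> (1 / n))) \<longlonglongrightarrow> \<gamma> 1"
proof -
  obtain r1 L where r1: "r1 > 0" "L > 0"
    "\<And>b y. b \<in> B r1 \<Longrightarrow> y \<in> B r1 \<Longrightarrow> b + y - b \<in> U \<and> norm (k (b + y - b)) \<le> L * norm (k y)"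
    using k_conj_le by blast
  obtain r2 where r2: "r2 > 0" "\<And>x y. x \<in> B r2 \<Longrightarrow> y \<in> B r2 \<Longrightarrow> x + y \<in> U"
    "\<And>x y x' y'. x \<in> B r2 \<Longrightarrow> y \<in> B r2 \<Longrightarrow> x' \<in> B r2 \<Longrightarrow> y' \<in> B r2 \<Longrightarrow>
      norm (k (x + y) - k (x' + y') - ((k x - k x') + (k y - k y'))) \<le> 1 * (norm (k x - k x') + norm (k y - k y'))"
    using mult_strictly_differentiable[of 1] by auto
  show thesis
  proof
    show "r1 > 0" by fact
    fix \<gamma> :: "real \<Rightarrow> 'g" and y
    assume hom: "\<And>s t. \<gamma> (s + t) = \<gamma> s + \<gamma> t" and \<gamma>: "\<And>t. 0 \<le> t \<Longrightarrow> t \<le> 1 \<Longrightarrow> \<gamma> t \<in> B r1"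
      and y0: "y \<longlonglongrightarrow> 0" and y: "(\<lambda>n. n * norm (k (y n))) \<longlonglongrightarrow> 0"
    have \<gamma>0: "\<gamma> 0 = 0" using hom[of 0 0] by (metis add.right_neutral add_left_cancel)
    define q where "q n j = gpow j (y n + \<gamma> (1 / n)) - \<gamma> (j / n)" for n j :: nat
    have qSuc: "q n (Suc j) = q n j + (\<gamma> (j / n) + y n - \<gamma> (j / n))" for n j
    proof -
      have "\<gamma> (Suc j / n) = \<gamma> (j / n) + \<gamma> (1 / n)"
        unfolding hom[symmetric] by (simp add: add_divide_distrib add.commute)
      then show ?thesis by (simp add: q_def diff_conv_add_uminus add.assoc minus_add del: add_uminus_conv_diff)
    qed
    \<comment> \<open>A conjugate of \<open>y n\<close> has coordinate size at most
      \<open>L * norm (k (y n))\<close>, and multiplying by it increases the norm by at most twice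
      that; n steps cost \<open>2 * L\<close> times a null sequence.\<close>
    have bound: "q n n \<in> U \<and> norm (k (q n n)) \<le> 2 * L * (n * norm (k (y n)))"
      if yn: "y n \<in> B r1" "2 * L * (n * norm (k (y n))) < r2" for n
    proof -
      have "q n j \<in> U \<and> norm (k (q n j)) \<le> 2 * L * (j * norm (k (y n)))" if "j \<le> n" for j
        using that
      proof (induction j)
        case 0
        then show ?case by (simp add: q_def \<gamma>0 e_chart(3))
      next
        case (Suc j)
        define z where "z = \<gamma> (j / n) + y n - \<gamma> (j / n)"
        have n: "n \<ge> 1" using Suc.prems by simp
        have "\<gamma> (j / n) \<in> B r1" using Suc.prems by (intro \<gamma>) auto
        from r1(3)[OF this yn(1)] have z: "z \<in> U" "norm (k z) \<le> L * norm (k (y n))"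
          by (auto simp: z_def)
        have le: "2 * L * (i * norm (k (y n))) \<le> 2 * L * (n * norm (k (y n)))" if "i \<le> n" for i :: nat
          using that r1(2) by (intro mult_left_mono mult_right_mono) auto
        have q: "q n j \<in> U" "norm (k (q n j)) \<le> 2 * L * (j * norm (k (y n)))" using Suc by auto
        have qB: "q n j \<in> B r2" using q le[of j] yn(2) Suc.prems by (auto simp: B_def)
        have "L * norm (k (y n)) \<le> 2 * L * (1 * norm (k (y n)))" using r1(2) by simp
        then have zB: "z \<in> B r2" using z le[of 1] yn(2) n by (auto simp: B_def)
        have "norm (k (q n j + z) - k (q n j) - k z) \<le> norm (k z)"
          using r2(3)[OF qB zB qB zero_in_B[OF r2(1)]] by simp
        then have "norm (k (q n j + z)) \<le> norm (k (q n j)) + 2 * norm (k z)"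
          using norm_triangle_ineq2[of "k (q n j + z)" "k (q n j)"]
            norm_triangle_ineq2[of "k (q n j + z) - k (q n j)" "k z"] by linarith
        also have "\<dots> \<le> 2 * L * (j * norm (k (y n))) + 2 * (L * norm (k (y n)))"
          using q(2) z(2) by (intro add_mono mult_left_mono) auto
        also have "\<dots> = 2 * L * (Suc j * norm (k (y n)))" by (simp add: algebra_simps)
        finally show ?case using r2(2)[OF qB zB] unfolding qSuc z_def[symmetric] by simp
      qed
      then show ?thesis by simp
    qed
    have lim: "(\<lambda>n. 2 * L * (n * norm (k (y n)))) \<longlonglongrightarrow> 0"
      using tendsto_mult[OF tendsto_const[of "2 * L"] y] by simp
    have "\<forall>\<^sub>F n in sequentially. q n n \<in> U \<and> norm (k (q n n)) \<le> 2 * L * (n * norm (k (y n)))"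
      using eventually_in_B[OF y0 r1(1)] order_tendstoD(2)[OF lim r2(1)]
      by eventually_elim (rule bound)
    then have ev: "\<forall>\<^sub>F n in sequentially. q n n \<in> U"
      "\<forall>\<^sub>F n in sequentially. norm (k (q n n)) \<le> 2 * L * (n * norm (k (y n)))"
      by (auto elim: eventually_mono)
    have "(\<lambda>n. k (q n n)) \<longlonglongrightarrow> 0" by (rule Lim_null_comparison[OF ev(2) lim])
    then have "(\<lambda>n. q n n) \<longlonglongrightarrow> 0" by (rule tendsto_0_if_k[OF ev(1)])
    then have "(\<lambda>n. q n n + \<gamma> 1) \<longlonglongrightarrow> 0 + \<gamma> 1" by (rule tendsto_group_add) simp
    moreover have "\<forall>\<^sub>F n in sequentially. q n n + \<gamma> 1 = gpow n (y n + \<gamma> (1 / n))"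
      using eventually_gt_at_top[of 0] by eventually_elim (simp add: q_def)
    ultimately show "(\<lambda>n. gpow n (y n + \<gamma> (1 / n))) \<longlonglongrightarrow> \<gamma> 1" by (simp add: tendsto_cong)
  qed
qed

section \<open>One-parameter subgroups\<close>

definition one_param :: "(real \<Rightarrow> 'g) \<Rightarrow> 'a \<Rightarrow> bool" where
  "one_param \<gamma> X \<longleftrightarrow> smooth_map_on euclidean_atlas \<A> UNIV \<gamma> \<and> (\<forall>s t. \<gamma> (s + t) = \<gamma> s + \<gamma> t) \<and>
     ((\<lambda>t. k (\<gamma> t)) has_vector_derivative X) (at 0)"

lemma is_exp_iff: "is_exp \<A> e X x \<longleftrightarrow> (\<exists>\<gamma>. one_param \<gamma> X \<and> \<gamma> 1 = x)"
  unfolding is_exp_def one_param_def k_def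
  by (simp add: has_vector_derivative_diff_const conj_assoc)

lemma one_paramD:
  fixes u t :: real
  assumes "one_param \<gamma> X"
  shows "smooth_at EU \<A> \<gamma> t" "\<gamma> (u + t) = \<gamma> u + \<gamma> t" "\<gamma> 0 = 0" "\<gamma> (- t) = - \<gamma> t"
    "((\<lambda>t. k (\<gamma> t)) has_vector_derivative X) (at 0)"
proof -
  show "smooth_at EU \<A> \<gamma> t"
    using assms unfolding one_param_def by (auto intro: smooth_at_if_smooth_map_on)
  have hom: "\<gamma> (u + t) = \<gamma> u + \<gamma> t" for u t using assms by (simp add: one_param_def)
  show "\<gamma> (u + t) = \<gamma> u + \<gamma> t" by (rule hom)
  show \<gamma>0: "\<gamma> 0 = 0" using hom[of 0 0] by (metis add.right_neutral add_left_cancel)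
  have "\<gamma> (- t) + \<gamma> t = 0" using hom[of "- t" t] \<gamma>0 by simp
  then show "\<gamma> (- t) = - \<gamma> t" by (simp add: eq_neg_iff_add_eq_0)
qed (use assms in \<open>simp add: one_param_def\<close>)

lemma one_param_tendsto:
  fixes t :: real
  shows "one_param \<gamma> X \<Longrightarrow> (f \<longlongrightarrow> t) F \<Longrightarrow> ((\<lambda>z. \<gamma> (f z)) \<longlongrightarrow> \<gamma> t) F"
  using isCont_tendsto_compose[OF smooth_at_isCont[OF one_paramD(1)]] by blast

lemma one_param_gpow:
  fixes t :: real
  shows "one_param \<gamma> X \<Longrightarrow> gpow n (\<gamma> t) = \<gamma> (n * t)"
proof (induction n)
  case (Suc n)
  then show ?case using one_paramD(2)[of \<gamma> X "n * t" t] by (simp add: distrib_right add.commute)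
qed (simp add: one_paramD(3))

lemma one_param_lim:
  assumes "one_param \<gamma> X"
  shows "(\<lambda>n. n *\<^sub>R k (\<gamma> (t / n))) \<longlonglongrightarrow> t *\<^sub>R X"
proof (cases "t = 0")
  case True
  then show ?thesis using one_paramD(3)[OF assms] by simp
next
  case False
  have "((\<lambda>h. norm (k (\<gamma> (0 + h)) - k (\<gamma> 0) - h *\<^sub>R X) / norm h) \<longlongrightarrow> 0) (at 0)"
    using one_paramD(5)[OF assms] unfolding has_vector_derivative_def has_derivative_at by blast
  then have *: "((\<lambda>h. norm (k (\<gamma> h) - h *\<^sub>R X) / \<bar>h\<bar>) \<longlongrightarrow> 0) (at 0)"
    by (simp add: one_paramD(3)[OF assms])
  have "filterlim (\<lambda>n. t / real n) (at 0) sequentially"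
    unfolding filterlim_at using False
    by (auto intro!: tendsto_divide_0[OF tendsto_const] filterlim_at_top_imp_at_infinity
        filterlim_real_sequentially eventually_sequentiallyI[of 1])
  from filterlim_compose[OF * this]
  have "(\<lambda>n. \<bar>t\<bar> * (norm (k (\<gamma> (t / n)) - (t / n) *\<^sub>R X) / \<bar>t / n\<bar>)) \<longlonglongrightarrow> \<bar>t\<bar> * 0"
    by (intro tendsto_mult tendsto_const)
  moreover have "\<forall>\<^sub>F n in sequentially.
      \<bar>t\<bar> * (norm (k (\<gamma> (t / n)) - (t / n) *\<^sub>R X) / \<bar>t / n\<bar>) = norm (n *\<^sub>R k (\<gamma> (t / n)) - t *\<^sub>R X)"
    using eventually_gt_at_top[of 0]
  proof eventually_elim
    case (elim n)
    have "n *\<^sub>R k (\<gamma> (t / n)) - t *\<^sub>R X = n *\<^sub>R (k (\<gamma> (t / n)) - (t / n) *\<^sub>R X)"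
      using elim by (simp add: scaleR_diff_right)
    then have "norm (n *\<^sub>R k (\<gamma> (t / n)) - t *\<^sub>R X) = n * norm (k (\<gamma> (t / n)) - (t / n) *\<^sub>R X)"
      by simp
    then show ?case using False elim by (simp add: abs_divide)
  qed
  ultimately have "(\<lambda>n. norm (n *\<^sub>R k (\<gamma> (t / n)) - t *\<^sub>R X)) \<longlonglongrightarrow> 0" by (simp add: tendsto_cong)
  then show ?thesis by (rule LIM_zero_cancel[OF tendsto_norm_zero_cancel])
qed

text \<open>Two subgroups with equal velocity differ at time t/n by o(1/n). By
  \<open>gpow_perturb\<close>, \<open>\<gamma>' t\<close>, the n-th power of
  \<open>\<gamma>' (t / n)\<close>, then tends to \<open>\<gamma> t\<close> for small
  \<open>t\<close>; powers and inverses reach all times.\<close>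

lemma one_param_unique:
  assumes "one_param \<gamma> X" "one_param \<gamma>' X" shows "\<gamma> = \<gamma>'"
proof -
  obtain r where r: "r > 0"
    "\<And>\<gamma> y. (\<And>s t :: real. \<gamma> (s + t) = \<gamma> s + \<gamma> t) \<Longrightarrow> (\<And>t. 0 \<le> t \<Longrightarrow> t \<le> 1 \<Longrightarrow> \<gamma> t \<in> B r) \<Longrightarrow>
      (y \<longlongrightarrow> 0) sequentially \<Longrightarrow> (\<lambda>n. n * norm (k (y n))) \<longlonglongrightarrow> 0 \<Longrightarrow>
      (\<lambda>n. gpow n (y n + \<gamma> (1 / n))) \<longlonglongrightarrow> \<gamma> 1"
    using gpow_perturb by blast
  obtain r2 where r2: "r2 > 0"
    "\<And>x y. x \<in> B r2 \<Longrightarrow> y \<in> B r2 \<Longrightarrow> x - y \<in> B r2 \<Longrightarrow> norm (k (x - y)) \<le> 2 * norm (k x - k y)"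
    using k_diff_le by blast
  have "(\<gamma> \<longlongrightarrow> 0) (at 0)"
    using one_param_tendsto[OF assms(1) tendsto_ident_at[of 0 UNIV]] one_paramD(3)[OF assms(1)] by simp
  from eventually_in_B[OF this r(1)] obtain \<tau> where \<tau>: "\<tau> > 0" "\<And>t. t \<noteq> 0 \<Longrightarrow> \<bar>t\<bar> < \<tau> \<Longrightarrow> \<gamma> t \<in> B r"
    unfolding eventually_at by (auto simp: dist_real_def)
  have \<tau>': "\<gamma> t \<in> B r" if "\<bar>t\<bar> < \<tau>" for t
    using \<tau>(2)[of t] that zero_in_B[OF r(1)] one_paramD(3)[OF assms(1)] by (cases "t = 0") auto
  have small: "\<gamma> t = \<gamma>' t" if t: "0 < t" "t < \<tau>" for t
  proof -
    define y where "y n = \<gamma>' (t / n) - \<gamma> (t / n)" for n :: nat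
    have lim0: "(\<lambda>n. t / real n) \<longlonglongrightarrow> 0" by (rule lim_const_over_n)
    have g: "(\<lambda>n. \<gamma> (t / n)) \<longlonglongrightarrow> 0" "(\<lambda>n. \<gamma>' (t / n)) \<longlonglongrightarrow> 0"
      using one_param_tendsto[OF assms(1) lim0] one_param_tendsto[OF assms(2) lim0]
        one_paramD(3)[OF assms(1)] one_paramD(3)[OF assms(2)] by auto
    have y0: "y \<longlonglongrightarrow> 0" using tendsto_group_diff[OF g(2,1)] by (simp add: y_def[abs_def])
    have "(\<lambda>n. 2 * norm (n *\<^sub>R k (\<gamma>' (t / n)) - n *\<^sub>R k (\<gamma> (t / n)))) \<longlonglongrightarrow> 2 * norm (t *\<^sub>R X - t *\<^sub>R X)"
      by (intro tendsto_mult tendsto_const tendsto_norm tendsto_diff one_param_lim assms)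
    then have lim: "(\<lambda>n. 2 * norm (n *\<^sub>R k (\<gamma>' (t / n)) - n *\<^sub>R k (\<gamma> (t / n)))) \<longlonglongrightarrow> 0" by simp
    have "\<forall>\<^sub>F n in sequentially. norm (n * norm (k (y n))) \<le> 2 * norm (n *\<^sub>R k (\<gamma>' (t / n)) - n *\<^sub>R k (\<gamma> (t / n)))"
      using eventually_in_B[OF g(1) r2(1)] eventually_in_B[OF g(2) r2(1)] eventually_in_B[OF y0 r2(1)]
    proof eventually_elim
      case (elim n)
      then have "norm (k (y n)) \<le> 2 * norm (k (\<gamma>' (t / n)) - k (\<gamma> (t / n)))"
        unfolding y_def by (intro r2(2))
      then have "n * norm (k (y n)) \<le> n * (2 * norm (k (\<gamma>' (t / n)) - k (\<gamma> (t / n))))"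
        by (intro mult_left_mono) auto
      also have "\<dots> = 2 * norm (n *\<^sub>R k (\<gamma>' (t / n)) - n *\<^sub>R k (\<gamma> (t / n)))"
        by (simp add: scaleR_diff_right[symmetric])
      finally show ?case by simp
    qed
    then have yk: "(\<lambda>n. n * norm (k (y n))) \<longlonglongrightarrow> 0" by (rule Lim_null_comparison[OF _ lim])
    have "(\<lambda>n. gpow n (y n + \<gamma> (t * (1 / n)))) \<longlonglongrightarrow> \<gamma> (t * 1)"
    proof (rule r(2)[of "\<lambda>u. \<gamma> (t * u)" y])
      show "\<gamma> (t * (u + v)) = \<gamma> (t * u) + \<gamma> (t * v)" for u v
        by (simp add: distrib_left one_paramD(2)[OF assms(1)])
      show "\<gamma> (t * u) \<in> B r" if "0 \<le> u" "u \<le> 1" for u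
      proof (rule \<tau>')
        have "t * u \<le> t * 1" using that t by (intro mult_left_mono) auto
        moreover have "0 \<le> t * u" using that t by simp
        ultimately show "\<bar>t * u\<bar> < \<tau>" using t(2) by linarith
      qed
    qed (fact y0 yk)+
    moreover have "\<forall>\<^sub>F n in sequentially. gpow n (y n + \<gamma> (t * (1 / n))) = \<gamma>' t"
      using eventually_gt_at_top[of 0] by eventually_elim (simp add: y_def one_param_gpow[OF assms(2)])
    ultimately have "(\<lambda>n::nat. \<gamma>' t) \<longlonglongrightarrow> \<gamma> t" by (simp add: tendsto_cong)
    then show ?thesis using LIMSEQ_unique[OF tendsto_const] by metis
  qed
  have pos: "\<gamma> t = \<gamma>' t" if "t > 0" for t
  proof -
    obtain n :: nat where "t / \<tau> < n" using reals_Archimedean2 by blast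
    moreover have "0 < t / \<tau>" using \<tau>(1) that by simp
    ultimately have "n > 0" by linarith
    then have n: "t / n < \<tau>" "n > 0" using \<open>t / \<tau> < n\<close> \<tau>(1) by (auto simp: field_simps)
    then have "\<gamma> (t / n) = \<gamma>' (t / n)" using that by (intro small) auto
    then have "gpow n (\<gamma> (t / n)) = gpow n (\<gamma>' (t / n))" by simp
    then show ?thesis using n by (simp add: one_param_gpow[OF assms(1)] one_param_gpow[OF assms(2)])
  qed
  show ?thesis
  proof
    fix t :: real
    consider "t > 0" | "t = 0" | "- t > 0" by linarith
    then show "\<gamma> t = \<gamma>' t"
    proof cases
      case 3
      then show ?thesis using pos[OF 3] one_paramD(4)[OF assms(1), of t] one_paramD(4)[OF assms(2), of t] by simp
    qed (use pos one_paramD(3)[OF assms(1)] one_paramD(3)[OF assms(2)] in auto)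
  qed
qed

lemma one_param_scale:
  assumes "one_param \<gamma> X" shows "one_param (\<lambda>t. \<gamma> (c * t)) (c *\<^sub>R X)"
  unfolding one_param_def
proof (intro conjI allI)
  show "smooth_map_on EU \<A> UNIV (\<lambda>t. \<gamma> (c * t))"
    by (intro smooth_map_onI_smooth_at pre_atlas_euclidean is_pre_atlas
        smooth_at_comp[where g = \<gamma> and f = "\<lambda>t. c * t" and \<B> = EU] one_paramD(1)[OF assms]
        smooth_at_linear[OF _ smooth_at_EU_ident] bounded_linear_mult_right)
  show "\<gamma> (c * (s + t)) = \<gamma> (c * s) + \<gamma> (c * t)" for s t
    by (simp add: distrib_left one_paramD(2)[OF assms])
  have "((\<lambda>t. k (\<gamma> t)) has_vector_derivative X) (at (c * 0))" using one_paramD(5)[OF assms] by simp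
  then show "((\<lambda>t. k (\<gamma> (c * t))) has_vector_derivative c *\<^sub>R X) (at 0)"
    using vector_diff_chain_at[of "\<lambda>t. c * t" c 0 "\<lambda>t. k (\<gamma> t)" X]
    by (simp add: o_def has_real_derivative_iff_has_vector_derivative[symmetric] DERIV_cmult_Id)
qed

text \<open>Commutativity makes the product a homomorphism; its velocity is the sum because
  multiplication is additive to first order.\<close>

lemma one_param_add:
  assumes "one_param \<gamma> X" "one_param \<gamma>' Y" and comm: "\<And>s t. \<gamma> s + \<gamma>' t = \<gamma>' t + \<gamma> s"
  shows "one_param (\<lambda>t. \<gamma> t + \<gamma>' t) (X + Y)"
  unfolding one_param_def
proof (intro conjI allI)
  show "smooth_map_on EU \<A> UNIV (\<lambda>t. \<gamma> t + \<gamma>' t)"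
    by (intro smooth_map_onI_smooth_at pre_atlas_euclidean is_pre_atlas smooth_at_mult one_paramD(1)[OF assms(1)]
        one_paramD(1)[OF assms(2)])
  show "\<gamma> (s + t) + \<gamma>' (s + t) = (\<gamma> s + \<gamma>' s) + (\<gamma> t + \<gamma>' t)" for s t
  proof -
    have "\<gamma> s + \<gamma> t + (\<gamma>' s + \<gamma>' t) = \<gamma> s + (\<gamma> t + \<gamma>' s) + \<gamma>' t" by (simp only: add.assoc)
    then show ?thesis
      by (simp only: one_paramD(2)[OF assms(1)] one_paramD(2)[OF assms(2)] comm[of t s] add.assoc)
  qed
  have d: "((\<lambda>h. norm (k (\<gamma> h) - h *\<^sub>R X) / \<bar>h\<bar>) \<longlongrightarrow> 0) (at 0)"
    if "one_param \<gamma> X" for \<gamma> X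
    using one_paramD(5)[OF that] one_paramD(3)[OF that] unfolding has_vector_derivative_def has_derivative_at by simp
  show "((\<lambda>t. k (\<gamma> t + \<gamma>' t)) has_vector_derivative X + Y) (at 0)"
    unfolding has_vector_derivative_def has_derivative_at_alt
  proof (intro conjI allI impI)
    show "bounded_linear (\<lambda>x. x *\<^sub>R (X + Y))" by (rule bounded_linear_scaleR_left)
    fix \<epsilon> :: real assume "\<epsilon> > 0"
    \<comment> \<open>The denominator collects the errors: \<open>norm X + 1\<close> and
      \<open>norm Y + 1\<close> from the additive approximation, and 1 for each of the two
      velocities.\<close>
    define \<eta> where "\<eta> = min 1 (\<epsilon> / (4 + norm X + norm Y))"
    have n0: "4 + norm X + norm Y > 0" by (smt (verit) norm_ge_zero)
    have \<eta>: "\<eta> > 0" "\<eta> \<le> 1" "\<eta> * (4 + norm X + norm Y) \<le> \<epsilon>"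
    proof -
      show "\<eta> > 0" "\<eta> \<le> 1" using \<open>\<epsilon> > 0\<close> n0 by (auto simp: \<eta>_def)
      have "\<eta> * (4 + norm X + norm Y) \<le> \<epsilon> / (4 + norm X + norm Y) * (4 + norm X + norm Y)"
        using n0 by (intro mult_right_mono) (auto simp: \<eta>_def)
      then show "\<eta> * (4 + norm X + norm Y) \<le> \<epsilon>" using n0 by simp
    qed
    obtain r where r: "r > 0"
      "\<And>x y x' y'. x \<in> B r \<Longrightarrow> y \<in> B r \<Longrightarrow> x' \<in> B r \<Longrightarrow> y' \<in> B r \<Longrightarrow>
        norm (k (x + y) - k (x' + y') - ((k x - k x') + (k y - k y'))) \<le> \<eta> * (norm (k x - k x') + norm (k y - k y'))"
      by (rule mult_strictly_differentiable[OF \<eta>(1)]) (erule that, assumption)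
    have lim: "(\<gamma> \<longlongrightarrow> 0) (at 0)" "(\<gamma>' \<longlongrightarrow> 0) (at 0)"
      using one_param_tendsto[OF assms(1) tendsto_ident_at[of 0 UNIV]] one_param_tendsto[OF assms(2) tendsto_ident_at[of 0 UNIV]]
        one_paramD(3)[OF assms(1)] one_paramD(3)[OF assms(2)] by simp_all
    have "\<forall>\<^sub>F h in at 0. norm (k (\<gamma> h + \<gamma>' h) - h *\<^sub>R (X + Y)) \<le> \<epsilon> * \<bar>h\<bar>"
      using eventually_in_B[OF lim(1) r(1)] eventually_in_B[OF lim(2) r(1)]
        order_tendstoD(2)[OF d[OF assms(1)] \<eta>(1)] order_tendstoD(2)[OF d[OF assms(2)] \<eta>(1)]
        eventually_neq_at_within[of 0]
    proof eventually_elim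
      case (elim h)
      have b: "norm (k (\<gamma> h) - h *\<^sub>R X) \<le> \<eta> * \<bar>h\<bar>" "norm (k (\<gamma>' h) - h *\<^sub>R Y) \<le> \<eta> * \<bar>h\<bar>"
        using elim(3-5) by (auto simp: field_simps)
      have c: "norm (k (\<gamma> h)) \<le> norm X * \<bar>h\<bar> + \<bar>h\<bar>" "norm (k (\<gamma>' h)) \<le> norm Y * \<bar>h\<bar> + \<bar>h\<bar>"
        using b mult_right_mono[OF \<eta>(2), of "\<bar>h\<bar>"] norm_triangle_ineq2[of "k (\<gamma> h)" "h *\<^sub>R X"]
          norm_triangle_ineq2[of "k (\<gamma>' h)" "h *\<^sub>R Y"] by (auto simp: mult.commute)
      have "norm (k (\<gamma> h + \<gamma>' h) - (k (\<gamma> h) + k (\<gamma>' h))) \<le> \<eta> * (norm (k (\<gamma> h)) + norm (k (\<gamma>' h)))"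
        using r(2)[OF elim(1,2) zero_in_B[OF r(1)] zero_in_B[OF r(1)]] by simp
      also have "\<dots> \<le> \<eta> * ((norm X * \<bar>h\<bar> + \<bar>h\<bar>) + (norm Y * \<bar>h\<bar> + \<bar>h\<bar>))"
        using \<eta>(1) c by (intro mult_left_mono add_mono) auto
      finally have a: "norm (k (\<gamma> h + \<gamma>' h) - (k (\<gamma> h) + k (\<gamma>' h))) \<le> \<dots>" .
      have "norm ((k (\<gamma> h + \<gamma>' h) - (k (\<gamma> h) + k (\<gamma>' h))) + ((k (\<gamma> h) - h *\<^sub>R X) + (k (\<gamma>' h) - h *\<^sub>R Y)))
        \<le> \<eta> * ((norm X * \<bar>h\<bar> + \<bar>h\<bar>) + (norm Y * \<bar>h\<bar> + \<bar>h\<bar>)) + (\<eta> * \<bar>h\<bar> + \<eta> * \<bar>h\<bar>)"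
        by (intro norm_triangle_mono a b)
      also have "(k (\<gamma> h + \<gamma>' h) - (k (\<gamma> h) + k (\<gamma>' h))) + ((k (\<gamma> h) - h *\<^sub>R X) + (k (\<gamma>' h) - h *\<^sub>R Y))
        = k (\<gamma> h + \<gamma>' h) - h *\<^sub>R (X + Y)" by (simp add: scaleR_add_right)
      also have "\<eta> * ((norm X * \<bar>h\<bar> + \<bar>h\<bar>) + (norm Y * \<bar>h\<bar> + \<bar>h\<bar>)) + (\<eta> * \<bar>h\<bar> + \<eta> * \<bar>h\<bar>)
        = \<eta> * (4 + norm X + norm Y) * \<bar>h\<bar>" by (simp add: algebra_simps)
      also have "\<dots> \<le> \<epsilon> * \<bar>h\<bar>" using \<eta>(3) by (rule mult_right_mono) simp
      finally show ?case .
    qed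
    then obtain \<rho> where \<rho>: "\<rho> > 0"
      "\<And>h. h \<noteq> 0 \<Longrightarrow> \<bar>h\<bar> < \<rho> \<Longrightarrow> norm (k (\<gamma> h + \<gamma>' h) - h *\<^sub>R (X + Y)) \<le> \<epsilon> * \<bar>h\<bar>"
      unfolding eventually_at by (auto simp: dist_real_def)
    have z: "\<gamma> 0 = 0" "\<gamma>' 0 = 0" by (rule one_paramD(3)[OF assms(1)], rule one_paramD(3)[OF assms(2)])
    show "\<exists>d>0. \<forall>y. norm (y - 0) < d \<longrightarrow>
        norm (k (\<gamma> y + \<gamma>' y) - k (\<gamma> 0 + \<gamma>' 0) - (y - 0) *\<^sub>R (X + Y)) \<le> \<epsilon> * norm (y - 0)"
    proof (intro exI[of _ \<rho>] conjI allI impI \<rho>(1))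
      fix y :: real assume "norm (y - 0) < \<rho>"
      then show "norm (k (\<gamma> y + \<gamma>' y) - k (\<gamma> 0 + \<gamma>' 0) - (y - 0) *\<^sub>R (X + Y)) \<le> \<epsilon> * norm (y - 0)"
        using \<rho>(2)[of y] z by (cases "y = 0") auto
    qed
  qed
qed

section \<open>Horizontal paths and the Lie algebra of \<open>V\<close>\<close>

lemma g1_subspace: "subspace (g 1)"
  using carnot by (auto simp: carnot_group_def stratification_def)

text \<open>On the first layer the map induced by a dilation is multiplication by \<open>t\<close>,
  so by uniqueness of one-parameter subgroups only time is rescaled.\<close>

lemma g1_path:
  assumes X: "X \<in> g 1" and \<gamma>: "one_param \<gamma> X" and t: "t > 0"
  shows "\<delta> t (\<gamma> u) = \<gamma> (t * u)"
proof -
  have "1 \<in> {1..s}" using carnot by (simp add: carnot_group_def stratification_def)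
  moreover obtain D where D: "\<And>j X. j \<in> {1..s} \<Longrightarrow> X \<in> g j \<Longrightarrow> D X = t ^ j *\<^sub>R X"
    "\<And>X x. is_exp \<A> e X x \<Longrightarrow> is_exp \<A> e (D X) (\<delta> t x)"
    using carnot t unfolding carnot_group_def dilations_def by metis
  moreover have uX: "u *\<^sub>R X \<in> g 1" using g1_subspace X by (simp add: subspace_scale)
  ultimately have DX: "D (u *\<^sub>R X) = t *\<^sub>R u *\<^sub>R X" by (metis power_one_right)
  have "is_exp \<A> e (u *\<^sub>R X) (\<gamma> u)"
    unfolding is_exp_iff by (intro exI[of _ "\<lambda>t. \<gamma> (u * t)"]) (simp add: one_param_scale \<gamma>)
  then have "is_exp \<A> e ((t * u) *\<^sub>R X) (\<delta> t (\<gamma> u))" using D(2) DX by fastforce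
  then obtain \<eta> where \<eta>: "one_param \<eta> ((t * u) *\<^sub>R X)" "\<eta> 1 = \<delta> t (\<gamma> u)" unfolding is_exp_iff by blast
  have "\<eta> = (\<lambda>r. \<gamma> ((t * u) * r))" by (rule one_param_unique[OF \<eta>(1) one_param_scale[OF \<gamma>]])
  then show ?thesis using \<eta>(2) by simp
qed

text \<open>The Lie algebra of \<open>V\<close>: the whole path, not merely its endpoint, is
  required to stay in \<open>V\<close>.\<close>

definition VV :: "'a set" where "VV = {X \<in> g 1. \<exists>\<gamma>. one_param \<gamma> X \<and> range \<gamma> \<subseteq> V}"

text \<open>For positive times the path consists of dilates of \<open>v\<close>; inverses give the
  negative times.\<close>

lemma V_path:
  assumes "v \<in> V"
  obtains X \<gamma> where "X \<in> VV" "one_param \<gamma> X" "\<gamma> 1 = v"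
proof -
  obtain X \<gamma> where X: "X \<in> g 1" and \<gamma>: "one_param \<gamma> X" "\<gamma> 1 = v"
    using Vhor assms unfolding horizontal_def is_exp_iff by blast
  have pos: "\<gamma> t \<in> V" if "t > 0" for t
    using V_delta[OF that assms] g1_path[OF X \<gamma>(1) that, of 1] \<gamma>(2) by simp
  have "\<gamma> t \<in> V" for t
  proof -
    consider "t > 0" | "t = 0" | "- t > 0" by linarith
    then show ?thesis
    proof cases
      case 3
      then have "- \<gamma> (- t) \<in> V" using pos V_subgroup by blast
      then show ?thesis using one_paramD(4)[OF \<gamma>(1), of t] by simp
    qed (use pos one_paramD(3)[OF \<gamma>(1)] V_subgroup in auto)
  qed
  then have "X \<in> VV" using X \<gamma> by (auto simp: VV_def)
  then show thesis using that \<gamma> by blast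
qed

lemma V_delta_2:
  assumes "v \<in> V" shows "\<delta> 2 v = v + v"
proof -
  obtain X \<gamma> where X: "X \<in> VV" and \<gamma>: "one_param \<gamma> X" "\<gamma> 1 = v" using V_path[OF assms] .
  have "X \<in> g 1" using X by (simp add: VV_def)
  then have "\<delta> 2 (\<gamma> 1) = \<gamma> (2 * 1)" using \<gamma>(1) by (intro g1_path) auto
  also have "\<gamma> (2 * 1) = \<gamma> 1 + \<gamma> 1" using one_paramD(2)[OF \<gamma>(1), of 1 1] by simp
  finally show ?thesis by (simp add: \<gamma>(2))
qed

text \<open>On \<open>V\<close> the dilation by 2 is doubling, and a group in which doubling is a
  homomorphism is commutative.\<close>

lemma V_comm:
  assumes "v \<in> V" "w \<in> V" shows "v + w = w + v"
proof -
  have "v + (w + (v + w)) = v + (v + (w + w))"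
    using delta_add[of 2 v w] V_delta_2[OF assms(1)] V_delta_2[OF assms(2)]
      V_delta_2[OF V_subgroup(2)[OF assms]] by (simp add: add.assoc)
  then have "w + (v + w) = v + (w + w)" by (rule add_left_imp_eq)
  then have "(w + v) + w = (v + w) + w" by (simp only: add.assoc)
  then show ?thesis using add_right_imp_eq by metis
qed

lemma VV_D: "X \<in> VV \<Longrightarrow> X \<in> g 1" "X \<in> VV \<Longrightarrow> \<exists>\<gamma>. one_param \<gamma> X \<and> range \<gamma> \<subseteq> V"
  by (auto simp: VV_def)

lemma VV_subspace: "subspace VV"
  unfolding subspace_def
proof (intro conjI ballI allI)
  have "one_param (\<lambda>t. 0) 0"
    unfolding one_param_def using V_subgroup(1)
    by (auto intro: smooth_map_onI_smooth_at pre_atlas_euclidean is_pre_atlas)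
  then show "0 \<in> VV"
    using V_subgroup(1) g1_subspace unfolding VV_def by (auto simp: subspace_0 intro!: exI[of _ "\<lambda>t. 0"])
  fix X assume X: "X \<in> VV"
  obtain \<gamma> where \<gamma>: "one_param \<gamma> X" "range \<gamma> \<subseteq> V" using VV_D(2)[OF X] by blast
  show "c *\<^sub>R X \<in> VV" for c
    using one_param_scale[OF \<gamma>(1), of c] \<gamma>(2) subspace_scale[OF g1_subspace VV_D(1)[OF X], of c]
    unfolding VV_def by blast
  fix Y assume Y: "Y \<in> VV"
  obtain \<gamma>' where \<gamma>': "one_param \<gamma>' Y" "range \<gamma>' \<subseteq> V" using VV_D(2)[OF Y] by blast
  have "one_param (\<lambda>t. \<gamma> t + \<gamma>' t) (X + Y)"
    using \<gamma> \<gamma>' by (intro one_param_add V_comm) auto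
  moreover have "\<gamma> t + \<gamma>' t \<in> V" for t using \<gamma> \<gamma>' V_subgroup(2) by blast
  ultimately show "X + Y \<in> VV"
    using subspace_add[OF g1_subspace VV_D(1)[OF X] VV_D(1)[OF Y]] unfolding VV_def
    by (auto intro!: exI[of _ "\<lambda>t. \<gamma> t + \<gamma>' t"])
qed

text \<open>The choice is unambiguous on \<open>VV\<close>: by \<open>one_param_unique\<close> the
  velocity determines the path.\<close>

definition \<Gamma> :: "'a \<Rightarrow> real \<Rightarrow> 'g" where "\<Gamma> X = (SOME \<gamma>. one_param \<gamma> X)"
definition E0 :: "'a \<Rightarrow> 'g" where "E0 X = \<Gamma> X 1"

lemma \<Gamma>:
  assumes "X \<in> VV" shows "one_param (\<Gamma> X) X" "\<Gamma> X t \<in> V"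
proof -
  obtain \<gamma> where \<gamma>: "one_param \<gamma> X" "range \<gamma> \<subseteq> V" using VV_D(2)[OF assms] by blast
  show 1: "one_param (\<Gamma> X) X" unfolding \<Gamma>_def using \<gamma>(1) by (rule someI[of "\<lambda>\<gamma>. one_param \<gamma> X"])
  show "\<Gamma> X t \<in> V" using one_param_unique[OF 1 \<gamma>(1)] \<gamma>(2) by blast
qed

lemma E0_scale:
  assumes "X \<in> VV" shows "E0 (c *\<^sub>R X) = \<Gamma> X c"
  using one_param_unique[OF \<Gamma>(1)[OF subspace_scale[OF VV_subspace assms]] one_param_scale[OF \<Gamma>(1)[OF assms]], of c]
  by (simp add: E0_def)

lemma E0_add:
  assumes "X \<in> VV" "Y \<in> VV" shows "E0 (X + Y) = E0 X + E0 Y"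
proof -
  have "one_param (\<lambda>t. \<Gamma> X t + \<Gamma> Y t) (X + Y)"
    using \<Gamma> assms by (intro one_param_add V_comm) auto
  from one_param_unique[OF \<Gamma>(1)[OF subspace_add[OF VV_subspace assms]] this]
  show ?thesis by (simp add: E0_def)
qed

lemma E0_V: "X \<in> VV \<Longrightarrow> E0 X \<in> V" by (simp add: E0_def \<Gamma>)

lemma E0_delta: "X \<in> VV \<Longrightarrow> t > 0 \<Longrightarrow> \<delta> t (E0 X) = E0 (t *\<^sub>R X)"
  unfolding E0_scale unfolding E0_def using g1_path[OF VV_D(1) \<Gamma>(1), of X t 1] by simp

lemma E0_surj:
  assumes "v \<in> V" obtains X where "X \<in> VV" "E0 X = v"
proof -
  obtain X \<gamma> where X: "X \<in> VV" "one_param \<gamma> X" "\<gamma> 1 = v" using V_path[OF assms] .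
  then have "E0 X = v" using one_param_unique[OF \<Gamma>(1)[OF X(1)] X(2)] by (simp add: E0_def)
  then show thesis using that X by blast
qed

lemma E0_0: "E0 0 = 0"
  using E0_add[OF subspace_0[OF VV_subspace] subspace_0[OF VV_subspace]]
  by (metis add.right_neutral add_left_cancel)

text \<open>Dilations fix 0, so the path vanishes at all times 1/n, and its velocity is the limit of
  n times these values in coordinates.\<close>

lemma E0_eq_0:
  assumes "X \<in> VV" "E0 X = 0" shows "X = 0"
proof -
  have z: "\<Gamma> X (1 / n) = 0" if "n > 0" for n :: nat
    using E0_delta[OF assms(1), of "1 / n"] E0_scale[OF assms(1), of "1 / n"] assms(2) delta_0[of "1 / n"] that by simp
  have "\<forall>\<^sub>F n in sequentially. n *\<^sub>R k (\<Gamma> X (1 / n)) = 0"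
    using eventually_gt_at_top[of 0] by eventually_elim (simp add: z)
  then have "(\<lambda>n. n *\<^sub>R k (\<Gamma> X (1 / n))) \<longlonglongrightarrow> 0" by (rule tendsto_eventually)
  from LIMSEQ_unique[OF one_param_lim[OF \<Gamma>(1)[OF assms(1)]] this] show ?thesis by simp
qed

section \<open>The exponential map of \<open>V\<close> on the model space\<close>

definition BV :: "'a set" where
  "BV = (SOME B. B \<subseteq> VV \<and> pairwise orthogonal B \<and> (\<forall>b\<in>B. norm b = 1) \<and> independent B \<and> span B = VV)"

lemma BV: "BV \<subseteq> VV" "pairwise orthogonal BV" "b \<in> BV \<Longrightarrow> norm b = 1" "span BV = VV" "finite BV"
proof -
  have "\<exists>B. B \<subseteq> VV \<and> pairwise orthogonal B \<and> (\<forall>b\<in>B. norm b = 1) \<and> independent B \<and> span B = VV"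
    using orthonormal_basis_subspace[OF VV_subspace] by metis
  from someI_ex[OF this] show "BV \<subseteq> VV" "pairwise orthogonal BV" "b \<in> BV \<Longrightarrow> norm b = 1" "span BV = VV" "finite BV"
    unfolding BV_def[symmetric] by (auto intro: independent_imp_finite)
qed

definition P :: "'a \<Rightarrow> 'a" where "P X = (\<Sum>b\<in>BV. (X \<bullet> b) *\<^sub>R b)"

lemma P_VV: "P X \<in> VV"
  unfolding P_def using BV(1) by (intro subspace_sum VV_subspace subspace_scale) auto

lemma P_linear: "bounded_linear P"
  unfolding P_def by (intro bounded_linear_sum bounded_linear_scaleR_const bounded_linear_inner_left)

lemma P_id: "X \<in> VV \<Longrightarrow> P X = X"
  unfolding P_def using BV by (intro orthonormal_basis_expand) auto

lemma P_P [simp]: "P (P X) = P X" using P_id P_VV by blast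

text \<open>Composing with \<open>P\<close> therefore does not spoil the contraction factor of the
  fixed-point equation solved later.\<close>

lemma norm_P_le: "norm (P X) \<le> norm X"
proof -
  have "P X \<bullet> c = X \<bullet> c" if c: "c \<in> BV" for c
  proof -
    have "P X \<bullet> c = (\<Sum>b\<in>BV. (X \<bullet> b) * (b \<bullet> c))" by (simp add: P_def inner_sum_left)
    also have "\<dots> = (\<Sum>b\<in>BV. if b = c then X \<bullet> c else 0)"
    proof (rule sum.cong[OF refl])
      fix b assume b: "b \<in> BV"
      have "b \<bullet> c = 0" if "b \<noteq> c"
        using pairwiseD[OF BV(2) b c that] by (simp add: orthogonal_def)
      moreover have "c \<bullet> c = 1" using BV(3)[OF c] by (simp add: dot_square_norm)
      ultimately show "(X \<bullet> b) * (b \<bullet> c) = (if b = c then X \<bullet> c else 0)" by auto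
    qed
    finally show ?thesis using c BV(5) by simp
  qed
  moreover have "Z \<bullet> P X = (\<Sum>b\<in>BV. (X \<bullet> b) * (Z \<bullet> b))" for Z
    by (simp add: P_def inner_sum_right)
  ultimately have "P X \<bullet> P X = X \<bullet> P X" by simp
  then have "norm (P X) * norm (P X) \<le> norm X * norm (P X)"
    using norm_cauchy_schwarz[of X "P X"] by (simp add: dot_square_norm power2_eq_square)
  then show ?thesis by (cases "norm (P X) = 0") auto
qed

text \<open>The exponential map on the Lie algebra \<open>VV\<close> of \<open>V\<close>, extended to the model space by the orthogonal
  projection \<open>P\<close>.\<close>

definition E :: "'a \<Rightarrow> 'g" where "E X = E0 (P X)"

lemma E_add: "E (X + Y) = E X + E Y"
  using bounded_linear.linear[OF P_linear] by (simp add: E_def linear_add E0_add P_VV)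

lemma E_0 [simp]: "E 0 = 0"
  using bounded_linear.linear[OF P_linear] by (simp add: E_def linear_0 E0_0)

lemma E_minus: "E (- X) = - E X"
  using E_add[of X "- X"] by (simp add: eq_neg_iff_add_eq_0[symmetric] minus_unique)

lemma E_diff: "E (X - Y) = E X - E Y"
  using E_add[of X "- Y"] by (simp add: E_minus)

lemma E_V: "E X \<in> V" by (simp add: E_def E0_V P_VV)

lemma E_P [simp]: "E (P X) = E X" by (simp add: E_def)

lemma E_delta: "t > 0 \<Longrightarrow> \<delta> t (E X) = E (t *\<^sub>R X)"
  using bounded_linear.linear[OF P_linear] by (simp add: E_def E0_delta P_VV linear_cmul)

lemma E_surj: "v \<in> V \<Longrightarrow> \<exists>X\<in>VV. E X = v"
  using E0_surj P_id unfolding E_def by metis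

lemma E_eq_0: "X \<in> VV \<Longrightarrow> E X = 0 \<Longrightarrow> X = 0"
  unfolding E_def using E0_eq_0 P_id by simp

text \<open>Along the basis \<open>BV\<close>, \<open>E\<close> is a product of one-parameter
  subgroups evaluated at linear coordinates.\<close>

lemma smooth_at_E:
  assumes "pre_atlas \<B>" "smooth_at \<B> EU f x"
  shows "smooth_at \<B> \<A> (\<lambda>x. E (f x)) x"
proof -
  have "smooth_at EU \<A> (\<lambda>X. E0 (\<Sum>b\<in>F. (X \<bullet> b) *\<^sub>R b)) Y" if "finite F" "F \<subseteq> BV" for F Y
    using that
  proof (induction F)
    case empty
    then show ?case by simp
  next
    case (insert b F)
    have b: "b \<in> VV" using insert BV(1) by auto
    have "(\<Sum>b\<in>F. (X \<bullet> b) *\<^sub>R b) \<in> VV" for X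
      using insert BV(1) by (intro subspace_sum VV_subspace subspace_scale) auto
    then have "E0 (\<Sum>b\<in>insert b F. (X \<bullet> b) *\<^sub>R b) = \<Gamma> b (X \<bullet> b) + E0 (\<Sum>b\<in>F. (X \<bullet> b) *\<^sub>R b)" for X
      using insert b by (simp add: E0_add E0_scale subspace_scale[OF VV_subspace])
    moreover have "smooth_at EU \<A> (\<lambda>X. \<Gamma> b (X \<bullet> b)) Y"
      by (rule smooth_at_comp[OF pre_atlas_euclidean pre_atlas_euclidean is_pre_atlas
            smooth_at_linear[OF pre_atlas_euclidean smooth_at_EU_ident bounded_linear_inner_left] one_paramD(1)[OF \<Gamma>(1)[OF b]]])
    ultimately show ?case using insert by (simp add: smooth_at_mult)
  qed
  then have "smooth_at EU \<A> E (f x)" using BV(5) by (simp add: E_def[abs_def] P_def)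
  from smooth_at_comp[OF assms(1) pre_atlas_euclidean is_pre_atlas assms(2) this] show ?thesis .
qed

lemma tendsto_E: "(f \<longlongrightarrow> X) F \<Longrightarrow> ((\<lambda>z. E (f z)) \<longlongrightarrow> E X) F"
  using isCont_tendsto_compose[OF smooth_at_isCont[OF smooth_at_E[OF pre_atlas_euclidean smooth_at_EU_ident]]] by blast

text \<open>Dilations make both sides homogeneous of degree 1, so compactness of the unit sphere and
  the unit ball suffices. The trivial kernel of \<open>E\<close> on \<open>VV\<close> makes the
  lower bound positive.\<close>

lemma E_bounds:
  obtains c C where "c > 0" "C > 0" "\<And>X. X \<in> VV \<Longrightarrow> c * norm X \<le> nrm (E X)" "\<And>X. nrm (E X) \<le> C * norm X"
proof -
  have cont: "continuous_on S (\<lambda>X. nrm (E X))" for S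
    unfolding continuous_on_def by (intro ballI tendsto_nrm tendsto_E tendsto_ident_at)
  have scale: "nrm (E (t *\<^sub>R X)) = t * nrm (E X)" if "t > 0" for t X
    using nrm_delta[OF that, of "E X"] E_delta[OF that] by simp
  have "\<exists>c>0. \<forall>X\<in>VV \<inter> sphere 0 1. c \<le> nrm (E X)"
  proof (cases "VV \<inter> sphere 0 1 = {}")
    case False
    have "compact (VV \<inter> sphere 0 1)"
      by (intro closed_Int_compact closed_subspace VV_subspace compact_sphere)
    from continuous_attains_inf[OF this False cont]
    obtain X0 where X0: "X0 \<in> VV" "norm X0 = 1" "\<And>X. X \<in> VV \<inter> sphere 0 1 \<Longrightarrow> nrm (E X0) \<le> nrm (E X)" by auto
    have "E X0 \<noteq> 0" using E_eq_0[OF X0(1)] X0(2) by auto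
    then have "nrm (E X0) > 0" by (metis UNIV_I dm.mdist_pos_eq)
    then show ?thesis using X0 by blast
  qed (auto intro: exI[of _ 1])
  then obtain c where c: "c > 0" "\<And>X. X \<in> VV \<Longrightarrow> norm X = 1 \<Longrightarrow> c \<le> nrm (E X)" by auto
  have "\<exists>X1\<in>cball 0 1. \<forall>X\<in>cball 0 1. nrm (E X) \<le> nrm (E X1)"
    by (rule continuous_attains_sup[OF compact_cball _ cont]) simp
  then obtain X1 where "\<forall>X\<in>cball 0 1. nrm (E X) \<le> nrm (E X1)" by blast
  then have X1: "nrm (E X) \<le> nrm (E X1)" if "norm X \<le> 1" for X using that by simp
  have up: "nrm (E X) \<le> (nrm (E X1) + 1) * norm X" for X
  proof (cases "X = 0")
    case False
    have "nrm (E X) = nrm (E (norm X *\<^sub>R (X /\<^sub>R norm X)))" using False by simp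
    also have "\<dots> = norm X * nrm (E (X /\<^sub>R norm X))" using False by (intro scale) simp
    also have "\<dots> \<le> norm X * nrm (E X1)" using False by (intro mult_left_mono X1) auto
    also have "\<dots> \<le> norm X * (nrm (E X1) + 1)" by (intro mult_left_mono) auto
    finally show ?thesis by (simp add: mult.commute)
  qed simp
  have lo: "c * norm X \<le> nrm (E X)" if "X \<in> VV" for X
  proof (cases "X = 0")
    case False
    have "c \<le> nrm (E (X /\<^sub>R norm X))"
      using False that by (intro c(2) subspace_scale VV_subspace) auto
    then have "norm X * c \<le> norm X * nrm (E (X /\<^sub>R norm X))" by (intro mult_left_mono) auto
    also have "\<dots> = nrm (E (norm X *\<^sub>R (X /\<^sub>R norm X)))" using False by (intro scale[symmetric]) simp
    finally show ?thesis using False by (simp add: mult.commute)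
  qed simp
  show thesis using that[OF c(1) _ lo up] by (simp add: add_nonneg_pos)
qed

section \<open>Normality of \<open>W\<close>\<close>

lemma delta_tendsto_0: "(\<lambda>n. \<delta> (1 / real n) x) \<longlonglongrightarrow> 0"
proof -
  have "\<forall>\<^sub>F n in sequentially. nrm x / real n = nrm (\<delta> (1 / real n) x)"
    using eventually_gt_at_top[of 0] by eventually_elim (simp add: nrm_delta)
  then have "(\<lambda>n. nrm (\<delta> (1 / real n) x)) \<longlonglongrightarrow> 0"
    using lim_const_over_n[of "nrm x"] by (simp add: tendsto_cong)
  then show ?thesis by (simp add: tendsto_iff_d)
qed

text \<open>Dilation by 1/n makes both factors of coordinate size O(1/n), where the products in
  either order agree up to an arbitrarily small relative error. The commutator is therefore
  o(1/n).\<close>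

lemma k_commutator_delta:
  "(\<lambda>n. n * norm (k (\<delta> (1 / real n) (a + b - (b + a))))) \<longlonglongrightarrow> 0"
  unfolding tendsto_iff
proof (intro allI impI)
  fix \<epsilon> :: real assume "\<epsilon> > 0"
  obtain r1 C where r1: "r1 > 0" "C > 0" "\<And>x. x \<in> B r1 \<Longrightarrow> norm (k x) \<le> C * nrm x" using norm_k_le_nrm by blast
  obtain r2 where r2: "r2 > 0"
    "\<And>x y. x \<in> B r2 \<Longrightarrow> y \<in> B r2 \<Longrightarrow> x - y \<in> B r2 \<Longrightarrow> norm (k (x - y)) \<le> 2 * norm (k x - k y)"
    using k_diff_le by blast
  define M where "M = C * (nrm a + nrm b) + 1"
  have M: "M > 0" using r1(2) by (simp add: M_def add_nonneg_pos)
  \<comment> \<open>\<open>M\<close> bounds n times the total coordinate size of the two factors,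
    and the final estimate is \<open>4 * \<eta> * M = \<epsilon> / 2\<close>.\<close>
  define \<eta> where "\<eta> = \<epsilon> / (8 * M)"
  have \<eta>: "\<eta> > 0" using M \<open>\<epsilon> > 0\<close> by (simp add: \<eta>_def)
  obtain r3 where r3: "r3 > 0"
    "\<And>x y x' y'. x \<in> B r3 \<Longrightarrow> y \<in> B r3 \<Longrightarrow> x' \<in> B r3 \<Longrightarrow> y' \<in> B r3 \<Longrightarrow>
      norm (k (x + y) - k (x' + y') - ((k x - k x') + (k y - k y'))) \<le> \<eta> * (norm (k x - k x') + norm (k y - k y'))"
    by (rule mult_strictly_differentiable[OF \<eta>]) (erule that, assumption)
  define r where "r = min r1 (min r2 r3)"
  have r: "r > 0" "r \<le> r1" "r \<le> r2" "r \<le> r3" using r1 r2 r3 by (auto simp: r_def)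
  define A B' where "A n = \<delta> (1 / real n) a" and "B' n = \<delta> (1 / real n) b" for n
  have A0: "A \<longlonglongrightarrow> 0" "B' \<longlonglongrightarrow> 0" unfolding A_def[abs_def] B'_def[abs_def] by (rule delta_tendsto_0)+
  have AB: "(\<lambda>n. A n + B' n) \<longlonglongrightarrow> 0" "(\<lambda>n. B' n + A n) \<longlonglongrightarrow> 0"
    using tendsto_group_add[OF A0] tendsto_group_add[OF A0(2,1)] by auto
  have D0: "(\<lambda>n. A n + B' n - (B' n + A n)) \<longlonglongrightarrow> 0" using tendsto_group_diff[OF AB] by simp
  show "\<forall>\<^sub>F n in sequentially. dist (n * norm (k (\<delta> (1 / real n) (a + b - (b + a))))) 0 < \<epsilon>"
    using eventually_in_B[OF A0(1) r(1)] eventually_in_B[OF A0(2) r(1)] eventually_in_B[OF AB(1) r(1)]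
      eventually_in_B[OF AB(2) r(1)] eventually_in_B[OF D0 r(1)] eventually_gt_at_top[of 0]
  proof eventually_elim
    case (elim n)
    have sub: "B r \<subseteq> B r1" "B r \<subseteq> B r2" "B r \<subseteq> B r3" using r by (auto intro!: B_mono)
    have n: "1 / real n > 0" using elim by simp
    have eq: "\<delta> (1 / real n) (a + b - (b + a)) = A n + B' n - (B' n + A n)"
      using n by (simp only: A_def B'_def diff_conv_add_uminus delta_add delta_uminus)
    have kA: "norm (k (A n)) \<le> C * nrm (A n)" "norm (k (B' n)) \<le> C * nrm (B' n)"
      using r1(3) sub(1) elim by blast+
    have nA: "nrm (A n) = nrm a / n" "nrm (B' n) = nrm b / n"
      using n by (simp_all add: A_def B'_def nrm_delta)
    have kAB: "norm (k (A n)) + norm (k (B' n)) \<le> M / n"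
    proof -
      have "norm (k (A n)) + norm (k (B' n)) \<le> C * (nrm a / n) + C * (nrm b / n)" using kA nA by simp
      also have "\<dots> = (C * (nrm a + nrm b)) / n" by (simp add: distrib_left add_divide_distrib)
      also have "\<dots> \<le> M / n" by (intro divide_right_mono) (auto simp: M_def)
      finally show ?thesis .
    qed
    have 1: "norm (k (A n + B' n) - (k (A n) + k (B' n))) \<le> \<eta> * (norm (k (A n)) + norm (k (B' n)))"
      using r3(2)[of "A n" "B' n" 0 0] sub(3) elim zero_in_B[OF r3(1)] by auto
    have 2: "norm (k (B' n + A n) - (k (B' n) + k (A n))) \<le> \<eta> * (norm (k (B' n)) + norm (k (A n)))"
      using r3(2)[of "B' n" "A n" 0 0] sub(3) elim zero_in_B[OF r3(1)] by auto
    have "norm (k (A n + B' n) - k (B' n + A n)) \<le> 2 * (\<eta> * (norm (k (A n)) + norm (k (B' n))))"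
      using norm_triangle_le_diff[OF add_mono[OF 1 2]] by (simp add: algebra_simps)
    also have "\<dots> \<le> 2 * (\<eta> * (M / n))" using kAB \<eta> by (intro mult_left_mono) auto
    finally have "norm (k (A n + B' n) - k (B' n + A n)) \<le> 2 * (\<eta> * (M / n))" .
    moreover have "norm (k (A n + B' n - (B' n + A n))) \<le> 2 * norm (k (A n + B' n) - k (B' n + A n))"
      using r2(2) sub(2) elim by blast
    ultimately have "norm (k (A n + B' n - (B' n + A n))) \<le> 4 * (\<eta> * (M / n))" by linarith
    then have "n * norm (k (A n + B' n - (B' n + A n))) \<le> n * (4 * (\<eta> * (M / n)))" by (intro mult_left_mono) auto
    also have "\<dots> = \<epsilon> / 2" using elim M by (simp add: \<eta>_def)
    also have "\<dots> < \<epsilon>" using \<open>\<epsilon> > 0\<close> by simp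
    finally show ?case by (simp add: eq)
  qed
qed

lemma W_gpow: "x \<in> W \<Longrightarrow> gpow n x \<in> W"
  by (induction n) (auto intro: W_subgroup)

text \<open>If a commutator had a nontrivial \<open>V\<close>-component \<open>v\<close>, then, since commutators are infinitesimal
  of higher order under dilations, the powers \<open>(\<delta>\<^bsub>1/n\<^esub> w)\<^sup>n\<close> of its \<open>W\<close>-component \<open>w\<close> would converge to \<open>-v\<close>.\<close>

lemma commutator_in_W: "a + b - (b + a) \<in> W"
proof -
  define y where "y = a + b - (b + a)"
  obtain w v where wv: "w \<in> W" "v \<in> V" "y = w + v" using WV unfolding complementary_def by blast
  obtain X where X: "X \<in> VV" "E X = v" using E_surj[OF wv(2)] by blast
  obtain r where r: "r > 0"
    "\<And>\<gamma> y. (\<And>s t :: real. \<gamma> (s + t) = \<gamma> s + \<gamma> t) \<Longrightarrow> (\<And>t. 0 \<le> t \<Longrightarrow> t \<le> 1 \<Longrightarrow> \<gamma> t \<in> B r) \<Longrightarrow>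
      (y \<longlongrightarrow> 0) sequentially \<Longrightarrow> (\<lambda>n. n * norm (k (y n))) \<longlonglongrightarrow> 0 \<Longrightarrow>
      (\<lambda>n. gpow n (y n + \<gamma> (1 / n))) \<longlonglongrightarrow> \<gamma> 1"
    using gpow_perturb by blast
  have "(E \<longlongrightarrow> E 0) (nhds 0)" using tendsto_E[of "\<lambda>x. x" 0 "nhds 0"] by (simp add: filterlim_ident)
  then have "\<forall>\<^sub>F Z in nhds 0. E Z \<in> B r" using r(1) by (intro eventually_in_B) auto
  then obtain \<rho> where \<rho>: "\<rho> > 0" "\<And>Z. norm Z < \<rho> \<Longrightarrow> E Z \<in> B r" unfolding eventually_nhds_metric by auto
  \<comment> \<open>Shrinking by \<tau> brings the path into \<open>B r\<close>; \<open>W\<close>,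
    \<open>V\<close> and the form of a commutator are preserved by dilations.\<close>
  define \<tau> where "\<tau> = \<rho> / (norm X + 1)"
  have nX: "norm X + 1 > 0" by (smt (verit) norm_ge_zero)
  have \<tau>: "\<tau> > 0" "\<tau> * norm X < \<rho>" using \<rho>(1) nX by (auto simp: \<tau>_def field_simps)
  have yt: "\<delta> \<tau> y = \<delta> \<tau> a + \<delta> \<tau> b - (\<delta> \<tau> b + \<delta> \<tau> a)"
    using \<tau>(1) by (simp only: y_def diff_conv_add_uminus delta_add delta_uminus)
  \<comment> \<open>The path runs along the inverse of the \<open>V\<close>-component, so that
    multiplying by it leaves the dilated \<open>W\<close>-component.\<close>
  have "(\<lambda>n. gpow n (\<delta> (1 / n) (\<delta> \<tau> y) + E ((1 / n) *\<^sub>R (- \<tau> *\<^sub>R X)))) \<longlonglongrightarrow> E (1 *\<^sub>R (- \<tau> *\<^sub>R X))"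
  proof (rule r(2)[of "\<lambda>t. E (t *\<^sub>R (- \<tau> *\<^sub>R X))" "\<lambda>n. \<delta> (1 / n) (\<delta> \<tau> y)"])
    show "E ((u + t) *\<^sub>R (- \<tau> *\<^sub>R X)) = E (u *\<^sub>R (- \<tau> *\<^sub>R X)) + E (t *\<^sub>R (- \<tau> *\<^sub>R X))" for u t
      by (simp only: scaleR_add_left E_add)
    show "E (t *\<^sub>R (- \<tau> *\<^sub>R X)) \<in> B r" if "0 \<le> t" "t \<le> 1" for t
    proof (rule \<rho>(2))
      have "t * (\<tau> * norm X) \<le> 1 * (\<tau> * norm X)" using that \<tau> by (intro mult_right_mono) auto
      moreover have "norm (t *\<^sub>R (- \<tau> *\<^sub>R X)) = t * (\<tau> * norm X)" using that \<tau> by simp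
      ultimately show "norm (t *\<^sub>R (- \<tau> *\<^sub>R X)) < \<rho>" using \<tau>(2) by linarith
    qed
    show "(\<lambda>n. \<delta> (1 / real n) (\<delta> \<tau> y)) \<longlonglongrightarrow> 0" by (rule delta_tendsto_0)
    show "(\<lambda>n. n * norm (k (\<delta> (1 / real n) (\<delta> \<tau> y)))) \<longlonglongrightarrow> 0"
      unfolding yt by (rule k_commutator_delta)
  qed
  moreover have "\<forall>\<^sub>F n in sequentially. gpow n (\<delta> (1 / n) (\<delta> \<tau> y) + E ((1 / n) *\<^sub>R (- \<tau> *\<^sub>R X))) = gpow n (\<delta> (1 / n) (\<delta> \<tau> w))"
    using eventually_gt_at_top[of 0]
  proof eventually_elim
    case (elim n)
    have "\<delta> (1 / n) (\<delta> \<tau> y) = \<delta> (1 / n) (\<delta> \<tau> w) + E ((1 / n) *\<^sub>R \<tau> *\<^sub>R X)"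
      using elim \<tau>(1) by (simp add: wv(3) delta_add X(2)[symmetric] E_delta)
    moreover have "E ((1 / n) *\<^sub>R (- \<tau> *\<^sub>R X)) = - E ((1 / n) *\<^sub>R \<tau> *\<^sub>R X)"
      by (simp only: scaleR_minus_left scaleR_minus_right E_minus)
    ultimately show ?case by (simp add: add.assoc)
  qed
  ultimately have lim: "(\<lambda>n. gpow n (\<delta> (1 / n) (\<delta> \<tau> w))) \<longlonglongrightarrow> E (- \<tau> *\<^sub>R X)" by (simp add: tendsto_cong)
  have "\<forall>\<^sub>F n in sequentially. gpow n (\<delta> (1 / real n) (\<delta> \<tau> w)) \<in> W"
    using eventually_gt_at_top[of 0] by eventually_elim (use wv(1) \<tau>(1) in \<open>auto intro!: W_gpow W_delta\<close>)
  then obtain N where N: "\<And>n. n \<ge> N \<Longrightarrow> gpow n (\<delta> (1 / real n) (\<delta> \<tau> w)) \<in> W"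
    unfolding eventually_sequentially by blast
  \<comment> \<open>Closedness of \<open>W\<close> puts the limit into the intersection of
    \<open>W\<close> and \<open>V\<close>.\<close>
  have "E (- \<tau> *\<^sub>R X) \<in> W"
    by (rule W_closed[OF _ LIMSEQ_ignore_initial_segment[OF lim, of N]]) (simp add: N del: of_nat_add)
  then have "E (- \<tau> *\<^sub>R X) = 0" using E_V by (rule W_Int_V)
  then have "- \<tau> *\<^sub>R X = 0" by (rule E_eq_0[rotated]) (intro subspace_scale VV_subspace X(1))
  then have "v = 0" using \<tau>(1) X(2) by simp
  then show ?thesis using wv by (simp add: y_def)
qed

lemma W_conj:
  assumes "w \<in> W" shows "x + w - x \<in> W"
proof -
  have "x + w - x = (x + w - (w + x)) + w" by (simp add: diff_conv_add_uminus add.assoc minus_add del: add_uminus_conv_diff)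
  then show ?thesis using W_subgroup(2)[OF commutator_in_W assms, of x w] by simp
qed

section \<open>The \<open>V\<close>-component as a smooth homomorphism\<close>

text \<open>The logarithm of the \<open>V\<close>-component, with values in the model space;
  \<open>pw\<close> is then the \<open>W\<close>-component.\<close>

definition h :: "'g \<Rightarrow> 'a" where "h x = (THE X. X \<in> VV \<and> x - E X \<in> W)"
definition pw :: "'g \<Rightarrow> 'g" where "pw x = x - E (h x)"

lemma h_unique:
  assumes "X \<in> VV" "x - E X \<in> W" shows "h x = X"
  unfolding h_def
proof (rule the_equality)
  fix Y assume Y: "Y \<in> VV \<and> x - E Y \<in> W"
  have "- (x - E Y) + (x - E X) = E Y - E X"
    by (simp only: diff_conv_add_uminus minus_add add.assoc minus_minus minus_add_cancel)
  also have "\<dots> = E (Y - X)" by (simp add: E_diff)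
  finally have "E (Y - X) \<in> W" using W_subgroup(2,3) Y assms(2) by metis
  then have "E (Y - X) = 0" using E_V by (rule W_Int_V)
  then have "Y - X = 0" using Y assms(1) by (intro E_eq_0) (auto intro: subspace_diff VV_subspace)
  then show "Y = X" by simp
qed (use assms in blast)

lemma h_VV_pw_W: "h x \<in> VV \<and> pw x \<in> W"
proof -
  obtain w v where wv: "w \<in> W" "v \<in> V" "x = w + v" using WV unfolding complementary_def by blast
  obtain X where X: "X \<in> VV" "E X = v" using E_surj[OF wv(2)] by blast
  have "x - E X = w" using wv X by (simp add: diff_conv_add_uminus add.assoc del: add_uminus_conv_diff)
  then have "h x = X" using X wv by (intro h_unique) auto
  then show ?thesis using X wv \<open>x - E X = w\<close> by (simp add: pw_def)
qed

lemma h_VV: "h x \<in> VV" and pw_W: "pw x \<in> W"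
  using h_VV_pw_W by auto

lemma decomp: "x = pw x + E (h x)"
  by (simp add: pw_def)

lemma h_decomp: "w \<in> W \<Longrightarrow> X \<in> VV \<Longrightarrow> h (w + E X) = X"
  by (rule h_unique) (auto simp: diff_conv_add_uminus add.assoc simp del: add_uminus_conv_diff)

lemma pw_decomp: "w \<in> W \<Longrightarrow> X \<in> VV \<Longrightarrow> pw (w + E X) = w"
  by (simp add: pw_def h_decomp)

lemma P_h [simp]: "P (h x) = h x" using P_id h_VV by blast

text \<open>\<open>E (h x)\<close> is moved to the right past \<open>pw y\<close>, which turns into
  a conjugate and by normality stays in \<open>W\<close>.\<close>

lemma h_add: "h (x + y) = h x + h y"
proof -
  have "x + y = (pw x + (E (h x) + pw y - E (h x))) + E (h x + h y)"
    by (subst (1) decomp[of x], subst (1) decomp[of y])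
      (simp only: E_add diff_conv_add_uminus add.assoc minus_add_cancel)
  then show ?thesis
    using h_decomp[OF W_subgroup(2)[OF pw_W W_conj[OF pw_W]] subspace_add[OF VV_subspace h_VV h_VV]] by metis
qed

lemma h_E: "X \<in> VV \<Longrightarrow> h (E X) = X"
  using h_decomp[OF W_subgroup(1)] by simp

lemma h_W: "w \<in> W \<Longrightarrow> h w = 0"
  using h_decomp[OF _ subspace_0[OF VV_subspace]] by simp

lemma h_0 [simp]: "h 0 = 0" using h_W W_subgroup(1) by blast

lemma h_uminus: "h (- x) = - h x"
  using h_add[of "- x" x] by (simp add: eq_neg_iff_add_eq_0)

lemma h_diff: "h (x - y) = h x - h y"
  using h_add[of x "- y"] by (simp add: h_uminus)

lemma pw_add_E: "X \<in> VV \<Longrightarrow> pw (x + E X) = pw x"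
proof -
  assume X: "X \<in> VV"
  have "x + E X = pw x + E (h x + X)" by (subst decomp[of x]) (simp only: E_add add.assoc)
  then show ?thesis using pw_decomp[OF pw_W subspace_add[OF VV_subspace h_VV X]] by metis
qed

lemma h_delta: "r > 0 \<Longrightarrow> h (\<delta> r x) = r *\<^sub>R h x"
  and pw_delta: "r > 0 \<Longrightarrow> pw (\<delta> r x) = \<delta> r (pw x)"
proof -
  assume r: "r > 0"
  have eq: "\<delta> r x = \<delta> r (pw x) + E (r *\<^sub>R h x)"
    by (subst decomp[of x]) (simp add: delta_add r E_delta)
  show "h (\<delta> r x) = r *\<^sub>R h x"
    using h_decomp[OF W_delta[OF r pw_W] subspace_scale[OF VV_subspace h_VV]] eq by metis
  show "pw (\<delta> r x) = \<delta> r (pw x)"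
    using pw_decomp[OF W_delta[OF r pw_W] subspace_scale[OF VV_subspace h_VV]] eq by metis
qed

lemma h_gpow: "h (gpow n x) = n *\<^sub>R h x"
  by (induction n) (auto simp: h_add scaleR_add_left)

section \<open>Continuity and smoothness of \<open>h\<close>\<close>

text \<open>Otherwise dilations yield a sequence \<open>y n\<close> tending to 0 with
  \<open>norm (h (y n)) = 1\<close>. For a limit point \<open>X\<close> of \<open>h (y n)\<close>,
  the elements \<open>pw (y n)\<close> tend along a subsequence to the inverse of
  \<open>E X\<close>, so \<open>E X\<close> lies in the closed set \<open>W\<close> as well as in
  \<open>V\<close>, although \<open>X\<close> has norm 1.\<close>

lemma h_bound: obtains C where "C > 0" "\<And>x. norm (h x) \<le> C * nrm x"
proof -
  have "\<exists>C>0. \<forall>x. norm (h x) \<le> C * nrm x"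
  proof (rule ccontr)
    assume "\<not> ?thesis"
    then have "\<exists>x. norm (h x) > real (Suc n) * nrm x" for n
      by (metis not_le of_nat_0_less_iff zero_less_Suc)
    then obtain x where x: "\<And>n. norm (h (x n)) > real (Suc n) * nrm (x n)" by metis
    have hp: "norm (h (x n)) > 0" for n using x[of n] nrm_nonneg[of "x n"]
      by (smt (verit) mult_nonneg_nonneg of_nat_0_le_iff)
    define y where "y n = \<delta> (1 / norm (h (x n))) (x n)" for n
    have hy: "norm (h (y n)) = 1" for n using hp[of n] by (simp add: y_def h_delta)
    have ny: "nrm (y n) \<le> 1 / real (Suc n)" for n
      using hp[of n] x[of n] by (simp add: y_def nrm_delta field_simps)
    have "(\<lambda>n. nrm (y n)) \<longlonglongrightarrow> 0"
      by (rule Lim_null_comparison[OF _ LIMSEQ_Suc[OF lim_const_over_n[of 1]]]) (use ny in auto)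
    then have y0: "y \<longlonglongrightarrow> 0" by (simp add: tendsto_iff_d)
    have "compact (VV \<inter> sphere 0 1)"
      by (intro closed_Int_compact closed_subspace VV_subspace compact_sphere)
    moreover have "\<forall>n. h (y n) \<in> VV \<inter> sphere 0 1" using hy h_VV by auto
    ultimately obtain X r where X: "X \<in> VV \<inter> sphere 0 1" "strict_mono (r :: nat \<Rightarrow> nat)" "((\<lambda>n. h (y n)) \<circ> r) \<longlonglongrightarrow> X"
      unfolding compact_def by metis
    have "(\<lambda>n. y (r n) - E (h (y (r n)))) \<longlonglongrightarrow> 0 - E X"
      using LIMSEQ_subseq_LIMSEQ[OF y0 X(2)] X(3) by (intro tendsto_group_diff tendsto_E) (auto simp: o_def)
    then have "0 - E X \<in> W" by (rule W_closed[rotated]) (use pw_W in \<open>simp add: pw_def[symmetric]\<close>)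
    then have "E X \<in> W" using W_subgroup(3) by fastforce
    then have "X = 0" using X(1) E_V W_Int_V E_eq_0 by blast
    then show False using X(1) by simp
  qed
  then show thesis using that by blast
qed

lemma tendsto_h: "(f \<longlongrightarrow> x) F \<Longrightarrow> ((\<lambda>z. h (f z)) \<longlongrightarrow> h x) F"
proof -
  assume "(f \<longlongrightarrow> x) F"
  then have lim: "((\<lambda>z. d x (f z)) \<longlongrightarrow> 0) F" by (simp add: tendsto_iff_d)
  obtain C where C: "C > 0" "\<And>x. norm (h x) \<le> C * nrm x" using h_bound by blast
  have "norm (h (f z) - h x) \<le> C * d x (f z)" for z
    using C(2)[of "- x + f z"] by (simp add: d_nrm[of x] h_add h_uminus)
  then have "((\<lambda>z. h (f z) - h x) \<longlongrightarrow> 0) F"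
    by (intro Lim_null_comparison[OF always_eventually tendsto_mult_right_zero[OF lim, of C]]) auto
  then show ?thesis by (rule LIM_zero_cancel)
qed

text \<open>A power of \<open>x\<close> at a fixed scale has bounded \<open>h\<close>, and
  \<open>h\<close> of an n-th power is n times \<open>h x\<close>.\<close>

lemma h_le_k:
  obtains r C where "r > 0" "C > 0" "\<And>x. x \<in> B r \<Longrightarrow> norm (h x) \<le> C * norm (k x)"
proof -
  obtain r where r: "r > 0"
    "\<And>\<rho> x. 0 < \<rho> \<Longrightarrow> \<rho> \<le> r \<Longrightarrow> x \<in> B (\<rho> / 8) \<Longrightarrow> x \<noteq> 0 \<Longrightarrow>
      \<exists>n\<ge>1. gpow n x \<in> B \<rho> \<and> norm (k (gpow n x)) \<ge> \<rho> / 8 \<and> \<rho> / 4 \<le> n * norm (k x) \<and> n * norm (k x) \<le> \<rho>"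
    using gpow_reach by blast
  obtain C where C: "C > 0" "\<And>x. norm (h x) \<le> C * nrm x" using h_bound by blast
  obtain \<rho>1 where \<rho>1: "\<rho>1 > 0" "B \<rho>1 \<subseteq> {y. d 0 y < 1}" using nbhd_contains_B[OF open_ball_d, of 0 1] by auto
  define \<rho> where "\<rho> = min r \<rho>1"
  have \<rho>: "\<rho> > 0" "\<rho> \<le> r" "\<rho> \<le> \<rho>1" using r \<rho>1 by (auto simp: \<rho>_def)
  show thesis
  proof
    show "\<rho> / 8 > 0" "4 * C / \<rho> > 0" using \<rho> C by auto
    fix x assume x: "x \<in> B (\<rho> / 8)"
    show "norm (h x) \<le> 4 * C / \<rho> * norm (k x)"
    proof (cases "x = 0")
      case False
      from r(2)[OF \<rho>(1,2) x False] obtain n :: nat where n: "n \<ge> 1" "gpow n x \<in> B \<rho>" "\<rho> / 4 \<le> n * norm (k x)" by blast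
      have "nrm (gpow n x) < 1" using n(2) \<rho>1(2) B_mono[OF \<rho>(3)] by blast
      then have "norm (h (gpow n x)) \<le> C * 1"
        using C(1) by (intro order_trans[OF C(2)] mult_left_mono) auto
      then have "n * norm (h x) \<le> C" by (simp add: h_gpow)
      also have "\<dots> = 4 * C / \<rho> * (\<rho> / 4)" using \<rho> by simp
      also have "\<dots> \<le> 4 * C / \<rho> * (n * norm (k x))" using n(3) C(1) \<rho>(1) by (intro mult_left_mono) auto
      finally have "n * norm (h x) \<le> n * (4 * C / \<rho> * norm (k x))" by (simp only: ac_simps)
      then show ?thesis by (rule mult_left_le_imp_le) (use n(1) in simp)
    qed simp
  qed
qed

text \<open>\<open>k'\<close> turns sums into products up to a factor whose coordinates are o(|Z|).
  As \<open>h_le_k\<close> controls \<open>h\<close> of that factor, the homomorphism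
  \<open>h\<close> is almost additive in coordinates.\<close>

lemma h_k'_differentiable: "\<exists>T. ((\<lambda>Y. h (k' Y)) has_derivative T) (at 0)"
proof -
  obtain r C where rC: "r > 0" "C > 0" "\<And>x. x \<in> B r \<Longrightarrow> norm (h x) \<le> C * norm (k x)" using h_le_k by blast
  obtain r2 where r2: "r2 > 0"
    "\<And>x y. x \<in> B r2 \<Longrightarrow> y \<in> B r2 \<Longrightarrow> x - y \<in> B r2 \<Longrightarrow> norm (k (x - y)) \<le> 2 * norm (k x - k y)"
    using k_diff_le by blast
  obtain rK where rK: "rK > 0" "ball 0 rK \<subseteq> K" using open_K zero_in_K open_contains_ball by blast
  have k'B: "k' Y \<in> B \<rho>" if "norm Y < \<rho>" "norm Y < rK" for Y \<rho>
  proof -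
    have "Y \<in> K" using that rK(2) by auto
    then show ?thesis using that by (simp add: B_def k'_in_U k_k')
  qed
  define r3 where "r3 = min r r2"
  have r3: "r3 > 0" "B r3 \<subseteq> B r" "B r3 \<subseteq> B r2" using rC r2 by (auto simp: r3_def intro!: B_mono)
  show ?thesis
  proof (rule almost_additive_differentiable)
    show "min r rK > 0" using rC rK by simp
    show "norm (h (k' Y)) \<le> C * norm Y" if "norm Y < min r rK" for Y
    proof -
      have "Y \<in> K" using that rK(2) by auto
      then show ?thesis using rC(3)[OF k'B[of Y r]] that by (simp add: k_k')
    qed
    fix \<eta> :: real assume "\<eta> > 0"
    define \<eta>' where "\<eta>' = \<eta> / (2 * C)"
    have \<eta>': "\<eta>' > 0" using \<open>\<eta> > 0\<close> rC(2) by (simp add: \<eta>'_def)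
    obtain r4 where r4: "r4 > 0"
      "\<And>x y x' y'. x \<in> B r4 \<Longrightarrow> y \<in> B r4 \<Longrightarrow> x' \<in> B r4 \<Longrightarrow> y' \<in> B r4 \<Longrightarrow>
        norm (k (x + y) - k (x' + y') - ((k x - k x') + (k y - k y'))) \<le> \<eta>' * (norm (k x - k x') + norm (k y - k y'))"
      by (rule mult_strictly_differentiable[OF \<eta>']) (erule that, assumption)
    define f where "f p = k' (fst p) + k' (snd p)" for p
    have id: "((\<lambda>p. p) \<longlongrightarrow> (0::'a, 0::'a)) (nhds (0, 0))" by (rule filterlim_ident)
    have lim: "((\<lambda>p. k' (fst p)) \<longlongrightarrow> k' 0) (nhds (0::'a, 0::'a))"
      "((\<lambda>p. k' (snd p)) \<longlongrightarrow> k' 0) (nhds (0::'a, 0::'a))"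
      "((\<lambda>p. k' (fst p + snd p)) \<longlongrightarrow> k' 0) (nhds (0::'a, 0::'a))"
      using isCont_tendsto_compose[OF isCont_k'[OF zero_in_K]] tendsto_fst[OF id] tendsto_snd[OF id]
        tendsto_add[OF tendsto_fst[OF id] tendsto_snd[OF id]] by simp_all
    have lf: "(f \<longlongrightarrow> 0) (nhds (0, 0))"
      using tendsto_group_add[OF lim(1,2)] by (simp add: f_def[abs_def])
    have lg: "((\<lambda>p. f p - k' (fst p + snd p)) \<longlongrightarrow> 0) (nhds (0, 0))"
      using tendsto_group_diff[OF lf lim(3)] by simp
    have "\<forall>\<^sub>F p in nhds (0, 0). f p \<in> B r3 \<and> k' (fst p + snd p) \<in> B r3 \<and> f p - k' (fst p + snd p) \<in> B r3"
      using eventually_in_B[OF lf r3(1)] eventually_in_B[OF lim(3)[simplified] r3(1)] eventually_in_B[OF lg r3(1)]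
      by eventually_elim simp
    then obtain t where t: "t > 0" "\<And>p. dist p (0, 0) < t \<Longrightarrow> f p \<in> B r3 \<and> k' (fst p + snd p) \<in> B r3 \<and> f p - k' (fst p + snd p) \<in> B r3"
      unfolding eventually_nhds_metric by blast
    define \<rho> where "\<rho> = min (t / 2) (min r4 (rK / 2))"
    have \<rho>: "\<rho> > 0" "\<rho> \<le> t / 2" "\<rho> \<le> r4" "\<rho> \<le> rK / 2" using t r4 rK by (auto simp: \<rho>_def)
    have "norm (h (k' (Y + Z)) - h (k' Y) - h (k' Z)) \<le> \<eta> * norm Z" if YZ: "norm Y < \<rho>" "norm Z < \<rho>" for Y Z
    proof -
      have "norm (Y, Z) \<le> norm Y + norm Z" by (rule norm_Pair_le)
      then have "dist (Y, Z) (0, 0) < t" using YZ \<rho>(2) by (simp add: dist_norm zero_prod_def[symmetric])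
      from t(2)[OF this] have in3: "k' Y + k' Z \<in> B r3" "k' (Y + Z) \<in> B r3" "k' Y + k' Z - k' (Y + Z) \<in> B r3"
        by (auto simp: f_def)
      have sum: "norm (Y + Z) < rK" using YZ \<rho>(4) norm_triangle_ineq[of Y Z] by linarith
      have K: "Y \<in> K" "Z \<in> K" "Y + Z \<in> K" using YZ \<rho> rK sum by auto
      have B4: "k' Y \<in> B r4" "k' Z \<in> B r4" using YZ \<rho> rK by (auto intro!: k'B)
      have "norm (k (k' Y + k' Z) - k (k' (Y + Z))) \<le> \<eta>' * norm Z"
        using r4(2)[OF B4 B4(1) zero_in_B[OF r4(1)]] K by (simp add: k_k' algebra_simps)
      then have "norm (k (k' Y + k' Z - k' (Y + Z))) \<le> 2 * (\<eta>' * norm Z)"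
        using r2(2)[of "k' Y + k' Z" "k' (Y + Z)"] in3 r3(3) by fastforce
      then have "norm (h (k' Y + k' Z - k' (Y + Z))) \<le> C * (2 * (\<eta>' * norm Z))"
        using rC(2) in3 r3(2) by (intro order_trans[OF rC(3) mult_left_mono]) auto
      also have "\<dots> = \<eta> * norm Z" using rC(2) by (simp add: \<eta>'_def)
      also have "norm (h (k' Y + k' Z - k' (Y + Z))) = norm (h (k' (Y + Z)) - h (k' Y) - h (k' Z))"
        by (simp add: h_diff h_add norm_minus_commute[of "h (k' (Y + Z))"] diff_diff_eq)
      finally show ?thesis .
    qed
    then show "\<exists>\<rho>>0. \<forall>Y Z. norm Y < \<rho> \<longrightarrow> norm Z < \<rho> \<longrightarrow> norm (h (k' (Y + Z)) - h (k' Y) - h (k' Z)) \<le> \<eta> * norm Z"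
      using \<rho>(1) by blast
  qed
qed

text \<open>Since \<open>h (i Y) = h (i X) + h (k' (p (X, Y)))\<close> for \<open>Y\<close> near
  \<open>X\<close>, differentiability at the identity suffices: the derivative at \<open>X\<close>
  is the fixed linear map \<open>T\<close> after a partial derivative of \<open>p\<close>, and this
  is smooth in \<open>X\<close>.\<close>

lemma smooth_at_h: "smooth_at \<A> EU h x"
proof -
  obtain T where T: "((\<lambda>Y. h (k' Y)) has_derivative T) (at 0)" using h_k'_differentiable by blast
  obtain U1 \<kappa> where c: "(U1, \<kappa>) \<in> \<A>" "x \<in> U1" using pre_atlasD(2)[OF is_pre_atlas] by blast
  note ch = pre_atlasD(1)[OF is_pre_atlas c(1)]
  have comp: "compatible (U1, \<kappa>) c'" if "c' \<in> \<A>" for c'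
    using is_smooth_atlas c that unfolding smooth_atlas_def by blast
  define i where "i = inv_into U1 \<kappa>"
  have i: "smooth_at EU \<A> i X" if "X \<in> \<kappa> ` U1" for X
    unfolding i_def by (rule smooth_at_inv_compatible_chart[OF is_pre_atlas ch comp that])
  have i_comp: "smooth_at EU \<A> (\<lambda>p. i (f p)) p" if "f p \<in> \<kappa> ` U1" "smooth_at EU EU f p" for f :: "'a \<times> 'a \<Rightarrow> 'a" and p
    by (rule smooth_at_comp[OF pre_atlas_euclidean pre_atlas_euclidean is_pre_atlas that(2) i[OF that(1)]])
  define p where "p z = k (- i (fst z) + i (snd z))" for z
  define X0 where "X0 = \<kappa> x"
  have X0: "X0 \<in> \<kappa> ` U1" using c by (simp add: X0_def)
  have "smooth_at EU EU p (X0, X0)"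
    unfolding p_def
    by (intro smooth_at_k smooth_at_mult smooth_at_uminus i_comp pre_atlas_euclidean smooth_at_EU_fst smooth_at_EU_snd)
      (auto simp: X0 e_chart)
  then obtain S where S: "open S" "(X0, X0) \<in> S" "smooth_on S p" unfolding smooth_at_euclidean_iff by blast
  define R where "R = \<kappa> ` U1 \<inter> (\<lambda>X. (X, X)) -` S"
  have oR: "open R"
    unfolding R_def by (rule continuous_open_preimage[OF _ is_chartD(2)[OF ch] S(1)]) (intro continuous_intros)
  have X0R: "X0 \<in> R" using X0 S by (simp add: R_def)
  have der: "((\<lambda>X. h (i X)) has_derivative (\<lambda>v. T (fd p (X, X) (0, v)))) (at X)" if X: "X \<in> R" for X
  proof -
    have XU: "X \<in> \<kappa> ` U1" and XS: "(X, X) \<in> S" using X by (auto simp: R_def)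
    have "p differentiable (at (X, X))" using smooth_on_Ck[OF S(3), of 1] XS by auto
    then have "((\<lambda>Y. p (X, Y)) has_derivative (\<lambda>v. fd p (X, X) (0, v))) (at X)"
      by (intro has_derivative_compose[where f = "\<lambda>Y. (X, Y)" and g = p] fd_works has_derivative_Pair
          has_derivative_const has_derivative_ident)
    moreover have "p (X, X) = 0" by (simp add: p_def)
    ultimately have "((\<lambda>Y. h (k' (p (X, Y)))) has_derivative (\<lambda>v. T (fd p (X, X) (0, v)))) (at X)"
      using T by (intro has_derivative_compose[where f = "\<lambda>Y. p (X, Y)" and g = "\<lambda>Y. h (k' Y)"]) auto
    then have d1: "((\<lambda>Y. h (i X) + h (k' (p (X, Y)))) has_derivative (\<lambda>v. T (fd p (X, X) (0, v)))) (at X)"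
      by (rule has_derivative_add_const[of _ _ _ "h (i X)", unfolded add.commute[of _ "h (i X)"]])
    have "((\<lambda>Y. - i X + i Y) \<longlongrightarrow> - i X + i X) (nhds X)"
      using smooth_at_isCont[OF i[OF XU]]
      by (intro tendsto_group_add tendsto_const) (simp add: isCont_def tendsto_nhds_iff)
    then have "\<forall>\<^sub>F Y in nhds X. - i X + i Y \<in> U"
      using topological_tendstoD[OF _ open_U] e_chart(3) by fastforce
    then obtain Q where Q: "open Q" "X \<in> Q" "\<And>Y. Y \<in> Q \<Longrightarrow> - i X + i Y \<in> U" unfolding eventually_nhds by blast
    have eqQ: "h (i X) + h (k' (p (X, Y))) = h (i Y)" if "Y \<in> Q" for Y
      using k'_k[OF Q(3)[OF that]] by (simp add: p_def h_add h_uminus)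
    show ?thesis by (rule has_derivative_transform_within_open[OF d1 Q(1,2) eqQ])
  qed
  have "Ck_on (Suc n) R (\<lambda>X. h (i X))" for n
  proof -
    have "Ck_on n R (\<lambda>X. T (fd p (X, X) (0, v)))" for v
    proof (rule Ck_on_linear_comp[OF has_derivative_bounded_linear[OF T] oR])
      have "Ck_on n S (\<lambda>z. fd p z (0, v))" using smooth_on_Ck[OF S(3), of "Suc n"] by simp
      then show "Ck_on n R (\<lambda>X. fd p (X, X) (0, v))"
        using Ck_on_comp[OF oR S(1) _ Ck_on_Pair[OF oR Ck_on_bounded_linear[OF bounded_linear_ident]
              Ck_on_bounded_linear[OF bounded_linear_ident]], of n "\<lambda>z. fd p z (0, v)"]
        by (auto simp: R_def)
    qed
    then have "Ck_on n R (\<lambda>X. fd (\<lambda>X. h (i X)) X v)" for v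
      by (rule Ck_on_cong[OF oR, rotated]) (simp add: fd_eqI[OF der])
    then show ?thesis using der by (auto simp: differentiable_def)
  qed
  then have "smooth_on R (\<lambda>X. h (i X))" unfolding smooth_on_def using Ck_on_SucD by blast
  then have "smooth_at EU EU (\<lambda>X. h (i X)) (\<kappa> x)"
    using smooth_at_euclideanI oR X0R unfolding X0_def by blast
  from smooth_at_comp[OF is_pre_atlas pre_atlas_euclidean pre_atlas_euclidean smooth_at_compatible_chart[OF is_pre_atlas ch comp c(2)] this]
  have "smooth_at \<A> EU (\<lambda>x. h (i (\<kappa> x))) x" .
  then show ?thesis
    by (rule smooth_at_cong[OF is_pre_atlas pre_atlas_euclidean _ is_chartD(1)[OF ch] c(2)])
      (simp add: i_def is_chartD(6)[OF ch])
qed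

section \<open>A smooth gauge\<close>

text \<open>The value at \<open>x + y\<close> is a smooth function of the coordinates of both
  \<open>x\<close> and \<open>y\<close>, whence a bound uniform in the base point near
  \<open>x0\<close>.\<close>

lemma smooth_locally_lipschitz:
  fixes b :: "'g \<Rightarrow> real"
  assumes b: "\<And>x. smooth_at \<A> EU b x"
  shows "\<exists>S r L. open S \<and> x0 \<in> S \<and> r > 0 \<and> L > 0 \<and> (\<forall>x\<in>S. \<forall>y\<in>B r. \<bar>b (x + y) - b x\<bar> \<le> L * norm (k y))"
proof -
  obtain U1 \<kappa> where c: "(U1, \<kappa>) \<in> \<A>" "x0 \<in> U1" using pre_atlasD(2)[OF is_pre_atlas] by blast
  note ch = pre_atlasD(1)[OF is_pre_atlas c(1)]
  have comp: "compatible (U1, \<kappa>) c'" if "c' \<in> \<A>" for c'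
    using is_smooth_atlas c that unfolding smooth_atlas_def by blast
  define i where "i = inv_into U1 \<kappa>"
  have i: "smooth_at EU \<A> i X" if "X \<in> \<kappa> ` U1" for X
    unfolding i_def by (rule smooth_at_inv_compatible_chart[OF is_pre_atlas ch comp that])
  have i_comp: "smooth_at EU \<A> (\<lambda>p. i (f p)) p" if "f p \<in> \<kappa> ` U1" "smooth_at EU EU f p" for f :: "'a \<times> 'a \<Rightarrow> 'a" and p
    by (rule smooth_at_comp[OF pre_atlas_euclidean pre_atlas_euclidean is_pre_atlas that(2) i[OF that(1)]])
  define F where "F p = b (i (fst p) + k' (snd p))" for p
  have "smooth_at EU \<A> (\<lambda>p. i (fst p) + k' (snd p)) (\<kappa> x0, 0)"
    by (intro smooth_at_mult i_comp smooth_at_k' pre_atlas_euclidean smooth_at_EU_fst smooth_at_EU_snd)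
      (auto simp: c zero_in_K)
  from smooth_at_comp[OF pre_atlas_euclidean is_pre_atlas pre_atlas_euclidean this b]
  have "smooth_at EU EU F (\<kappa> x0, 0)" unfolding F_def .
  then obtain S where S: "open S" "(\<kappa> x0, 0) \<in> S" "smooth_on S F" unfolding smooth_at_euclidean_iff by blast
  obtain r L where r: "r > 0" "L > 0"
    "\<And>p q. p \<in> ball (\<kappa> x0, 0) r \<Longrightarrow> q \<in> ball (\<kappa> x0, 0) r \<Longrightarrow> norm (F p - F q) \<le> L * norm (p - q)"
    using Ck_on_locally_lipschitz[OF smooth_on_Ck[OF S(3)] S(1,2)] by blast
  define Q where "Q = U1 \<inter> \<kappa> -` ball (\<kappa> x0) (r / 2)"
  have "open Q" unfolding Q_def
    by (rule continuous_open_preimage[OF is_chartD(3,1)[OF ch]]) simp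
  moreover have "x0 \<in> Q" using c r by (simp add: Q_def)
  moreover have "\<bar>b (x + y) - b x\<bar> \<le> L * norm (k y)" if x: "x \<in> Q" and y: "y \<in> B (r / 2)" for x y
  proof -
    have ix: "i (\<kappa> x) = x" using x is_chartD(6)[OF ch] by (simp add: Q_def i_def)
    have ball: "(\<kappa> x, Z) \<in> ball (\<kappa> x0, 0) r" if "norm Z < r / 2" for Z
    proof -
      have "dist (\<kappa> x0, 0) (\<kappa> x, Z) \<le> dist (\<kappa> x0) (\<kappa> x) + norm Z"
        unfolding dist_prod_def by (simp add: sqrt_sum_squares_le_sum)
      also have "\<dots> < r" using x that by (auto simp: Q_def)
      finally show ?thesis by simp
    qed
    have "norm (F (\<kappa> x, k y) - F (\<kappa> x, 0)) \<le> L * norm ((\<kappa> x, k y) - (\<kappa> x, 0))"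
      using y r(1) by (intro r(3) ball) (auto simp: B_def)
    then show ?thesis using y by (simp add: F_def ix k'_k B_D norm_prod_def)
  qed
  ultimately show ?thesis using r(1,2) by (intro exI[of _ Q] exI[of _ "r / 2"] exI[of _ L]) auto
qed

text \<open>For a violating sequence, boundedness of \<open>b\<close> forces \<open>y n\<close> to
  0, and one of the points \<open>x n\<close>, \<open>x n + y n\<close> lies in the ball of radius
  \<open>R\<close>, so the \<open>x n\<close> accumulate at some \<open>x0\<close>. There the local
  bound, with coordinates estimated by the distance, contradicts the growing factor.\<close>

lemma compact_support_lipschitz:
  fixes b :: "'g \<Rightarrow> real"
  assumes b: "\<And>x. smooth_at \<A> EU b x" and supp: "\<And>x. nrm x > R \<Longrightarrow> b x = 0"
  obtains C where "C > 0" "\<And>x y. \<bar>b (x + y) - b x\<bar> \<le> C * nrm y"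
proof -
  have contb: "continuous_on S b" for S
    using smooth_at_isCont[OF b] by (simp add: continuous_at_imp_continuous_on)
  have "bounded (b ` {x. nrm x \<le> R})"
    by (intro compact_imp_bounded compact_continuous_image contb compact_nrm_ball)
  then obtain M where M: "\<And>x. nrm x \<le> R \<Longrightarrow> \<bar>b x\<bar> \<le> M" unfolding bounded_iff by auto
  have bM: "\<bar>b x\<bar> \<le> \<bar>M\<bar>" for x using M[of x] supp[of x] by (cases "nrm x \<le> R") auto
  have "\<exists>C>0. \<forall>x y. \<bar>b (x + y) - b x\<bar> \<le> C * nrm y"
  proof (rule ccontr)
    assume "\<not> ?thesis"
    then have "\<exists>x y. \<bar>b (x + y) - b x\<bar> > real (Suc n) * nrm y" for n
      by (metis not_le of_nat_0_less_iff zero_less_Suc)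
    then obtain x y where xy: "\<And>n. \<bar>b (x n + y n) - b (x n)\<bar> > real (Suc n) * nrm (y n)" by metis
    have ny: "nrm (y n) \<le> 2 * \<bar>M\<bar> / real (Suc n)" for n
    proof -
      have "\<bar>b (x n + y n) - b (x n)\<bar> \<le> 2 * \<bar>M\<bar>" using bM[of "x n + y n"] bM[of "x n"] by linarith
      then have "real (Suc n) * nrm (y n) \<le> 2 * \<bar>M\<bar>" using xy[of n] by linarith
      then show ?thesis by (simp add: field_simps)
    qed
    have "(\<lambda>n. nrm (y n)) \<longlonglongrightarrow> 0"
      by (rule Lim_null_comparison[OF _ LIMSEQ_Suc[OF lim_const_over_n[of "2 * \<bar>M\<bar>"]]]) (use ny in auto)
    then have y0: "y \<longlonglongrightarrow> 0" by (simp add: tendsto_iff_d)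
    have "nrm (x n) \<le> R + 2 * \<bar>M\<bar>" for n
    proof -
      have "2 * \<bar>M\<bar> / real (Suc n) \<le> 2 * \<bar>M\<bar> / 1" by (intro divide_left_mono) auto
      then have "nrm (y n) \<le> 2 * \<bar>M\<bar>" using ny[of n] by simp
      moreover have "0 \<le> real (Suc n) * nrm (y n)" by simp
      then have "\<bar>b (x n + y n) - b (x n)\<bar> > 0" using xy[of n] by linarith
      then have "b (x n + y n) \<noteq> 0 \<or> b (x n) \<noteq> 0" by auto
      then have "nrm (x n + y n) \<le> R \<or> nrm (x n) \<le> R" using supp by (meson not_le)
      moreover have "nrm (x n) \<le> nrm (x n + y n) + nrm (y n)" using nrm_add[of "x n + y n" "- y n"] by (simp add: add.assoc)
      ultimately show ?thesis by auto
    qed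
    then obtain x0 r where r: "strict_mono (r :: nat \<Rightarrow> nat)" "(\<lambda>n. x (r n)) \<longlonglongrightarrow> x0"
      using bounded_subseq by blast
    obtain S r1 L where S: "open S" "x0 \<in> S" "r1 > 0" "L > 0"
      "\<And>x y. x \<in> S \<Longrightarrow> y \<in> B r1 \<Longrightarrow> \<bar>b (x + y) - b x\<bar> \<le> L * norm (k y)"
      using smooth_locally_lipschitz[OF b] by metis
    obtain r2 C where r2: "r2 > 0" "C > 0" "\<And>x. x \<in> B r2 \<Longrightarrow> norm (k x) \<le> C * nrm x" using norm_k_le_nrm by blast
    have yr: "(\<lambda>n. y (r n)) \<longlonglongrightarrow> 0" using LIMSEQ_subseq_LIMSEQ[OF y0 r(1)] by (simp add: o_def)
    have "\<forall>\<^sub>F n in sequentially. real (Suc (r n)) \<le> L * C"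
      using topological_tendstoD[OF r(2) S(1,2)] eventually_in_B[OF yr S(3)] eventually_in_B[OF yr r2(1)]
    proof eventually_elim
      case (elim n)
      have "\<bar>b (x (r n) + y (r n)) - b (x (r n))\<bar> \<le> L * (C * nrm (y (r n)))"
        using S(4) elim by (intro order_trans[OF S(5) mult_left_mono] r2(3)) auto
      then have lt: "real (Suc (r n)) * nrm (y (r n)) < (L * C) * nrm (y (r n))"
        using xy[of "r n"] by (simp add: mult.assoc)
      then show ?case using mult_right_less_imp_less[OF lt] by simp
    qed
    then obtain N where N: "\<And>n. n \<ge> N \<Longrightarrow> real (Suc (r n)) \<le> L * C" unfolding eventually_sequentially by blast
    obtain m :: nat where m: "L * C < m" using reals_Archimedean2 by blast
    have "real (Suc (r (max N m))) \<le> L * C" by (rule N) simp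
    moreover have "max N m \<le> r (max N m)" using seq_suble[OF r(1)] .
    ultimately show False using m by linarith
  qed
  then show thesis using that by blast
qed

text \<open>A radial cutoff in coordinates, extended by 0 outside the chart. The extension is smooth
  because the coordinate ball that carries it is compact, hence closed in the whole group.\<close>

lemma bump_exists:
  assumes "\<rho> > 0"
  obtains \<beta> r where "r > 0" "\<And>x. smooth_at \<A> (EU :: (real, real) chart set) \<beta> x" "\<And>x. 0 \<le> \<beta> x" "\<And>x. \<beta> x \<le> 1"
    "\<And>x. nrm x < r \<Longrightarrow> \<beta> x = 1" "\<And>x. nrm x \<ge> \<rho> \<Longrightarrow> \<beta> x = 0"
proof -
  obtain r1 where r1: "r1 > 0" "B r1 \<subseteq> {y. d 0 y < \<rho>}" using nbhd_contains_B[OF open_ball_d, of 0 \<rho>] assms by auto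
  obtain r2 where r2: "r2 > 0" "ball 0 r2 \<subseteq> K" using open_K zero_in_K open_contains_ball by blast
  define \<sigma> where "\<sigma> = min r1 r2 / 2"
  have \<sigma>: "\<sigma> > 0" "2 * \<sigma> \<le> r1" "2 * \<sigma> \<le> r2" using r1 r2 by (auto simp: \<sigma>_def)
  define q where "q x = step ((k x \<bullet> k x) / \<sigma>\<^sup>2 - 1)" for x
  define \<beta> where "\<beta> x = (if x \<in> U then q x else 0)" for x
  have q1: "q x = 1" if "norm (k x) \<le> \<sigma>" for x
    unfolding q_def using that \<sigma>(1) by (intro step_eq_1) (simp add: dot_square_norm power_mono)
  \<comment> \<open>\<open>step\<close> vanishes once its argument reaches 1, that is, from norm
    sqrt 2 times \<sigma> on; 3/2 is a convenient upper bound for sqrt 2.\<close>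
  have q0: "q x = 0" if "norm (k x) \<ge> 3 / 2 * \<sigma>" for x
  proof -
    have "(3 / 2 * \<sigma>)\<^sup>2 \<le> (norm (k x))\<^sup>2" using that \<sigma>(1) by (intro power_mono) auto
    then have "9 / 4 * \<sigma>\<^sup>2 \<le> k x \<bullet> k x" by (simp add: dot_square_norm power_mult_distrib power_divide)
    then have "2 * \<sigma>\<^sup>2 \<le> k x \<bullet> k x" using zero_le_power2[of \<sigma>] by linarith
    then show ?thesis unfolding q_def using \<sigma>(1) by (intro step_eq_0) (simp add: field_simps)
  qed
  have sub: "cball 0 (3 / 2 * \<sigma>) \<subseteq> K"
  proof -
    have "cball (0::'a) (3 / 2 * \<sigma>) \<subseteq> ball 0 r2" using \<sigma> by auto
    then show ?thesis using r2(2) by blast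
  qed
  have "compact (k' ` cball 0 (3 / 2 * \<sigma>))"
    using sub isCont_k' by (intro compact_continuous_image) (auto intro!: continuous_at_imp_continuous_on)
  then have cl: "closed (k' ` cball 0 (3 / 2 * \<sigma>))" by (rule compact_imp_closed)
  have smq: "smooth_at \<A> (EU :: (real, real) chart set) q x" if "x \<in> U" for x
  proof -
    have kx: "smooth_at \<A> EU k x" by (rule smooth_at_k[OF is_pre_atlas smooth_at_G_ident that])
    have "smooth_at \<A> EU (\<lambda>x. (k x \<bullet> k x) / \<sigma>\<^sup>2 - 1) x"
      by (intro smooth_at_diff_euclidean is_pre_atlas smooth_at_const
          smooth_at_linear[OF is_pre_atlas smooth_at_bilinear_euclidean[OF is_pre_atlas kx kx bounded_bilinear_inner] bounded_linear_divide])
    then show ?thesis unfolding q_def[abs_def]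
      by (rule smooth_at_euclidean_comp[OF is_pre_atlas _ smooth_on_step open_UNIV]) simp
  qed
  have sm: "smooth_at \<A> (EU :: (real, real) chart set) \<beta> x" for x
  proof (cases "x \<in> U")
    case True
    show ?thesis
      by (rule smooth_at_cong[OF is_pre_atlas pre_atlas_euclidean smq[OF True] open_U True]) (simp add: \<beta>_def)
  next
    case False
    have "x \<notin> k' ` cball 0 (3 / 2 * \<sigma>)" using False sub k'_in_U by blast
    moreover have "0 = \<beta> z" if "z \<in> - k' ` cball 0 (3 / 2 * \<sigma>)" for z
    proof (cases "z \<in> U")
      case True
      have "k z \<notin> cball 0 (3 / 2 * \<sigma>)" using that k'_k[OF True] by (metis ComplD imageI)
      then show ?thesis using q0[of z] by (simp add: \<beta>_def)
    qed (simp add: \<beta>_def)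
    ultimately show ?thesis
      using cl by (intro smooth_at_cong[OF is_pre_atlas pre_atlas_euclidean smooth_at_const[where c = 0], of "- k' ` cball 0 (3 / 2 * \<sigma>)"]) auto
  qed
  obtain r where r: "r > 0" "\<And>y. nrm y < r \<Longrightarrow> y \<in> B \<sigma>"
    using nrm_ball_subset[OF open_B zero_in_B[OF \<sigma>(1)]] by blast
  show thesis
  proof (rule that[OF r(1) sm])
    show "0 \<le> \<beta> x" "\<beta> x \<le> 1" for x using step_bounds by (auto simp: \<beta>_def q_def)
    show "\<beta> x = 1" if "nrm x < r" for x
      using r(2)[OF that] q1[of x] by (auto simp: \<beta>_def B_def)
    show "\<beta> x = 0" if "nrm x \<ge> \<rho>" for x
    proof (cases "x \<in> U")
      case True
      have "x \<notin> B r1" using r1(2) that by auto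
      then have "norm (k x) \<ge> 3 / 2 * \<sigma>" using True \<sigma> by (auto simp: B_def)
      then show ?thesis using q0 by (simp add: \<beta>_def)
    qed (simp add: \<beta>_def)
  qed
qed

lemma smooth_at_pw: "smooth_at \<A> \<A> pw x"
proof -
  have "smooth_at \<A> \<A> (\<lambda>z. z + - E (h z)) x"
    by (intro smooth_at_mult smooth_at_uminus smooth_at_E smooth_at_G_ident smooth_at_h is_pre_atlas)
  then show ?thesis unfolding pw_def[abs_def] by simp
qed

text \<open>A smooth substitute for \<open>max (\<epsilon> \<parallel>x\<^sub>V\<parallel>) (2 l \<parallel>x\<^sub>W\<parallel>)\<close>, valid up to additive constants: a sum of dyadic
  dilates of \<open>1 - b\<close>, where \<open>b\<close> is a cutoff that varies slowly in the direction of \<open>V\<close>.\<close>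

lemma gauge_exists:
  assumes "l > 0" "\<epsilon> > 0"
  obtains N :: "'g \<Rightarrow> real" and C c where "C > 0" "c > 0" "\<And>z. smooth_at \<A> EU N z" "N 0 = 0"
    "\<And>z X. X \<in> VV \<Longrightarrow> \<bar>N (z + E X) - N z\<bar> \<le> \<epsilon> * norm X"
    "\<And>z y. \<bar>N (z + y) - N z\<bar> \<le> C * nrm y"
    "\<And>z. norm (h z) \<le> l * nrm (pw z) \<Longrightarrow> N z \<ge> 2 * norm (h z) - 1"
    "\<And>z. N z \<ge> c * nrm z - 1"
proof -
  obtain c0 CE where CE: "CE > 0" "\<And>X. nrm (E X) \<le> CE * norm X" using E_bounds by metis
  obtain Ch where Ch: "Ch > 0" "\<And>x. norm (h x) \<le> Ch * nrm x" using h_bound by blast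
  \<comment> \<open>With this radius \<open>nrm (pw z) / \<rho> - 1\<close>, the lower bound
    obtained for \<open>N z\<close>, equals \<open>2 * l * nrm (pw z) - 1\<close>.\<close>
  define \<rho> where "\<rho> = 1 / (2 * l)"
  have \<rho>: "\<rho> > 0" using assms(1) by (simp add: \<rho>_def)
  obtain \<beta> rb where \<beta>: "rb > 0" "\<And>x. smooth_at \<A> (EU :: (real, real) chart set) \<beta> x" "\<And>x. 0 \<le> \<beta> x" "\<And>x. \<beta> x \<le> 1"
    "\<And>x. nrm x < rb \<Longrightarrow> \<beta> x = 1" "\<And>x. nrm x \<ge> \<rho> \<Longrightarrow> \<beta> x = 0" using bump_exists[OF \<rho>] by metis
  define s2 where "s2 X = step (X \<bullet> X - 1)" for X :: 'a
  have s2: "0 \<le> s2 X" "s2 X \<le> 1" for X using step_bounds by (auto simp: s2_def)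
  have s2_1: "s2 X = 1" if "norm X \<le> 1" for X
    unfolding s2_def using that power_mono[OF that, of 2] by (intro step_eq_1) (simp add: dot_square_norm)
  have s2_0: "s2 X = 0" if "norm X \<ge> 2" for X
    unfolding s2_def using power_mono[OF that, of 2] by (intro step_eq_0) (simp add: dot_square_norm)
  \<comment> \<open>The cutoff has fixed size \<rho> in the direction of \<open>W\<close> and is
    stretched by \<open>R\<close> in the direction of \<open>V\<close>; a large \<open>R\<close>
    makes it flat along \<open>V\<close>.\<close>
  define bR where "bR R z = \<beta> (pw z) * s2 ((1 / R) *\<^sub>R h z)" for R z
  have bR01: "0 \<le> bR R z" "bR R z \<le> 1" for R z
    using \<beta>(3,4)[of "pw z"] s2[of "(1 / R) *\<^sub>R h z"] by (auto simp: bR_def mult_le_one)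
  have bR_smooth: "smooth_at \<A> (EU :: (real, real) chart set) (bR R) z" for R z
  proof -
    have 1: "smooth_at \<A> (EU :: (real, real) chart set) (\<lambda>z. \<beta> (pw z)) z"
      by (rule smooth_at_comp[OF is_pre_atlas is_pre_atlas pre_atlas_euclidean smooth_at_pw \<beta>(2)])
    have hR: "smooth_at \<A> EU (\<lambda>z. (1 / R) *\<^sub>R h z) z"
      by (rule smooth_at_linear[OF is_pre_atlas smooth_at_h bounded_linear_scaleR_right])
    have 2: "smooth_at \<A> (EU :: (real, real) chart set) (\<lambda>z. ((1 / R) *\<^sub>R h z) \<bullet> ((1 / R) *\<^sub>R h z) - 1) z"
      by (rule smooth_at_diff_euclidean[OF is_pre_atlas smooth_at_bilinear_euclidean[OF is_pre_atlas hR hR bounded_bilinear_inner] smooth_at_const])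
    have 3: "smooth_at \<A> (EU :: (real, real) chart set) (\<lambda>z. s2 ((1 / R) *\<^sub>R h z)) z"
      unfolding s2_def by (rule smooth_at_euclidean_comp[OF is_pre_atlas 2 smooth_on_step open_UNIV UNIV_I])
    show ?thesis unfolding bR_def by (rule smooth_at_bilinear_euclidean[OF is_pre_atlas 1 3 bounded_bilinear_mult])
  qed
  have bR_supp: "bR R z = 0" if "R > 0" "nrm z > \<rho> + 2 * R * CE" for R z
  proof (rule ccontr)
    assume "bR R z \<noteq> 0"
    then have "\<beta> (pw z) \<noteq> 0" "s2 ((1 / R) *\<^sub>R h z) \<noteq> 0" by (auto simp: bR_def)
    then have 1: "nrm (pw z) < \<rho>" and "norm ((1 / R) *\<^sub>R h z) < 2" using \<beta>(6) s2_0 by (meson not_le)+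
    then have 2: "norm (h z) < 2 * R" using that(1) by (simp add: field_simps)
    have "nrm z \<le> nrm (pw z) + nrm (E (h z))" using nrm_add[of "pw z" "E (h z)"] decomp[of z] by simp
    also have "\<dots> \<le> nrm (pw z) + CE * norm (h z)" using CE(2) by simp
    also have "\<dots> \<le> \<rho> + CE * (2 * R)" using 1 2 CE(1) by (intro add_mono mult_left_mono) auto
    finally show False using that(2) by (simp add: ac_simps)
  qed
  have bR_lip: "\<exists>C>0. \<forall>x y. \<bar>bR R (x + y) - bR R x\<bar> \<le> C * nrm y" if "R > 0" for R
    using compact_support_lipschitz[of "bR R" "\<rho> + 2 * R * CE"] bR_smooth bR_supp[OF that] by metis
  obtain C1 where C1: "C1 > 0" "\<And>x y. \<bar>bR 1 (x + y) - bR 1 x\<bar> \<le> C1 * nrm y" using bR_lip[of 1] by auto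
  define Cs where "Cs = C1 * CE"
  have Cs: "Cs > 0" using C1 CE by (simp add: Cs_def)
  \<comment> \<open>On \<open>V\<close> the function \<open>bR 1\<close> is \<open>s2\<close>, so
    the Lipschitz bound for functions of bounded support applies.\<close>
  have s2_lip: "\<bar>s2 Y - s2 X\<bar> \<le> Cs * norm (Y - X)" if "X \<in> VV" "Y \<in> VV" for X Y
  proof -
    have b1: "bR 1 (E Z) = s2 Z" if "Z \<in> VV" for Z
      using pw_decomp[OF W_subgroup(1) that] h_E[OF that] \<beta>(5)[of 0] \<beta>(1) by (simp add: bR_def)
    have "\<bar>bR 1 (E X + E (Y - X)) - bR 1 (E X)\<bar> \<le> C1 * nrm (E (Y - X))" by (rule C1)
    also have "\<dots> \<le> C1 * (CE * norm (Y - X))" using C1(1) CE(2) by (intro mult_left_mono) auto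
    finally show ?thesis using b1 that unfolding E_add[symmetric] by (simp add: Cs_def mult.assoc)
  qed
  \<comment> \<open>\<open>(3 * Cs + 4) / R\<close> is the constant that
    \<open>dyadic_difference_sum\<close> yields along \<open>V\<close>, with \<open>m = 1\<close>,
    \<open>r0 = R\<close> and slope \<open>Cs / R\<close>.\<close>
  define R where "R = max 1 ((3 * Cs + 4) / \<epsilon>)"
  have R: "R \<ge> 1" "(3 * Cs + 4) / R \<le> \<epsilon>"
  proof -
    show "R \<ge> 1" by (simp add: R_def)
    have "(3 * Cs + 4) / \<epsilon> \<le> R" by (simp add: R_def)
    then show "(3 * Cs + 4) / R \<le> \<epsilon>" using assms(2) \<open>R \<ge> 1\<close> by (simp add: field_simps)
  qed
  obtain CR where CR: "CR > 0" "\<And>x y. \<bar>bR R (x + y) - bR R x\<bar> \<le> CR * nrm y" using bR_lip[of R] R by auto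
  define R0 where "R0 = \<rho> + 2 * R * CE"
  have R0: "R0 > 0" using \<rho> R(1) CE(1) by (simp add: R0_def add_pos_pos)
  define b where "b = bR R"
  have b01: "0 \<le> b z" "b z \<le> 1" for z using bR01 by (auto simp: b_def)
  have b0: "b z = 0" if "nrm z > R0" for z using bR_supp[of R z] R(1) that by (simp add: b_def R0_def)
  \<comment> \<open>Below radius \<open>r1\<close> the cutoff is 1: the first bound serves
    \<open>pw z\<close>, the second \<open>h z\<close>. Hence all but finitely many terms of the
    series for \<open>N\<close> vanish.\<close>
  define r1 where "r1 = min (rb / (1 + CE * Ch)) (1 / Ch)"
  have den: "1 + CE * Ch > 0" using CE(1) Ch(1) by (simp add: add_pos_pos)
  have r1: "r1 > 0" using \<beta>(1) den Ch(1) by (simp add: r1_def)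
  have b1: "b z = 1" if "nrm z < r1" for z
  proof -
    have "norm (h z) \<le> Ch * nrm z" by (rule Ch)
    also have "\<dots> \<le> Ch * (1 / Ch)" using that Ch(1) by (intro mult_left_mono) (auto simp: r1_def)
    finally have h1: "norm (h z) \<le> 1" using Ch(1) by simp
    have "norm ((1 / R) *\<^sub>R h z) = norm (h z) / R" using R(1) by simp
    also have "\<dots> \<le> 1" using h1 R(1) by (simp add: divide_le_eq)
    finally have "s2 ((1 / R) *\<^sub>R h z) = 1" by (rule s2_1)
    have "nrm (pw z) \<le> nrm z + nrm (E (h z))"
      using nrm_add[of z "- E (h z)"] by (simp add: pw_def)
    also have "\<dots> \<le> nrm z + CE * (Ch * nrm z)"
      using CE(1) order_trans[OF CE(2) mult_left_mono[OF Ch(2)]] by (intro add_left_mono) auto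
    also have "\<dots> = (1 + CE * Ch) * nrm z" by (simp add: algebra_simps)
    also have "\<dots> < (1 + CE * Ch) * (rb / (1 + CE * Ch))"
      using that den by (intro mult_strict_left_mono) (auto simp: r1_def)
    also have "\<dots> = rb" using den by simp
    finally have "\<beta> (pw z) = 1" by (rule \<beta>)
    then show ?thesis using \<open>s2 _ = 1\<close> by (simp add: b_def bR_def)
  qed
  define \<delta>j where "\<delta>j j z = \<delta> (1 / 2 ^ j) z" for j :: nat and z
  have n\<delta>: "nrm (\<delta>j j z) = nrm z / 2 ^ j" for j z by (simp add: \<delta>j_def nrm_delta)
  \<comment> \<open>The term of index \<open>j\<close> varies at distances of order
    \<open>2 ^ j\<close>. The factor \<open>2 ^ j\<close> produces linear growth and gives all terms
    the same Lipschitz constant.\<close>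
  define N where "N z = (\<Sum>j. 2 ^ j * (1 - b (\<delta>j j z)))" for z
  have N_eq: "N z = (\<Sum>j<n. 2 ^ j * (1 - b (\<delta>j j z)))" if "nrm z < r1 * 2 ^ n" for n z
    unfolding N_def
  proof (rule suminf_finite)
    fix j assume "j \<notin> {..<n}"
    then have "(2::real) ^ n \<le> 2 ^ j" by (intro power_increasing) auto
    then have "r1 * 2 ^ n \<le> r1 * 2 ^ j" using r1 by simp
    then have "nrm (\<delta>j j z) < r1" using that by (simp add: n\<delta> field_simps)
    then show "2 ^ j * (1 - b (\<delta>j j z)) = 0" using b1 by simp
  qed simp
  have big: "\<exists>n::nat. x < r1 * 2 ^ n \<and> y < r1 * 2 ^ n \<and> t < 2 ^ n" for x y t :: real
  proof -
    obtain n where n: "max (max (x / r1) (y / r1)) t < 2 ^ n"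
      using real_arch_pow[of 2 "max (max (x / r1) (y / r1)) t"] by auto
    then show ?thesis using r1 by (intro exI[of _ n]) (auto simp: field_simps)
  qed
  have N_diff: "\<bar>N z' - N z\<bar> \<le> (\<Sum>j<n. 2 ^ j * \<bar>b (\<delta>j j z') - b (\<delta>j j z)\<bar>)"
    if "nrm z < r1 * 2 ^ n" "nrm z' < r1 * 2 ^ n" for z z' n
  proof -
    have "N z' - N z = (\<Sum>j<n. 2 ^ j * (b (\<delta>j j z) - b (\<delta>j j z')))"
      using N_eq[OF that(1)] N_eq[OF that(2)] by (simp add: sum_subtractf[symmetric] algebra_simps)
    also have "\<bar>\<dots>\<bar> \<le> (\<Sum>j<n. \<bar>2 ^ j * (b (\<delta>j j z) - b (\<delta>j j z'))\<bar>)" by (rule sum_abs)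
    also have "\<dots> = (\<Sum>j<n. 2 ^ j * \<bar>b (\<delta>j j z') - b (\<delta>j j z)\<bar>)"
      by (intro sum.cong refl) (simp add: abs_mult abs_minus_commute)
    finally show ?thesis .
  qed
  have T_le: "2 ^ j * \<bar>b x - b y\<bar> \<le> 2 ^ j" for j :: nat and x y
  proof -
    have "\<bar>b x - b y\<bar> \<le> 1" using b01[of x] b01[of y] by linarith
    then show ?thesis by (simp add: mult_left_le)
  qed
  \<comment> \<open>Along \<open>V\<close> the factor \<open>\<beta>\<close> does not change, and
    the difference of \<open>s2\<close> vanishes outside the window
    \<open>R * 2 ^ j \<le> norm (h z')\<close>,
    \<open>norm (h z) \<le> 2 * R * 2 ^ j\<close>.\<close>
  have N_V0: "\<bar>N z' - N z\<bar> \<le> \<epsilon> * norm (h z' - h z)" if pw: "pw z' = pw z" and le: "norm (h z) \<le> norm (h z')" for z z'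
  proof -
    obtain n where n: "nrm z < r1 * 2 ^ n" "nrm z' < r1 * 2 ^ n" using big by blast
    define D where "D = norm (h z' - h z)"
    have bd: "b (\<delta>j j y) = \<beta> (\<delta>j j (pw y)) * s2 ((1 / R / 2 ^ j) *\<^sub>R h y)" for j y
      by (simp add: b_def bR_def \<delta>j_def pw_delta h_delta mult.commute)
    have "(\<Sum>j<n. 2 ^ j * \<bar>b (\<delta>j j z') - b (\<delta>j j z)\<bar>) \<le> ((real 1 + 2) * (Cs / R) + 4 / R) * D"
    proof (rule dyadic_difference_sum[of R "2 * R" 1 "Cs / R" "norm (h z)" "norm (h z')" D])
      show "norm (h z') \<le> norm (h z) + D" using norm_triangle_ineq2[of "h z'" "h z"] by (simp add: D_def)
      fix j
      have "\<bar>b (\<delta>j j z') - b (\<delta>j j z)\<bar> = \<beta> (\<delta>j j (pw z)) * \<bar>s2 ((1 / R / 2 ^ j) *\<^sub>R h z') - s2 ((1 / R / 2 ^ j) *\<^sub>R h z)\<bar>"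
        using \<beta>(3) by (simp add: bd pw right_diff_distrib[symmetric] abs_mult)
      also have "\<dots> \<le> 1 * \<bar>s2 ((1 / R / 2 ^ j) *\<^sub>R h z') - s2 ((1 / R / 2 ^ j) *\<^sub>R h z)\<bar>"
        using \<beta>(4) by (intro mult_right_mono) auto
      also have "\<dots> \<le> Cs * norm ((1 / R / 2 ^ j) *\<^sub>R h z' - (1 / R / 2 ^ j) *\<^sub>R h z)"
        using s2_lip[of "(1 / R / 2 ^ j) *\<^sub>R h z" "(1 / R / 2 ^ j) *\<^sub>R h z'"]
        by (simp add: subspace_scale[OF VV_subspace h_VV])
      also have "\<dots> = Cs * (1 / R / 2 ^ j * D)" using R(1) by (simp add: scaleR_diff_right[symmetric] D_def)
      finally have "2 ^ j * \<bar>b (\<delta>j j z') - b (\<delta>j j z)\<bar> \<le> 2 ^ j * (Cs * (1 / R / 2 ^ j * D))" by (intro mult_left_mono) auto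
      also have "\<dots> = Cs / R * D" by simp
      finally show "2 ^ j * \<bar>b (\<delta>j j z') - b (\<delta>j j z)\<bar> \<le> Cs / R * D" .
      have nn: "norm ((1 / R / 2 ^ j) *\<^sub>R h y) = norm (h y) / (R * 2 ^ j)" for y using R(1) by simp
      assume ne: "2 ^ j * \<bar>b (\<delta>j j z') - b (\<delta>j j z)\<bar> \<noteq> 0"
      show "R * 2 ^ j \<le> norm (h z') \<and> norm (h z) \<le> 2 * R * 2 ^ j"
      proof (rule ccontr)
        assume "\<not> ?thesis"
        then consider "norm (h z') < R * 2 ^ j" | "norm (h z) > 2 * R * 2 ^ j" by linarith
        then have "s2 ((1 / R / 2 ^ j) *\<^sub>R h z') = s2 ((1 / R / 2 ^ j) *\<^sub>R h z)"
        proof cases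
          case 1
          then have "norm ((1 / R / 2 ^ j) *\<^sub>R h y) \<le> 1" if "norm (h y) \<le> norm (h z')" for y
            unfolding nn using that R(1) by (simp add: divide_le_eq)
          then show ?thesis using le s2_1 by simp
        next
          case 2
          then have "norm ((1 / R / 2 ^ j) *\<^sub>R h y) \<ge> 2" if "norm (h y) \<ge> norm (h z)" for y
            unfolding nn using that R(1) by (simp add: le_divide_eq)
          then show ?thesis using le s2_0 by simp
        qed
        then show False using ne by (simp add: bd pw)
      qed
    qed (use R(1) Cs le T_le in auto)
    also have "\<dots> = (3 * Cs + 4) / R * D" by (simp add: add_divide_distrib)
    also have "\<dots> \<le> \<epsilon> * D" using R(2) by (intro mult_right_mono) (auto simp: D_def)
    finally show ?thesis using N_diff[OF n] by (simp add: D_def)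
  qed
  have N_V: "\<bar>N z' - N z\<bar> \<le> \<epsilon> * norm (h z' - h z)" if "pw z' = pw z" for z z'
    using N_V0[of z' z] N_V0[of z z'] that by (cases "norm (h z) \<le> norm (h z')") (auto simp: abs_minus_commute norm_minus_commute)
  \<comment> \<open>The ratio of the radii between which the cutoff varies determines how many
    dyadic scales a point can see.\<close>
  obtain m where m: "R0 / r1 < 2 ^ m" using real_arch_pow[of 2] by auto
  then have m': "R0 \<le> 2 ^ m * r1" using r1 by (simp add: field_simps)
  define C where "C = (real m + 2) * CR + 4 / r1"
  have C: "C > 0" using CR(1) r1 by (simp add: C_def add_pos_pos)
  have N_d0: "\<bar>N z' - N z\<bar> \<le> C * d z z'" if le: "nrm z \<le> nrm z'" for z z'
  proof -
    obtain n where n: "nrm z < r1 * 2 ^ n" "nrm z' < r1 * 2 ^ n" using big by blast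
    have "(\<Sum>j<n. 2 ^ j * \<bar>b (\<delta>j j z') - b (\<delta>j j z)\<bar>) \<le> ((real m + 2) * CR + 4 / r1) * d z z'"
    proof (rule dyadic_difference_sum[of r1 R0 m CR "nrm z" "nrm z'" "d z z'"])
      show "nrm z' \<le> nrm z + d z z'" using nrm_diff[of z z'] by linarith
      fix j
      have "\<delta>j j z' = \<delta>j j z + \<delta>j j (- z + z')" by (simp add: \<delta>j_def delta_add[symmetric] add.assoc[symmetric])
      then have "\<bar>b (\<delta>j j z') - b (\<delta>j j z)\<bar> \<le> CR * nrm (\<delta>j j (- z + z'))" using CR(2) by (simp add: b_def)
      then have "2 ^ j * \<bar>b (\<delta>j j z') - b (\<delta>j j z)\<bar> \<le> 2 ^ j * (CR * (d z z' / 2 ^ j))"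
        by (intro mult_left_mono) (auto simp: n\<delta> d_nrm[of z])
      then show "2 ^ j * \<bar>b (\<delta>j j z') - b (\<delta>j j z)\<bar> \<le> CR * d z z'" by simp
      assume ne: "2 ^ j * \<bar>b (\<delta>j j z') - b (\<delta>j j z)\<bar> \<noteq> 0"
      show "r1 * 2 ^ j \<le> nrm z' \<and> nrm z \<le> R0 * 2 ^ j"
      proof (rule ccontr)
        assume "\<not> ?thesis"
        then consider "nrm z' < r1 * 2 ^ j" | "nrm z > R0 * 2 ^ j" by linarith
        then have "b (\<delta>j j z') = b (\<delta>j j z)"
        proof cases
          case 1
          then have "nrm (\<delta>j j y) < r1" if "nrm y \<le> nrm z'" for y
            unfolding n\<delta> using that by (simp add: divide_less_eq)
          then show ?thesis using le b1 by simp
        next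
          case 2
          then have "nrm (\<delta>j j y) > R0" if "nrm y \<ge> nrm z" for y
            unfolding n\<delta> using that by (simp add: less_divide_eq)
          then show ?thesis using le b0 by simp
        qed
        then show False using ne by simp
      qed
    qed (use r1 R0 m' CR(1) le T_le in auto)
    then show ?thesis using N_diff[OF n] by (simp add: C_def)
  qed
  have N_d: "\<bar>N z' - N z\<bar> \<le> C * d z z'" for z z'
    using N_d0[of z' z] N_d0[of z z'] dm.commute[of z z'] by (cases "nrm z \<le> nrm z'") (auto simp: abs_minus_commute)
  have N_ge: "N z \<ge> t - 1" if "\<And>j. 2 ^ j \<le> t \<Longrightarrow> b (\<delta>j j z) = 0" for z t
  proof -
    obtain n where n: "nrm z < r1 * 2 ^ n" "t < 2 ^ n" using big by blast
    have "min (2 ^ n) t - 1 \<le> (\<Sum>j<n. 2 ^ j * (1 - b (\<delta>j j z)))"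
      using b01 that by (intro dyadic_sum_ge) auto
    then show ?thesis using N_eq[OF n(1)] n(2) by simp
  qed
  have sm: "smooth_at \<A> (EU :: (real, real) chart set) N z" for z
  proof -
    obtain n where n: "nrm z < r1 * 2 ^ n" using big by blast
    have bs: "smooth_at \<A> (EU :: (real, real) chart set) (\<lambda>z. b (\<delta>j j z)) x" for j x
      unfolding b_def \<delta>j_def
      by (rule smooth_at_comp[OF is_pre_atlas is_pre_atlas pre_atlas_euclidean smooth_at_delta[OF _ is_pre_atlas smooth_at_G_ident] bR_smooth]) simp
    have "smooth_at \<A> (EU :: (real, real) chart set) (\<lambda>z. \<Sum>j<n. 2 ^ j * (1 - b (\<delta>j j z))) z"
      by (intro smooth_at_sum_euclidean is_pre_atlas finite_lessThan
          smooth_at_linear[OF is_pre_atlas smooth_at_diff_euclidean[OF is_pre_atlas smooth_at_const bs] bounded_linear_mult_right])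
    then show ?thesis
      by (rule smooth_at_cong[OF is_pre_atlas pre_atlas_euclidean _ open_ball_d[of 0 "r1 * 2 ^ n"]]) (use n N_eq in auto)
  qed
  show thesis
  proof (rule that)
    show "C > 0" by fact
    show "1 / (R0 + 1) > 0" using R0 by simp
    show "smooth_at \<A> EU N z" for z by (rule sm)
    show "N 0 = 0" using N_eq[of 0 0] r1 by simp
    show "\<bar>N (z + E X) - N z\<bar> \<le> \<epsilon> * norm X" if "X \<in> VV" for z X
      using N_V[of "z + E X" z] pw_add_E[OF that] by (simp add: h_add h_E[OF that])
    show "\<bar>N (z + y) - N z\<bar> \<le> C * nrm y" for z y
      using N_d[of "z + y" z] d_translate[of z 0 y] by simp
    show "N z \<ge> 2 * norm (h z) - 1" if "norm (h z) \<le> l * nrm (pw z)" for z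
    proof -
      have "nrm (pw z) / \<rho> - 1 \<le> N z"
      proof (rule N_ge)
        fix j assume "2 ^ j \<le> nrm (pw z) / \<rho>"
        then have "\<rho> \<le> nrm (pw (\<delta>j j z))" using \<rho> by (simp add: \<delta>j_def pw_delta nrm_delta field_simps)
        then show "b (\<delta>j j z) = 0" using \<beta>(6) by (simp add: b_def bR_def)
      qed
      moreover have "2 * norm (h z) \<le> nrm (pw z) / \<rho>" using that by (simp add: \<rho>_def mult.commute)
      ultimately show ?thesis by linarith
    qed
    \<comment> \<open>\<open>R0 + 1\<close> in place of \<open>R0\<close>, since \<open>b\<close> is
      known to vanish strictly beyond \<open>R0\<close>.\<close>
    show "N z \<ge> 1 / (R0 + 1) * nrm z - 1" for z
    proof (rule N_ge)
      fix j assume "2 ^ j \<le> 1 / (R0 + 1) * nrm z"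
      then have "R0 + 1 \<le> nrm z / 2 ^ j" using R0 by (simp add: field_simps)
      then show "b (\<delta>j j z) = 0" by (intro b0) (simp add: n\<delta>)
    qed
  qed
qed

section \<open>Smooth minima\<close>

text \<open>Transfers the Euclidean implicit function theorem to the group. Smoothness of
  \<open>F\<close> is tested along smooth maps \<open>i\<close> into the group, which avoids a
  product of the group with a vector space; injectivity is asked of any derivative, so that a lower
  Lipschitz bound can supply it.\<close>

lemma smooth_at_implicit:
  fixes F :: "'g \<Rightarrow> 'b::euclidean_space \<Rightarrow> 'b" and y :: "'g \<Rightarrow> 'b"
  assumes Q: "open Q" "x0 \<in> Q"
    and F: "\<And>(i :: 'a \<times> 'b \<Rightarrow> 'g) p. smooth_at EU \<A> i p \<Longrightarrow> i p \<in> Q \<Longrightarrow> smooth_at EU EU (\<lambda>z. F (i z) (snd z)) p"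
    and cont: "\<And>x. x \<in> Q \<Longrightarrow> isCont y x"
    and eq: "\<And>x. x \<in> Q \<Longrightarrow> F x (y x) = 0"
    and inj: "\<And>x D w. x \<in> Q \<Longrightarrow> (F x has_derivative D) (at (y x)) \<Longrightarrow> D w = 0 \<Longrightarrow> w = 0"
  shows "smooth_at \<A> EU y x0"
proof -
  obtain U1 \<kappa> where c: "(U1, \<kappa>) \<in> \<A>" "x0 \<in> U1" using pre_atlasD(2)[OF is_pre_atlas] by blast
  note ch = pre_atlasD(1)[OF is_pre_atlas c(1)]
  have comp: "compatible (U1, \<kappa>) c'" if "c' \<in> \<A>" for c'
    using is_smooth_atlas c that unfolding smooth_atlas_def by blast
  define i where "i = inv_into U1 \<kappa>"
  have i_k: "i (\<kappa> x) = x" if "x \<in> U1" for x using is_chartD(6)[OF ch that] by (simp add: i_def)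
  have i: "smooth_at EU \<A> i X" if "X \<in> \<kappa> ` U1" for X
    unfolding i_def by (rule smooth_at_inv_compatible_chart[OF is_pre_atlas ch comp that])
  define O1 where "O1 = \<kappa> ` (U1 \<inter> Q)"
  have O1: "open O1"
    unfolding O1_def using Q(1) is_chartD(1)[OF ch] by (intro open_chart_image[OF ch]) auto
  have O1_i: "X \<in> \<kappa> ` U1" "i X \<in> Q" if "X \<in> O1" for X using that i_k by (auto simp: O1_def)
  define S where "S = O1 \<times> (UNIV :: 'b set)"
  have S: "open S" unfolding S_def using O1 by (intro open_Times) auto
  define Ff where "Ff z = F (i (fst z)) (snd z)" for z
  have i_fst: "smooth_at EU \<A> (\<lambda>z::'a \<times> 'b. i (fst z)) p" if "p \<in> S" for p
    by (rule smooth_at_comp[OF pre_atlas_euclidean pre_atlas_euclidean is_pre_atlas])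
      (use that O1_i i in \<open>auto simp: S_def intro!: smooth_at_euclideanI[of UNIV fst] Ck_on_bounded_linear bounded_linear_fst simp: smooth_on_def\<close>)
  have Ff: "smooth_on S Ff"
  proof (rule smooth_on_if_smooth_at)
    fix p assume "p \<in> S"
    then show "smooth_at EU EU Ff p"
      unfolding Ff_def using O1_i by (intro F i_fst) (auto simp: S_def)
  qed
  have "Ck_on (Suc n) O1 (\<lambda>X. y (i X))" for n
  proof (rule Ck_on_implicit[OF S O1 smooth_on_Ck[OF Ff]])
    have "isCont (\<lambda>X. y (i X)) X" if "X \<in> O1" for X
      using isCont_o2[OF smooth_at_isCont[OF i[OF O1_i(1)[OF that]]] cont[OF O1_i(2)[OF that]]] .
    then show "continuous_on O1 (\<lambda>X. y (i X))" by (simp add: continuous_at_imp_continuous_on)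
    show "(X, y (i X)) \<in> S" if "X \<in> O1" for X using that by (simp add: S_def)
    show "Ff (X, y (i X)) = 0" if "X \<in> O1" for X using eq[OF O1_i(2)[OF that]] by (simp add: Ff_def)
    fix X v assume X: "X \<in> O1" and v: "fd Ff (X, y (i X)) (0, v) = 0"
    have "Ff differentiable (at (X, y (i X)))" using smooth_on_Ck[OF Ff, of 1] X by (simp add: S_def)
    then have "((\<lambda>w. Ff (X, w)) has_derivative (\<lambda>v. fd Ff (X, y (i X)) (0, v))) (at (y (i X)))"
      by (intro has_derivative_compose[where f = "\<lambda>w. (X, w)" and g = Ff] fd_works has_derivative_Pair
          has_derivative_const has_derivative_ident)
    then have "(F (i X) has_derivative (\<lambda>v. fd Ff (X, y (i X)) (0, v))) (at (y (i X)))"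
      by (simp add: Ff_def)
    from inj[OF O1_i(2)[OF X] this v] show "v = 0" .
  qed
  then have "smooth_on O1 (\<lambda>X. y (i X))" unfolding smooth_on_def using Ck_on_SucD by blast
  moreover have "\<kappa> x0 \<in> O1" using c Q by (auto simp: O1_def)
  ultimately have "smooth_at EU EU (\<lambda>X. y (i X)) (\<kappa> x0)" using smooth_at_euclideanI O1 by blast
  from smooth_at_comp[OF is_pre_atlas pre_atlas_euclidean pre_atlas_euclidean smooth_at_compatible_chart[OF is_pre_atlas ch comp c(2)] this]
  have "smooth_at \<A> EU (\<lambda>x. y (i (\<kappa> x))) x0" .
  then show ?thesis
    by (rule smooth_at_cong[OF is_pre_atlas pre_atlas_euclidean _ is_chartD(1)[OF ch] c(2)]) (simp add: i_k)
qed

text \<open>\<open>q x\<close> is the zero of \<open>t \<mapsto> (\<Sum>p. weight (a p x - t)) - 1\<close>. Unlike a partition of unity, this does not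
  deteriorate the modulus of continuity: if all \<open>a p\<close> change by at most \<open>c\<close>, then so does \<open>q\<close>.\<close>

lemma soft_min:
  fixes a :: "'g \<Rightarrow> 'g \<Rightarrow> real"
  assumes ne: "p0 \<in> I" and fin: "\<And>R T. finite {p\<in>I. \<exists>x. nrm x \<le> R \<and> a p x < T}"
    and sm: "\<And>p x. p \<in> I \<Longrightarrow> smooth_at \<A> EU (a p) x"
    and lip: "\<And>p x x'. p \<in> I \<Longrightarrow> \<bar>a p x' - a p x\<bar> \<le> C * d x x'"
  obtains q :: "'g \<Rightarrow> real" where "\<And>x. smooth_at \<A> EU q x"
    "\<And>x x' c. (\<And>p. p \<in> I \<Longrightarrow> \<bar>a p x' - a p x\<bar> \<le> c) \<Longrightarrow> \<bar>q x' - q x\<bar> \<le> c"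
    "\<And>x p. p \<in> I \<Longrightarrow> q x \<le> a p x" "\<And>x T. (\<And>p. p \<in> I \<Longrightarrow> T \<le> a p x) \<Longrightarrow> T - 1 \<le> q x"
proof -
  \<comment> \<open>Only indices with \<open>a p x < t + 1\<close> have nonzero weight, so
    restricting to them gives a finite sum with the intended value.\<close>
  define G where "G x t = (\<Sum>p\<in>{p\<in>I. a p x < t + 1}. weight (a p x - t))" for x t
  have finx: "finite {p\<in>I. a p x < T}" for x T
    by (rule finite_subset[OF _ fin[of "nrm x" T]]) auto
  have G_eq: "G x t = (\<Sum>p\<in>M. weight (a p x - t))"
    if "finite M" "M \<subseteq> I" "{p\<in>I. a p x < t + 1} \<subseteq> M" for M x t
    unfolding G_def by (rule sum.mono_neutral_left) (use that in \<open>auto intro!: weight_eq_0\<close>)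
  \<comment> \<open>Strictness comes from an active index, which \<open>G x t > 0\<close>
    provides.\<close>
  have G_strict: "G x t < G x t'" if "t < t'" "G x t > 0" for x t t'
  proof -
    define M where "M = {p\<in>I. a p x < t' + 1}"
    have M: "finite M" "M \<subseteq> I" "{p\<in>I. a p x < t' + 1} \<subseteq> M" "{p\<in>I. a p x < t + 1} \<subseteq> M"
      using finx that by (auto simp: M_def)
    have "\<exists>p\<in>I. a p x < t + 1"
    proof (rule ccontr)
      assume "\<not> ?thesis"
      then have "{p\<in>I. a p x < t + 1} = {}" by blast
      then show False using that(2) by (simp only: G_def sum.empty)
    qed
    then obtain p where p: "p \<in> I" "a p x < t + 1" by blast
    have "(\<Sum>p\<in>M. weight (a p x - t)) < (\<Sum>p\<in>M. weight (a p x - t'))"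
    proof (rule sum_strict_mono_ex1[OF M(1)])
      show "\<forall>p\<in>M. weight (a p x - t) \<le> weight (a p x - t')" using that(1) by (auto intro!: weight_antimono)
      show "\<exists>p\<in>M. weight (a p x - t) < weight (a p x - t')"
        using p that(1) by (intro bexI[of _ p] weight_strict_antimono) (auto simp: M_def)
    qed
    then show ?thesis using G_eq[OF M(1,2,3)] G_eq[OF M(1,2,4)] by simp
  qed
  have G_ge1: "G x (a p x) \<ge> 1" if "p \<in> I" for x p
  proof -
    have "weight (a p x - a p x) \<le> G x (a p x)"
      unfolding G_def by (rule member_le_sum) (use that finx in \<open>auto simp: weight_nonneg\<close>)
    then show ?thesis using weight_ge_1[of 0] by simp
  qed
  have "\<exists>t. G x t = 1" for x
  proof -
    define t1 where "t1 = a p0 x"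
    define M where "M = {p\<in>I. a p x < t1 + 1}"
    have M: "finite M" "M \<subseteq> I" "p0 \<in> M" using finx ne by (auto simp: M_def t1_def)
    define m where "m = Min ((\<lambda>p. a p x) ` M)"
    have m: "m \<le> a p x" if "p \<in> M" for p unfolding m_def using M(1) that by (intro Min_le) auto
    have Geq: "G x t = (\<Sum>p\<in>M. weight (a p x - t))" if "t \<le> t1" for t
      using M that by (intro G_eq) (auto simp: M_def)
    have mt: "m - 1 \<le> t1" using m[OF M(3)] by (simp add: t1_def)
    \<comment> \<open>At \<open>m - 1\<close> all weights vanish, and at \<open>t1 = a p0 x\<close>
      the index \<open>p0\<close> alone contributes 1. The finite set \<open>M\<close> serves for
      the whole interval.\<close>
    have "\<exists>t\<ge>m - 1. t \<le> t1 \<and> (\<Sum>p\<in>M. weight (a p x - t)) = 1"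
    proof (rule IVT')
      have "weight (a p x - (m - 1)) = 0" if "p \<in> M" for p using m[OF that] by (intro weight_eq_0) simp
      then show "(\<Sum>p\<in>M. weight (a p x - (m - 1))) \<le> 1" by simp
      show "1 \<le> (\<Sum>p\<in>M. weight (a p x - t1))" using Geq[of t1] G_ge1[OF ne, of x] by (simp add: t1_def)
      show "continuous_on {m - 1..t1} (\<lambda>t. \<Sum>p\<in>M. weight (a p x - t))"
        by (intro continuous_on_sum continuous_on_compose2[OF continuous_on_weight[of UNIV]] continuous_intros) auto
    qed (rule mt)
    then show ?thesis using Geq by metis
  qed
  then obtain q where q: "\<And>x. G x (q x) = 1" by metis
  \<comment> \<open>Raising the level by \<open>c\<close> compensates the rise of every
    \<open>a p\<close>, so \<open>G x' (q x + c)\<close> is still at least 1.\<close>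
  have le: "q x' \<le> q x + c" if cmp: "\<And>p. p \<in> I \<Longrightarrow> a p x' \<le> a p x + c" for x x' c
  proof (rule ccontr)
    assume "\<not> ?thesis"
    then have lt: "q x + c < q x'" by simp
    define M where "M = {p\<in>I. a p x < q x + 1} \<union> {p\<in>I. a p x' < q x + c + 1}"
    have M: "finite M" "M \<subseteq> I" using finx by (auto simp: M_def)
    have "1 = (\<Sum>p\<in>M. weight (a p x - q x))" unfolding q[of x, symmetric] by (rule G_eq[OF M]) (auto simp: M_def)
    also have "\<dots> \<le> (\<Sum>p\<in>M. weight (a p x' - (q x + c)))"
    proof (intro sum_mono weight_antimono)
      fix p assume "p \<in> M"
      then show "a p x' - (q x + c) \<le> a p x - q x" using cmp[of p] M(2) by auto
    qed
    also have "\<dots> = G x' (q x + c)" by (rule G_eq[OF M, symmetric]) (auto simp: M_def)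
    finally have "1 \<le> G x' (q x + c)" .
    then show False using G_strict[OF lt, of x'] q[of x'] by simp
  qed
  have mod: "\<bar>q x' - q x\<bar> \<le> c" if "\<And>p. p \<in> I \<Longrightarrow> \<bar>a p x' - a p x\<bar> \<le> c" for x x' c
  proof -
    have "q x' \<le> q x + c" by (rule le) (use that in \<open>fastforce simp: abs_le_iff\<close>)
    moreover have "q x \<le> q x' + c" by (rule le) (use that in \<open>fastforce simp: abs_le_iff\<close>)
    ultimately show ?thesis by linarith
  qed
  have qlip: "\<bar>q x' - q x\<bar> \<le> C * d x x'" for x x' using lip by (intro mod)
  have qcont: "isCont q x" for x
  proof -
    have "((\<lambda>z. d x z) \<longlongrightarrow> 0) (at x)" using tendsto_ident_at[of x UNIV] unfolding tendsto_iff_d .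
    then have "((\<lambda>z. C * d x z) \<longlongrightarrow> 0) (at x)" by (rule tendsto_mult_right_zero)
    moreover have "\<forall>\<^sub>F z in at x. norm (q z - q x) \<le> C * d x z" using qlip by simp
    ultimately have "((\<lambda>z. q z - q x) \<longlongrightarrow> 0) (at x)" by (rule Lim_null_comparison[rotated])
    then show ?thesis unfolding isCont_def by (rule LIM_zero_cancel)
  qed
  have "smooth_at \<A> EU q x0" for x0
  proof -
    \<comment> \<open>Within this radius \<open>q\<close> changes by less than 1, so one finite
      index set \<open>M\<close> serves a whole neighbourhood of \<open>x0\<close>.\<close>
    define r where "r = min 1 (1 / (\<bar>C\<bar> + 1))"
    have r: "r > 0" "r \<le> 1" "\<bar>C\<bar> * r < 1"
    proof -
      have "\<bar>C\<bar> * r \<le> \<bar>C\<bar> * (1 / (\<bar>C\<bar> + 1))" by (intro mult_left_mono) (auto simp: r_def)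
      also have "\<dots> < 1" by (simp add: divide_less_eq)
      finally show "\<bar>C\<bar> * r < 1" .
    qed (auto simp: r_def)
    define Q where "Q = {x. d x0 x < r}"
    define M where "M = {p\<in>I. \<exists>x. nrm x \<le> nrm x0 + 1 \<and> a p x < q x0 + 3}"
    have M: "finite M" "M \<subseteq> I" using fin by (auto simp: M_def)
    have sub: "{p\<in>I. a p x < q x + 1} \<subseteq> M" if "x \<in> Q" for x
    proof -
      have "\<bar>q x - q x0\<bar> \<le> \<bar>C\<bar> * d x0 x"
        using qlip[of x x0] mult_right_mono[OF abs_ge_self[of C] dm.nonneg[of x0 x]] by linarith
      also have "\<dots> \<le> \<bar>C\<bar> * r" using that by (intro mult_left_mono) (auto simp: Q_def)
      finally have "q x < q x0 + 1" using r(3) by linarith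
      moreover have "nrm x \<le> nrm x0 + 1" using nrm_diff[of x0 x] that r(2) by (auto simp: Q_def)
      ultimately show ?thesis by (fastforce simp: M_def)
    qed
    define F where "F x t = (\<Sum>p\<in>M. weight (a p x - t)) - 1" for x t
    show ?thesis
    proof (rule smooth_at_implicit[where Q = Q and F = F])
      show "open Q" unfolding Q_def by (rule open_ball_d)
      show "x0 \<in> Q" using r(1) by (simp add: Q_def)
      show "F x (q x) = 0" if "x \<in> Q" for x
        using G_eq[OF M sub[OF that]] q[of x] by (simp add: F_def)
      show "isCont q x" for x by (rule qcont)
      fix i :: "'a \<times> real \<Rightarrow> 'g" and p assume i: "smooth_at EU \<A> i p"
      have snd: "smooth_at EU (EU :: (real, real) chart set) (snd :: 'a \<times> real \<Rightarrow> real) p"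
        by (auto intro!: smooth_at_euclideanI[of UNIV] Ck_on_bounded_linear bounded_linear_snd simp: smooth_on_def)
      have "smooth_at EU (EU :: (real, real) chart set) (\<lambda>z. weight (a b (i z) - snd z)) p" if "b \<in> M" for b
      proof (rule smooth_at_euclidean_comp[OF pre_atlas_euclidean _ smooth_on_weight open_UNIV UNIV_I])
        have "smooth_at EU (EU :: (real, real) chart set) (\<lambda>z. a b (i z)) p"
          using M(2) that by (intro smooth_at_comp[OF pre_atlas_euclidean is_pre_atlas pre_atlas_euclidean i] sm) auto
        then show "smooth_at EU (EU :: (real, real) chart set) (\<lambda>z. a b (i z) - snd z) p"
          by (rule smooth_at_diff_euclidean[OF pre_atlas_euclidean _ snd])
      qed
      then show "smooth_at EU (EU :: (real, real) chart set) (\<lambda>z. F (i z) (snd z)) p"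
        unfolding F_def
        by (intro smooth_at_diff_euclidean smooth_at_sum_euclidean pre_atlas_euclidean M(1) smooth_at_const)
    next
      fix x D w assume x: "x \<in> Q" and D: "(F x has_derivative D) (at (q x))" and "D w = 0"
      obtain c where c: "\<And>s. (weight has_real_derivative c s) (at s)" "\<And>s. c s \<le> 0" "\<And>s. s < 1 \<Longrightarrow> c s < 0"
        using weight_has_real_derivative by metis
      have "((\<lambda>t. weight (a p x - t)) has_real_derivative c (a p x - q x) * (- 1)) (at (q x))" for p
        by (rule DERIV_chain2[where f = weight, OF c(1)]) (auto intro!: derivative_eq_intros)
      then have "(F x has_real_derivative (\<Sum>p\<in>M. c (a p x - q x) * (- 1)) - 0) (at (q x))"
        unfolding F_def by (intro DERIV_diff DERIV_sum DERIV_const)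
      then have "(F x has_derivative (*) (\<Sum>p\<in>M. c (a p x - q x) * (- 1))) (at (q x))"
        by (simp add: has_field_derivative_def)
      then have "D = (*) (\<Sum>p\<in>M. c (a p x - q x) * (- 1))" by (rule has_derivative_unique[OF D])
      \<comment> \<open>The weights add up to 1, so some index is active, and there the slope of
        \<open>weight\<close> is strictly negative.\<close>
      moreover have "(\<Sum>p\<in>M. c (a p x - q x) * (- 1)) > 0"
      proof -
        have "{p\<in>I. a p x < q x + 1} \<noteq> {}"
        proof
          assume "{p\<in>I. a p x < q x + 1} = {}"
          then have "G x (q x) = 0" by (simp only: G_def sum.empty)
          then show False using q[of x] by simp
        qed
        then obtain p where p: "p \<in> M" "a p x < q x + 1" using sub[OF x] by blast
        show ?thesis
        proof (rule sum_pos2[OF M(1) p(1)])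
          show "0 < c (a p x - q x) * - 1" using c(3)[of "a p x - q x"] p(2) by simp
          show "0 \<le> c (a i x - q x) * - 1" for i using c(2)[of "a i x - q x"] by simp
        qed
      qed
      ultimately show "w = 0" using \<open>D w = 0\<close> by simp
    qed
  qed
  moreover have "q x \<le> a p x" if "p \<in> I" for x p
  proof (rule ccontr)
    assume "\<not> ?thesis"
    then have "G x (a p x) < G x (q x)" using G_ge1[OF that, of x] by (intro G_strict) auto
    then show False using G_ge1[OF that, of x] q[of x] by simp
  qed
  \<comment> \<open>\<open>weight\<close> vanishes from 1 on, so the level 1 cannot be reached more
    than 1 below all the \<open>a p x\<close>.\<close>
  moreover have "T - 1 \<le> q x" if "\<And>p. p \<in> I \<Longrightarrow> T \<le> a p x" for x T
  proof (rule ccontr)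
    assume n: "\<not> ?thesis"
    have "{p\<in>I. a p x < q x + 1} = {}" using that n by force
    then have "G x (q x) = 0" by (simp only: G_def sum.empty)
    then show False using q[of x] by simp
  qed
  ultimately show thesis using that mod by blast
qed

section \<open>Separated nets\<close>

text \<open>A maximal separated subset, by Zorn's lemma: a point at distance at least 1 from all its
  members could be added.\<close>

lemma separated_net:
  obtains I where "I \<subseteq> S" "\<And>p q. p \<in> I \<Longrightarrow> q \<in> I \<Longrightarrow> p \<noteq> q \<Longrightarrow> d p q \<ge> 1"
    "\<And>x. x \<in> S \<Longrightarrow> \<exists>p\<in>I. d p x < 1"
proof -
  define \<C> where "\<C> = {I. I \<subseteq> S \<and> (\<forall>p\<in>I. \<forall>q\<in>I. p \<noteq> q \<longrightarrow> d p q \<ge> 1)}"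
  have "\<exists>M\<in>\<C>. \<forall>X\<in>\<C>. M \<subseteq> X \<longrightarrow> X = M"
  proof (rule subset_Zorn')
    fix c assume c: "subset.chain \<C> c"
    show "\<Union>c \<in> \<C>"
      unfolding \<C>_def
    proof (intro CollectI conjI ballI impI)
      show "\<Union>c \<subseteq> S" using c by (auto simp: subset.chain_def \<C>_def)
      fix p q assume "p \<in> \<Union>c" "q \<in> \<Union>c" and pq: "p \<noteq> q"
      then obtain X Y where XY: "X \<in> c" "Y \<in> c" "p \<in> X" "q \<in> Y" by blast
      then have "X \<subseteq> Y \<or> Y \<subseteq> X" using c by (auto simp: subset.chain_def)
      then obtain Z where "Z \<in> c" "p \<in> Z" "q \<in> Z" using XY by blast
      moreover have "Z \<in> \<C>" using c \<open>Z \<in> c\<close> by (auto simp: subset.chain_def)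
      ultimately show "d p q \<ge> 1" using pq by (auto simp: \<C>_def)
    qed
  qed
  then obtain I where I: "I \<in> \<C>" "\<And>X. X \<in> \<C> \<Longrightarrow> I \<subseteq> X \<Longrightarrow> X = I" by blast
  have "\<exists>p\<in>I. d p x < 1" if "x \<in> S" for x
  proof (rule ccontr)
    assume n: "\<not> ?thesis"
    then have "insert x I \<in> \<C>" using I(1) that by (auto simp: \<C>_def not_less dm.commute)
    then have "x \<in> I" using I(2) by blast
    then show False using n by force
  qed
  then show thesis using that I(1) by (auto simp: \<C>_def)
qed

text \<open>An infinite bounded subset would contain a convergent sequence of distinct
  points.\<close>

lemma separated_finite:
  assumes sep: "\<And>p q. p \<in> I \<Longrightarrow> q \<in> I \<Longrightarrow> p \<noteq> q \<Longrightarrow> d p q \<ge> 1"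
  shows "finite {p\<in>I. nrm p \<le> R}"
proof (rule ccontr)
  assume "infinite {p\<in>I. nrm p \<le> R}"
  then obtain f :: "nat \<Rightarrow> 'g" where f: "inj f" "range f \<subseteq> {p\<in>I. nrm p \<le> R}"
    using infinite_countable_subset by blast
  then have "nrm (f n) \<le> R" for n by blast
  then obtain l r where r: "strict_mono (r :: nat \<Rightarrow> nat)" "(\<lambda>n. f (r n)) \<longlonglongrightarrow> l" by (rule bounded_subseq)
  have "(\<lambda>n. d l (f (r n))) \<longlonglongrightarrow> 0" using r(2) by (simp add: tendsto_iff_d)
  then have "\<forall>\<^sub>F n in sequentially. d l (f (r n)) < 1 / 2" by (rule order_tendstoD) simp
  then obtain N where N: "\<And>n. n \<ge> N \<Longrightarrow> d l (f (r n)) < 1 / 2" unfolding eventually_sequentially by blast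
  have "d (f (r N)) (f (r (Suc N))) < 1"
    using N[of N] N[of "Suc N"] dm.triangle[of "f (r N)" l "f (r (Suc N))"] by (simp add: dm.commute)
  moreover have "r N \<noteq> r (Suc N)" using strict_monoD[OF r(1), of N "Suc N"] by simp
  then have "f (r N) \<noteq> f (r (Suc N))" using f(1) by (simp add: inj_eq)
  then have "d (f (r N)) (f (r (Suc N))) \<ge> 1" using f(2) by (intro sep) blast+
  ultimately show False by simp
qed

section \<open>Smooth approximation of graphs\<close>

text \<open>Stated for sets rather than maps, so that it applies equally to graphs, their dilates
  and zero sets.\<close>

definition slope_bounded :: "real \<Rightarrow> 'g set \<Rightarrow> bool" where
  "slope_bounded l S \<longleftrightarrow> (\<forall>x\<in>S. \<forall>y\<in>S. norm (h (- x + y)) \<le> l * nrm (pw (- x + y)))"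

lemma slope_boundedD:
  "slope_bounded l S \<Longrightarrow> x \<in> S \<Longrightarrow> y \<in> S \<Longrightarrow> norm (h (- x + y)) \<le> l * nrm (pw (- x + y))"
  by (simp add: slope_bounded_def)

text \<open>On \<open>S\<close> the homomorphism \<open>h\<close> agrees up to a constant with a smooth map \<open>q\<close> that is Lipschitz with a
  small constant along \<open>V\<close>. The map \<open>F\<close> solves \<open>h (x + E (F x)) = q (x + E (F x))\<close> by contraction.\<close>

lemma coarse_extension:
  assumes l: "l > 0"
  shows "\<exists>L>0. \<exists>K>0. \<forall>S. slope_bounded l S \<longrightarrow>
    (\<exists>F. (\<forall>x. smooth_at \<A> EU F x) \<and> (\<forall>x. F x \<in> VV) \<and> (\<forall>x. \<forall>X\<in>VV. F (x + E X) = F x - X) \<and>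
      slope_bounded L {x. F x = 0} \<and> (\<forall>x\<in>S. norm (F x) \<le> K))"
proof -
  define n where "n = real DIM('a)"
  have n: "n > 0" by (simp add: n_def)
  \<comment> \<open>Each coordinate of the soft minimum has slope at most \<epsilon> along
    \<open>V\<close>; the \<open>n\<close> coordinates together have slope at most 1/2.\<close>
  define \<epsilon> where "\<epsilon> = 1 / (2 * n)"
  have \<epsilon>: "\<epsilon> > 0" using n by (simp add: \<epsilon>_def)
  obtain N :: "'g \<Rightarrow> real" and C c where N: "C > 0" "c > 0" "\<And>z. smooth_at \<A> EU N z" "N 0 = 0"
    "\<And>z X. X \<in> VV \<Longrightarrow> \<bar>N (z + E X) - N z\<bar> \<le> \<epsilon> * norm X"
    "\<And>z y. \<bar>N (z + y) - N z\<bar> \<le> C * nrm y"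
    "\<And>z. norm (h z) \<le> l * nrm (pw z) \<Longrightarrow> N z \<ge> 2 * norm (h z) - 1"
    "\<And>z. N z \<ge> c * nrm z - 1"
    by (rule gauge_exists[OF l \<epsilon>]) (erule that; assumption)
  obtain Ch where Ch: "Ch > 0" "\<And>x. norm (h x) \<le> Ch * nrm x" using h_bound by blast
  have L0: "2 * n * C > 0" using n N by simp
  have K0: "2 * (n * (Ch + C + 2)) > 0" using n N Ch by simp
  show ?thesis
  proof (rule exI[of _ "2 * n * C"], intro conjI L0, rule exI[of _ "2 * (n * (Ch + C + 2))"], intro conjI K0 allI impI)
    fix S assume Sb: "slope_bounded l S"
    note S = slope_boundedD[OF Sb]
    show "\<exists>F. (\<forall>x. smooth_at \<A> EU F x) \<and> (\<forall>x. F x \<in> VV) \<and> (\<forall>x. \<forall>X\<in>VV. F (x + E X) = F x - X) \<and>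
        slope_bounded (2 * n * C) {x. F x = 0} \<and> (\<forall>x\<in>S. norm (F x) \<le> 2 * (n * (Ch + C + 2)))"
    proof (cases "S = {}")
      case True
      \<comment> \<open>For empty \<open>S\<close> there are no net points; the subgroup
        \<open>W\<close>, the zero set of \<open>- h\<close>, serves as the graph.\<close>
      have "smooth_at \<A> EU (\<lambda>x. - h x) x" for x
        by (rule smooth_at_linear[OF is_pre_atlas smooth_at_h bounded_linear_minus[OF bounded_linear_ident]])
      then show ?thesis using True L0
        by (intro exI[of _ "\<lambda>x. - h x"]) (auto simp: slope_bounded_def h_add h_E h_uminus subspace_neg VV_subspace h_VV)
    next
      case False
      obtain I where I: "I \<subseteq> S" "\<And>p q. p \<in> I \<Longrightarrow> q \<in> I \<Longrightarrow> p \<noteq> q \<Longrightarrow> d p q \<ge> 1"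
        "\<And>x. x \<in> S \<Longrightarrow> \<exists>p\<in>I. d p x < 1" using separated_net by blast
      obtain p0 where p0: "p0 \<in> I" using False I(3) by blast
      define a where "a b p x = h p \<bullet> b + N (- p + x)" for b p x
      have N_lip: "\<bar>N (- p + x') - N (- p + x)\<bar> \<le> C * d x x'" for p x x'
        using N(6)[of "- p + x" "- x + x'"] d_nrm[of x x'] by (simp add: add.assoc)
      \<comment> \<open>Averaging the two lower bounds of \<open>N\<close> leaves
        \<open>norm (h z)\<close>, which pays for replacing \<open>h p\<close> by
        \<open>h p0\<close>, plus a term linear in \<open>nrm z\<close>. Hence
        \<open>a b p x < T\<close> confines \<open>p\<close> to a bounded set.\<close>
      have fin: "finite {p\<in>I. \<exists>x. nrm x \<le> R \<and> a b p x < T}" if b: "b \<in> Basis" for b R T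
      proof -
        define Q where "Q = (T - h p0 \<bullet> b + 1 + C * (nrm p0 + R)) * 2 / c"
        have "{p\<in>I. \<exists>x. nrm x \<le> R \<and> a b p x < T} \<subseteq> {p\<in>I. nrm p \<le> nrm p0 + Q}"
        proof safe
          fix p x assume p: "p \<in> I" "nrm x \<le> R" "a b p x < T"
          define z where "z = - p + p0"
          have "norm (h z) \<le> l * nrm (pw z)" using S p(1) p0 I(1) by (auto simp: z_def)
          then have 1: "N z \<ge> 2 * norm (h z) - 1" by (rule N)
          have 2: "N z \<ge> c * nrm z - 1" by (rule N)
          have "h z \<bullet> b \<le> norm (h z)" using Basis_le_norm[OF b, of "h z"] by linarith
          then have 3: "h p0 \<bullet> b - norm (h z) \<le> h p \<bullet> b" by (simp add: z_def h_add h_uminus inner_diff_left inner_add_left)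
          have "d p0 x \<le> nrm p0 + nrm x" using nrm_add[of "- p0" x] by (simp add: d_nrm[of p0])
          then have "C * d p0 x \<le> C * (nrm p0 + R)" using N(1) p(2) by (intro mult_left_mono) auto
          then have "N z - C * (nrm p0 + R) \<le> N (- p + x)" using N_lip[of p x p0] unfolding z_def by (simp add: abs_le_iff)
          then have "c * nrm z / 2 \<le> T - h p0 \<bullet> b + 1 + C * (nrm p0 + R)"
            using 1 2 3 p(3) unfolding a_def by argo
          then have "nrm z \<le> Q" using N(2) by (simp add: Q_def field_simps)
          moreover have "nrm p \<le> nrm p0 + nrm z"
            using nrm_add[of p0 "- z"] nrm_uminus[of z] by (simp add: z_def minus_add add.assoc[symmetric] del: nrm_uminus)
          ultimately show "nrm p \<le> nrm p0 + Q" by linarith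
        qed
        then show ?thesis using separated_finite[OF I(2)] finite_subset by blast
      qed
      have sm: "smooth_at \<A> EU (a b p) x" for b p x
        unfolding a_def
        by (intro smooth_at_add_euclidean is_pre_atlas smooth_at_const
            smooth_at_comp[OF is_pre_atlas is_pre_atlas pre_atlas_euclidean smooth_at_mult[OF is_pre_atlas smooth_at_const smooth_at_G_ident] N(3)])
      have "\<exists>q. (\<forall>x. smooth_at \<A> EU q x) \<and>
          (\<forall>x x' c. (\<forall>p\<in>I. \<bar>a b p x' - a b p x\<bar> \<le> c) \<longrightarrow> \<bar>q x' - q x\<bar> \<le> c) \<and>
          (\<forall>x. \<forall>p\<in>I. q x \<le> a b p x) \<and> (\<forall>x T. (\<forall>p\<in>I. T \<le> a b p x) \<longrightarrow> T - 1 \<le> q x)" if "b \<in> Basis" for b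
      proof -
        have "\<bar>a b p x' - a b p x\<bar> \<le> C * d x x'" for p x x' using N_lip by (simp add: a_def)
        from soft_min[of p0 I "a b" C, OF p0 fin[OF that] sm this]
        show ?thesis by metis
      qed
      then obtain q where q: "\<And>b x. b \<in> Basis \<Longrightarrow> smooth_at \<A> (EU :: (real, real) chart set) (q b) x"
        "\<And>b x x' c. b \<in> Basis \<Longrightarrow> (\<And>p. p \<in> I \<Longrightarrow> \<bar>a b p x' - a b p x\<bar> \<le> c) \<Longrightarrow> \<bar>q b x' - q b x\<bar> \<le> c"
        "\<And>b x p. b \<in> Basis \<Longrightarrow> p \<in> I \<Longrightarrow> q b x \<le> a b p x"
        "\<And>b x T. b \<in> Basis \<Longrightarrow> (\<And>p. p \<in> I \<Longrightarrow> T \<le> a b p x) \<Longrightarrow> T - 1 \<le> q b x"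
        by metis
      define Gq where "Gq x = (\<Sum>b\<in>Basis. q b x *\<^sub>R b)" for x
      have norm_sum: "norm (\<Sum>b\<in>Basis. f b *\<^sub>R (b::'a)) \<le> n * e" if "\<And>b. b \<in> Basis \<Longrightarrow> \<bar>f b\<bar> \<le> e" for f e
      proof -
        have "norm (\<Sum>b\<in>Basis. f b *\<^sub>R (b::'a)) \<le> (\<Sum>b\<in>(Basis::'a set). e)"
          using that by (intro sum_norm_le) simp
        then show ?thesis by (simp add: n_def)
      qed
      have Gq_diff: "norm (Gq x' - Gq x) \<le> n * e"
        if "\<And>p. p \<in> I \<Longrightarrow> \<bar>N (- p + x') - N (- p + x)\<bar> \<le> e" for x x' e
      proof -
        have "Gq x' - Gq x = (\<Sum>b\<in>Basis. (q b x' - q b x) *\<^sub>R b)"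
          by (simp add: Gq_def sum_subtractf scaleR_diff_left)
        moreover have "\<bar>q b x' - q b x\<bar> \<le> e" if "b \<in> Basis" for b
          using that \<open>\<And>p. p \<in> I \<Longrightarrow> _\<close> by (intro q(2)) (auto simp: a_def)
        ultimately show ?thesis using norm_sum by simp
      qed
      have Gq_V: "norm (Gq (x + E X) - Gq x) \<le> 1 / 2 * norm X" if "X \<in> VV" for x X
      proof -
        have "norm (Gq (x + E X) - Gq x) \<le> n * (\<epsilon> * norm X)"
          by (rule Gq_diff) (use N(5)[OF that] in \<open>simp add: add.assoc[symmetric]\<close>)
        then show ?thesis using n by (simp add: \<epsilon>_def)
      qed
      have Gq_d: "norm (Gq x' - Gq x) \<le> n * (C * d x x')" for x x' using N_lip by (intro Gq_diff)
      \<comment> \<open>A fixed point \<open>v\<close> satisfies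
        \<open>h (x + E v) = P (Gq (x + E v))\<close>. The projection is there because
        coordinatewise minima may leave \<open>VV\<close>.\<close>
      define H where "H x v = P (Gq (x + E v)) - h x" for x v
      have P_diff: "P X - P Y = P (X - Y)" for X Y
        using linear_diff[OF bounded_linear.linear[OF P_linear]] by simp
      have H_contr: "norm (H x v' - H x v) \<le> 1 / 2 * norm (v' - v)" for x v v'
      proof -
        have "H x v' - H x v = P (Gq (x + E v') - Gq (x + E v))" by (simp add: H_def P_diff)
        then have "norm (H x v' - H x v) \<le> norm (Gq (x + E v') - Gq (x + E v))" using norm_P_le by simp
        also have "x + E v' = (x + E v) + E (P (v' - v))"
          by (simp add: add.assoc E_add[symmetric])
        also have "norm (Gq ((x + E v) + E (P (v' - v))) - Gq (x + E v)) \<le> 1 / 2 * norm (P (v' - v))"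
          by (rule Gq_V[OF P_VV])
        also have "\<dots> \<le> 1 / 2 * norm (v' - v)" using norm_P_le by simp
        finally show ?thesis .
      qed
      have "\<exists>!v. v \<in> UNIV \<and> H x v = v" for x
        using H_contr by (intro Banach_fix[where c = "1 / 2"]) (auto simp: dist_norm complete_UNIV)
      then obtain F where F: "\<And>x. H x (F x) = F x" and F_uniq: "\<And>x v. H x v = v \<Longrightarrow> v = F x"
        by (metis UNIV_I)
      have F_VV: "F x \<in> VV" for x
      proof -
        have "H x (F x) \<in> VV" unfolding H_def by (intro subspace_diff VV_subspace P_VV h_VV)
        then show ?thesis using F by simp
      qed
      \<comment> \<open>Moving \<open>x\<close> along \<open>V\<close> shifts the parameter only:
        the solution point \<open>x + E (F x)\<close> stays the same.\<close>
      have F_E: "F (x + E X) = F x - X" if "X \<in> VV" for x X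
      proof -
        have "H (x + E X) (F x - X) = H x (F x) - X"
          by (simp add: H_def h_add h_E[OF that] add.assoc E_add[symmetric])
        then show ?thesis using F_uniq[of "x + E X" "F x - X"] F[of x] by simp
      qed
      have H_cont: "isCont (\<lambda>x. H x v) x" for x v
      proof -
        have t: "((\<lambda>z. z + E v) \<longlongrightarrow> x + E v) (at x)" by (intro tendsto_group_add tendsto_ident_at tendsto_const)
        have "((\<lambda>z. n * (C * d (x + E v) (z + E v))) \<longlongrightarrow> 0) (at x)"
          using t unfolding tendsto_iff_d by (intro tendsto_mult_right_zero)
        moreover have "\<forall>\<^sub>F z in at x. norm (Gq (z + E v) - Gq (x + E v)) \<le> n * (C * d (x + E v) (z + E v))"
          using Gq_d by simp
        ultimately have "((\<lambda>z. Gq (z + E v) - Gq (x + E v)) \<longlongrightarrow> 0) (at x)"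
          by (rule Lim_null_comparison[rotated])
        then have "((\<lambda>z. Gq (z + E v)) \<longlongrightarrow> Gq (x + E v)) (at x)" by (rule LIM_zero_cancel)
        then show ?thesis unfolding isCont_def H_def
          by (intro tendsto_diff bounded_linear.tendsto[OF P_linear] tendsto_h tendsto_ident_at)
      qed
      have F_cont: "isCont F x" for x
      proof -
        \<comment> \<open>The factor 2 is 1/(1 - 1/2), as usual for fixed points of a family with
          contraction factor 1/2.\<close>
        have le: "norm (F z - F x) \<le> 2 * norm (H z (F x) - H x (F x))" for z
        proof -
          have "F z - F x = (H z (F z) - H z (F x)) + (H z (F x) - H x (F x))" by (simp add: F)
          then have "norm (F z - F x) \<le> norm (H z (F z) - H z (F x)) + norm (H z (F x) - H x (F x))"
            by (metis norm_triangle_ineq)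
          then show ?thesis using H_contr[of z "F z" "F x"] by linarith
        qed
        have "((\<lambda>z. 2 * norm (H z (F x) - H x (F x))) \<longlongrightarrow> 2 * norm (H x (F x) - H x (F x))) (at x)"
          using H_cont[of x "F x"] unfolding isCont_def by (intro tendsto_intros)
        then have "((\<lambda>z. 2 * norm (H z (F x) - H x (F x))) \<longlongrightarrow> 0) (at x)" by simp
        moreover have "\<forall>\<^sub>F z in at x. norm (F z - F x) \<le> 2 * norm (H z (F x) - H x (F x))"
          using le by simp
        ultimately have "((\<lambda>z. F z - F x) \<longlongrightarrow> 0) (at x)"
          by (rule Lim_null_comparison[rotated])
        then show ?thesis unfolding isCont_def by (rule LIM_zero_cancel)
      qed
      have smGq: "smooth_at \<A> EU Gq x" for x
        unfolding Gq_def
        by (intro smooth_at_sum_euclidean is_pre_atlas finite_Basis smooth_at_linear[OF is_pre_atlas q(1) bounded_linear_scaleR_left])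
      have smF: "smooth_at \<A> EU F x0" for x0
      proof (rule smooth_at_implicit[where Q = UNIV and F = "\<lambda>x v. v - H x v"])
        show "F x - H x (F x) = 0" for x by (simp add: F)
        show "isCont F x" for x by (rule F_cont)
        fix i :: "'a \<times> 'a \<Rightarrow> 'g" and p assume i: "smooth_at EU \<A> i p"
        have 1: "smooth_at EU EU (\<lambda>z. Gq (i z + E (snd z))) p"
          by (rule smooth_at_comp[OF pre_atlas_euclidean is_pre_atlas pre_atlas_euclidean _ smGq])
            (intro smooth_at_mult pre_atlas_euclidean i smooth_at_E smooth_at_EU_snd)
        have 2: "smooth_at EU EU (\<lambda>z. h (i z)) p"
          by (rule smooth_at_comp[OF pre_atlas_euclidean is_pre_atlas pre_atlas_euclidean i smooth_at_h])
        show "smooth_at EU EU (\<lambda>z. snd z - H (i z) (snd z)) p"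
          unfolding H_def
          by (intro smooth_at_diff_euclidean pre_atlas_euclidean smooth_at_EU_snd 2
              smooth_at_linear[OF pre_atlas_euclidean 1 P_linear])
      next
        \<comment> \<open>The identity minus a contraction of factor 1/2 shrinks distances by a
          factor no smaller than 1/2, so its derivative has trivial kernel.\<close>
        fix x D w assume D: "((\<lambda>v. v - H x v) has_derivative D) (at (F x))" "D w = 0"
        show "w = 0"
        proof (rule lower_lipschitz_derivative[OF D(1) _ _ D(2)])
          fix y z
          have "norm (y - z) \<le> norm ((y - H x y) - (z - H x z)) + norm (H x y - H x z)"
            using norm_triangle_ineq[of "(y - H x y) - (z - H x z)" "H x y - H x z"] by (simp add: algebra_simps)
          then show "1 / 2 * norm (y - z) \<le> norm ((y - H x y) - (z - H x z))" using H_contr[of x y z] by linarith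
        qed simp
      qed auto
      \<comment> \<open>The way from \<open>x\<close> to \<open>y\<close> is split into a step
        \<open>pw z\<close> in \<open>W\<close> and a step \<open>E (h z)\<close> along
        \<open>V\<close>. The latter changes \<open>Gq\<close> by at most half of
        \<open>norm (h z)\<close>, which is absorbed on the left.\<close>
      have zero: "norm (h (- x + y)) \<le> 2 * n * C * nrm (pw (- x + y))" if "F x = 0" "F y = 0" for x y
      proof -
        define z where "z = - x + y"
        have hx: "h x = P (Gq x)" "h y = P (Gq y)" using F[of x] F[of y] that by (auto simp: H_def)
        have y: "y = (x + pw z) + E (h z)"
        proof -
          have "y = x + z" by (simp add: z_def add.assoc[symmetric])
          also have "\<dots> = (x + pw z) + E (h z)" by (subst decomp[of z]) (simp only: add.assoc)
          finally show ?thesis .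
        qed
        have "h z = P (Gq y - Gq x)" by (simp add: z_def h_add h_uminus hx P_diff[symmetric])
        then have "norm (h z) \<le> norm (Gq y - Gq x)" using norm_P_le by simp
        also have "\<dots> \<le> norm (Gq y - Gq (x + pw z)) + norm (Gq (x + pw z) - Gq x)"
          using norm_triangle_ineq[of "Gq y - Gq (x + pw z)" "Gq (x + pw z) - Gq x"] by simp
        also have "\<dots> \<le> 1 / 2 * norm (h z) + n * (C * nrm (pw z))"
          using Gq_V[OF h_VV, of "x + pw z" z] Gq_d[of "x + pw z" x] d_translate[of x 0 "pw z"] y
          by (intro add_mono) auto
        finally show ?thesis by (simp add: z_def)
      qed
      have bnd: "norm (F x) \<le> 2 * (n * (Ch + C + 2))" if x: "x \<in> S" for x
      proof -
        \<comment> \<open>From above a net point within distance 1 is used. From below every net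
          point is covered, as \<open>N\<close> grows at least twice as fast as \<open>h\<close>
          varies along \<open>S\<close>; one 1 is lost in the gauge and another in the soft
          minimum.\<close>
        have qb: "\<bar>q b x - h x \<bullet> b\<bar> \<le> Ch + C + 2" if b: "b \<in> Basis" for b
        proof -
          obtain p where p: "p \<in> I" "d p x < 1" using I(3)[OF x] by blast
          have np: "nrm (- p + x) < 1" using p(2) by (simp add: d_nrm[of p])
          have "norm (h (- p + x)) \<le> Ch * 1" using np Ch(1) by (intro order_trans[OF Ch(2)] mult_left_mono) auto
          then have "- (h (- p + x) \<bullet> b) \<le> Ch" using Basis_le_norm[OF b, of "h (- p + x)"] by linarith
          then have "h p \<bullet> b \<le> h x \<bullet> b + Ch" by (simp add: h_add h_uminus inner_diff_left inner_add_left)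
          moreover have "N (- p + x) \<le> C * 1"
          proof -
            have "\<bar>N (0 + (- p + x)) - N 0\<bar> \<le> C * nrm (- p + x)" by (rule N)
            then have "N (- p + x) \<le> C * nrm (- p + x)" using N(4) by simp
            also have "\<dots> \<le> C * 1" using np N(1) by (intro mult_left_mono) auto
            finally show ?thesis .
          qed
          ultimately have up: "q b x \<le> h x \<bullet> b + (Ch + C)" using q(3)[OF b p(1), of x] by (simp add: a_def)
          have "(h x \<bullet> b - 1) - 1 \<le> q b x"
          proof (rule q(4)[OF b])
            fix p assume "p \<in> I"
            then have "norm (h (- p + x)) \<le> l * nrm (pw (- p + x))" using S x I(1) by blast
            then have "N (- p + x) \<ge> 2 * norm (h (- p + x)) - 1" by (rule N)
            moreover have "h (- p + x) \<bullet> b \<le> norm (h (- p + x))" using Basis_le_norm[OF b, of "h (- p + x)"] by linarith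
            then have "h x \<bullet> b - norm (h (- p + x)) \<le> h p \<bullet> b" by (simp add: h_add h_uminus inner_diff_left inner_add_left)
            ultimately show "h x \<bullet> b - 1 \<le> a b p x" using norm_ge_zero[of "h (- p + x)"] unfolding a_def by linarith
          qed
          then show ?thesis using up N(1) Ch(1) by (simp add: abs_le_iff)
        qed
        have "Gq x - h x = (\<Sum>b\<in>Basis. (q b x - h x \<bullet> b) *\<^sub>R b)"
          by (simp add: Gq_def scaleR_diff_left sum_subtractf euclidean_representation)
        then have 1: "norm (Gq x - h x) \<le> n * (Ch + C + 2)" using norm_sum[OF qb] by simp
        have "H x 0 = P (Gq x - h x)" by (simp add: H_def P_diff[symmetric])
        then have "norm (H x 0) \<le> n * (Ch + C + 2)" using order_trans[OF norm_P_le 1] by simp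
        moreover have "norm (F x) \<le> norm (H x (F x) - H x 0) + norm (H x 0)"
          using norm_triangle_ineq[of "H x (F x) - H x 0" "H x 0"] by (simp add: F)
        ultimately show ?thesis using H_contr[of x "F x" 0] by simp
      qed
      have "slope_bounded (2 * n * C) {x. F x = 0}" unfolding slope_bounded_def using zero by blast
      then show ?thesis using smF F_VV F_E bnd by blast
    qed
  qed
qed

section \<open>Cones and slope bounds\<close>

lemma proj_fst_eq: "proj_fst W V x = pw x"
  unfolding proj_fst_def
proof (rule the_equality)
  show "pw x \<in> W \<and> (\<exists>v\<in>V. x = pw x + v)" using pw_W E_V decomp by blast
  fix w assume w: "w \<in> W \<and> (\<exists>v\<in>V. x = w + v)"
  then obtain X where "X \<in> VV" "x = w + E X" using E_surj by metis
  then show "w = pw x" using pw_decomp w by simp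
qed

lemma proj_snd_eq: "proj_snd W V x = E (h x)"
  unfolding proj_snd_def
proof (rule the_equality)
  show "E (h x) \<in> V \<and> (\<exists>w\<in>W. x = w + E (h x))" using pw_W E_V decomp by blast
  fix v assume v: "v \<in> V \<and> (\<exists>w\<in>W. x = w + v)"
  then obtain w X where "w \<in> W" "X \<in> VV" "x = w + E X" "E X = v" using E_surj by metis
  then show "v = E (h x)" using h_decomp by metis
qed

lemma cone_condition_iff:
  "cone_condition W V d A \<phi> \<alpha> \<longleftrightarrow> (\<forall>x\<in>intrinsic_graph A \<phi>. \<forall>y\<in>intrinsic_graph A \<phi>.
     nrm (pw (- x + y)) \<le> \<alpha> * nrm (E (h (- x + y))) \<longrightarrow> x = y)"
proof -
  have im: "y \<in> (\<lambda>y. x + y) ` intrinsic_cone W V d \<alpha> \<longleftrightarrow> nrm (pw (- x + y)) \<le> \<alpha> * nrm (E (h (- x + y)))" for x y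
  proof -
    have "y \<in> (\<lambda>y. x + y) ` intrinsic_cone W V d \<alpha> \<longleftrightarrow> - x + y \<in> intrinsic_cone W V d \<alpha>"
      by (force simp: image_iff add.assoc[symmetric] intro: bexI[of _ "- x + y"])
    then show ?thesis by (simp add: intrinsic_cone_def proj_fst_eq proj_snd_eq)
  qed
  have pw0: "pw 0 = 0" by (simp add: pw_def)
  have self: "nrm (pw (- x + x)) \<le> \<alpha> * nrm (E (h (- x + x)))" for x by (simp add: pw0)
  show ?thesis
    unfolding cone_condition_def set_eq_iff Int_iff im singleton_iff
    by (intro ball_cong refl) (use self in metis)
qed

text \<open>Outside the cone the \<open>W\<close>-part exceeds \<alpha> times the
  \<open>V\<close>-part, and \<open>c\<close> converts the distance on \<open>V\<close> into the
  norm of \<open>h\<close>.\<close>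

lemma slope_bounded_graph:
  assumes "cone_condition W V d A \<phi> \<alpha>" "\<alpha> > 0" and c: "c > 0" "\<And>X. X \<in> VV \<Longrightarrow> c * norm X \<le> nrm (E X)"
    and l: "1 / \<alpha> \<le> l"
  shows "slope_bounded (l / c) (intrinsic_graph A \<phi>)"
  unfolding slope_bounded_def
proof (intro ballI)
  fix x y assume xy: "x \<in> intrinsic_graph A \<phi>" "y \<in> intrinsic_graph A \<phi>"
  have "norm (h (- x + y)) \<le> 1 / \<alpha> / c * nrm (pw (- x + y))"
  proof (cases "x = y")
  case False
  then have "\<not> nrm (pw (- x + y)) \<le> \<alpha> * nrm (E (h (- x + y)))"
    using assms(1) xy unfolding cone_condition_iff by blast
  then have "\<alpha> * nrm (E (h (- x + y))) \<le> nrm (pw (- x + y))" by simp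
  then have "\<alpha> * (c * norm (h (- x + y))) \<le> nrm (pw (- x + y))"
    using c(2)[OF h_VV, of "- x + y"] assms(2) by (meson mult_left_mono order_trans less_imp_le)
  then show ?thesis using assms(2) c(1) by (simp add: field_simps)
  qed (use assms(2) c(1) in simp)
  also have "\<dots> \<le> l / c * nrm (pw (- x + y))"
    using l c(1) by (intro mult_right_mono divide_right_mono) auto
  finally show "norm (h (- x + y)) \<le> l / c * nrm (pw (- x + y))" .
qed

text \<open>The cone is closed, so some slack is required: with the factor 2 a point of the cone
  satisfies \<open>nrm (pw z) \<le> nrm (pw z) / 2\<close> and must be the vertex.\<close>

lemma cone_condition_if_slope_bounded:
  assumes sb: "slope_bounded L (intrinsic_graph A \<phi>)"
    and L: "L > 0" and CE: "CE > 0" "\<And>X. nrm (E X) \<le> CE * norm X"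
  shows "cone_condition W V d A \<phi> (1 / (2 * CE * L))"
  unfolding cone_condition_iff
proof (intro ballI impI)
  note bnd = slope_boundedD[OF sb]
  fix x y assume x: "x \<in> intrinsic_graph A \<phi>" and y: "y \<in> intrinsic_graph A \<phi>"
  define z where "z = - x + y"
  assume "nrm (pw (- x + y)) \<le> 1 / (2 * CE * L) * nrm (E (h (- x + y)))"
  then have "nrm (pw z) \<le> 1 / (2 * CE * L) * nrm (E (h z))" by (simp add: z_def)
  also have "\<dots> \<le> 1 / (2 * CE * L) * (CE * norm (h z))" using CE L by (intro mult_left_mono) auto
  also have "\<dots> \<le> 1 / (2 * CE * L) * (CE * (L * nrm (pw z)))"
    using CE(1) L bnd[OF x y] by (intro mult_left_mono) (auto simp: z_def)
  also have "\<dots> = nrm (pw z) / 2" using CE(1) L by simp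
  finally have "nrm (pw z) = 0" using nrm_nonneg[of "pw z"] by linarith
  then have pz: "pw z = 0" by simp
  have "norm (h z) \<le> L * nrm (pw z)" using bnd[OF x y] by (simp add: z_def)
  then have "h z = 0" by (simp add: pz)
  then have "z = 0" using decomp[of z] pz by simp
  then show "x = y" unfolding z_def by (metis add.right_neutral add.right_inverse add.assoc add_0_left)
qed

section \<open>Rescaling and the uniform constant\<close>

definition smoothly_approximable :: "real \<Rightarrow> 'g set \<Rightarrow> ('g \<Rightarrow> 'g) \<Rightarrow> bool" where
  "smoothly_approximable L A \<phi> \<longleftrightarrow> (\<exists>\<Phi> :: nat \<Rightarrow> 'g \<Rightarrow> 'g.
     (\<forall>i x. smooth_at \<A> \<A> (\<Phi> i) x) \<and> (\<forall>i x. \<Phi> i x \<in> V) \<and>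
     (\<forall>\<epsilon>>0. \<exists>N. \<forall>i\<ge>N. \<forall>w\<in>A. d (\<Phi> i w) (\<phi> w) < \<epsilon>) \<and>
     (\<forall>i. slope_bounded L (intrinsic_graph W (\<Phi> i))))"

lemma smoothing:
  assumes l: "l > 0"
  shows "\<exists>L>0. \<forall>A \<phi>. A \<subseteq> W \<longrightarrow> \<phi> ` A \<subseteq> V \<longrightarrow> slope_bounded l (intrinsic_graph A \<phi>) \<longrightarrow>
    smoothly_approximable L A \<phi>"
proof -
  obtain c0 CE where CE: "CE > 0" "\<And>X. nrm (E X) \<le> CE * norm X" using E_bounds by metis
  obtain L K where LK: "L > 0" "K > 0"
    "\<And>S. slope_bounded l S \<Longrightarrow>
      \<exists>F. (\<forall>x. smooth_at \<A> EU F x) \<and> (\<forall>x. F x \<in> VV) \<and> (\<forall>x. \<forall>X\<in>VV. F (x + E X) = F x - X) \<and>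
        slope_bounded L {x. F x = 0} \<and> (\<forall>x\<in>S. norm (F x) \<le> K)"
    using coarse_extension[OF l] by blast
  show ?thesis
  proof (rule exI[of _ L], intro conjI LK(1) allI impI)
    fix A \<phi> assume A: "A \<subseteq> W" "\<phi> ` A \<subseteq> V" and bnd: "slope_bounded l (intrinsic_graph A \<phi>)"
    define r where "r i = real (Suc i)" for i
    have r: "r i > 0" for i by (simp add: r_def)
    have \<delta>z: "- \<delta> (r i) x + \<delta> (r i) y = \<delta> (r i) (- x + y)" for i x y
      using r[of i] by (simp add: delta_add delta_uminus)
    \<comment> \<open>Both sides are homogeneous of degree 1 under dilations, so slope bounds
      survive rescaling with the same constant.\<close>
    have scale: "norm (h (\<delta> (r i) z)) \<le> M * nrm (pw (\<delta> (r i) z)) \<longleftrightarrow> norm (h z) \<le> M * nrm (pw z)" for i z M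
      using r[of i] mult_le_cancel_left_pos[OF r[of i], of "norm (h z)" "M * nrm (pw z)"]
      by (simp add: h_delta pw_delta nrm_delta mult.left_commute)
    have "\<exists>F. (\<forall>x. smooth_at \<A> EU F x) \<and> (\<forall>x. F x \<in> VV) \<and> (\<forall>x. \<forall>X\<in>VV. F (x + E X) = F x - X) \<and>
        slope_bounded L {x. F x = 0} \<and> (\<forall>x\<in>\<delta> (r i) ` intrinsic_graph A \<phi>. norm (F x) \<le> K)" for i
      by (rule LK(3)) (use bnd in \<open>auto simp: slope_bounded_def \<delta>z scale\<close>)
    then obtain F where F': "\<And>i. (\<forall>x. smooth_at \<A> EU (F i) x) \<and> (\<forall>x. F i x \<in> VV) \<and>
        (\<forall>x. \<forall>X\<in>VV. F i (x + E X) = F i x - X) \<and>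
        slope_bounded L {x. F i x = 0} \<and> (\<forall>x\<in>\<delta> (r i) ` intrinsic_graph A \<phi>. norm (F i x) \<le> K)"
      by metis
    then have F: "\<And>i x. smooth_at \<A> EU (F i) x" "\<And>i x. F i x \<in> VV"
      "\<And>i x X. X \<in> VV \<Longrightarrow> F i (x + E X) = F i x - X" "\<And>i. slope_bounded L {x. F i x = 0}"
      "\<And>i x. x \<in> intrinsic_graph A \<phi> \<Longrightarrow> norm (F i (\<delta> (r i) x)) \<le> K"
      by blast+
    \<comment> \<open>Over the dilated \<open>w\<close>, the zero of \<open>F i\<close> is
      \<open>\<delta> (r i) w + E (F i (\<delta> (r i) w))\<close>; its \<open>V\<close>-component
      is scaled back.\<close>
    define \<Phi> where "\<Phi> i w = E ((1 / r i) *\<^sub>R F i (\<delta> (r i) w))" for i w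
    have sm: "smooth_at \<A> \<A> (\<Phi> i) x" for i x
      unfolding \<Phi>_def
      by (intro smooth_at_E is_pre_atlas smooth_at_linear[OF is_pre_atlas _ bounded_linear_scaleR_right]
          smooth_at_comp[OF is_pre_atlas is_pre_atlas pre_atlas_euclidean smooth_at_delta[OF r is_pre_atlas smooth_at_G_ident] F(1)])
    have zero: "F i (\<delta> (r i) x) = 0" if "x \<in> intrinsic_graph W (\<Phi> i)" for i x
    proof -
      obtain w where w: "x = w + \<Phi> i w" using \<open>x \<in> _\<close> unfolding intrinsic_graph_def by blast
      have "\<delta> (r i) x = \<delta> (r i) w + E (F i (\<delta> (r i) w))"
        using r[of i] by (simp add: w \<Phi>_def delta_add E_delta)
      then show ?thesis using F(3)[OF F(2)] by simp
    qed
    have lip: "slope_bounded L (intrinsic_graph W (\<Phi> i))" for i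
      unfolding slope_bounded_def
    proof (intro ballI)
      fix x y assume "x \<in> intrinsic_graph W (\<Phi> i)" "y \<in> intrinsic_graph W (\<Phi> i)"
      then show "norm (h (- x + y)) \<le> L * nrm (pw (- x + y))"
        using slope_boundedD[OF F(4)[of i], of "\<delta> (r i) x" "\<delta> (r i) y"] zero by (simp add: \<delta>z scale)
    qed
    \<comment> \<open>By equivariance along \<open>V\<close>, the value of \<open>F i\<close> at a
      dilated graph point is the offset between the dilated graphs. It is bounded by
      \<open>K\<close>, and scaling back divides it by \<open>r i\<close>.\<close>
    have dist: "d (\<Phi> i w) (\<phi> w) \<le> CE * K / r i" if w: "w \<in> A" for i w
    proof -
      define x where "x = w + \<phi> w"
      have x: "x \<in> intrinsic_graph A \<phi>" using w unfolding x_def intrinsic_graph_def by blast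
      obtain X where X: "X \<in> VV" "E X = \<phi> w" using E_surj A(2) w by blast
      define Y where "Y = F i (\<delta> (r i) x)"
      have "\<delta> (r i) x = \<delta> (r i) w + E (r i *\<^sub>R X)"
        using r[of i] by (simp add: x_def X(2)[symmetric] delta_add E_delta)
      then have "Y = F i (\<delta> (r i) w) - r i *\<^sub>R X"
        using F(3)[OF subspace_scale[OF VV_subspace X(1)]] by (simp add: Y_def)
      then have "F i (\<delta> (r i) w) = r i *\<^sub>R X + Y" by simp
      then have "(1 / r i) *\<^sub>R F i (\<delta> (r i) w) = X + (1 / r i) *\<^sub>R Y"
        using r[of i] by (simp add: scaleR_add_right)
      then have "\<Phi> i w = \<phi> w + E ((1 / r i) *\<^sub>R Y)" by (simp add: \<Phi>_def E_add X(2))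
      then have "d (\<Phi> i w) (\<phi> w) = nrm (E ((1 / r i) *\<^sub>R Y))"
        using d_translate[of "\<phi> w" "E ((1 / r i) *\<^sub>R Y)" 0] by (simp add: dm.commute)
      also have "\<dots> \<le> CE * norm ((1 / r i) *\<^sub>R Y)" by (rule CE)
      also have "\<dots> = CE * norm Y / r i" using r[of i] by simp
      also have "\<dots> \<le> CE * K / r i"
        using F(5)[OF x, of i] CE(1) r[of i] by (intro divide_right_mono mult_left_mono) (auto simp: Y_def)
      finally show ?thesis .
    qed
    have unif: "\<exists>N. \<forall>i\<ge>N. \<forall>w\<in>A. d (\<Phi> i w) (\<phi> w) < \<epsilon>" if \<epsilon>: "\<epsilon> > 0" for \<epsilon>
    proof -
      obtain N :: nat where N: "CE * K / \<epsilon> < N" using reals_Archimedean2 by blast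
      have "d (\<Phi> i w) (\<phi> w) < \<epsilon>" if "i \<ge> N" "w \<in> A" for i w
      proof -
        have "CE * K / \<epsilon> < r i" using N that(1) by (simp add: r_def)
        then have "CE * K / r i < \<epsilon>" using r[of i] \<epsilon> by (simp add: field_simps)
        then show ?thesis using dist[OF that(2), of i] by linarith
      qed
      then show ?thesis by blast
    qed
    show "smoothly_approximable L A \<phi>"
      unfolding smoothly_approximable_def
    proof (intro exI[of _ \<Phi>] conjI allI impI)
      show "\<Phi> i x \<in> V" for i x by (simp add: \<Phi>_def E_V)
    qed (fact sm unif lip)+
  qed
qed

lemma smooth_approximation:
  "\<exists>u :: real \<Rightarrow> real. (\<forall>l\<ge>0. u l \<ge> 0) \<and>
    (\<forall>A \<phi>. A \<subseteq> W \<and> \<phi> ` A \<subseteq> V \<and> intrinsic_lipschitz W V d A \<phi> \<longrightarrow>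
      (\<exists>\<Phi> :: nat \<Rightarrow> 'g \<Rightarrow> 'g.
        (\<forall>i. \<Phi> i ` W \<subseteq> V \<and> smooth_map_on_submanifold \<A> \<A> W (\<Phi> i) \<and>
             intrinsic_lipschitz W V d W (\<Phi> i)) \<and>
        (\<forall>\<epsilon>>0. \<exists>N. \<forall>i\<ge>N. \<forall>w\<in>A. d (\<Phi> i w) (\<phi> w) < \<epsilon>) \<and>
        (\<forall>l\<ge>0. intrinsic_lipschitz_const W V d A \<phi> \<le> l \<longrightarrow>
           (\<forall>i. intrinsic_lipschitz_const W V d W (\<Phi> i) \<le> u l))))"
proof -
  obtain c CE where c: "c > 0" "CE > 0" "\<And>X. X \<in> VV \<Longrightarrow> c * norm X \<le> nrm (E X)" "\<And>X. nrm (E X) \<le> CE * norm X"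
    using E_bounds by blast
  \<comment> \<open>One constant is fixed for every integer slope, before any \<open>A\<close> or
    \<phi> is given.\<close>
  have "\<forall>M. \<exists>L>0. \<forall>A \<phi>. A \<subseteq> W \<longrightarrow> \<phi> ` A \<subseteq> V \<longrightarrow> slope_bounded (real (Suc M) / c) (intrinsic_graph A \<phi>) \<longrightarrow>
      smoothly_approximable L A \<phi>"
    using c(1) by (intro allI smoothing) simp
  from choice[OF this] obtain L where L': "\<forall>M. L M > 0 \<and> (\<forall>A \<phi>. A \<subseteq> W \<longrightarrow> \<phi> ` A \<subseteq> V \<longrightarrow>
      slope_bounded (real (Suc M) / c) (intrinsic_graph A \<phi>) \<longrightarrow> smoothly_approximable (L M) A \<phi>)" ..
  then have L: "L M > 0" for M by simp
  have approx: "smoothly_approximable (L M) A \<phi>"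
    if "A \<subseteq> W" "\<phi> ` A \<subseteq> V" "slope_bounded (real (Suc M) / c) (intrinsic_graph A \<phi>)" for M A \<phi>
    using L' that by simp
  \<comment> \<open>The sum over all integers up to the ceiling dominates each \<open>L M\<close>,
    whether or not \<open>L\<close> is monotone.\<close>
  define u :: "real \<Rightarrow> real" where "u l = (\<Sum>M\<le>nat \<lceil>l + 1\<rceil>. 2 * CE * L M)" for l
  have pos: "2 * CE * L M > 0" for M using c(2) L by simp
  have u_ge: "2 * CE * L M \<le> u l" if "M \<le> nat \<lceil>l + 1\<rceil>" for M l
    unfolding u_def by (rule member_le_sum) (use that pos in \<open>auto intro: less_imp_le\<close>)
  have "\<exists>\<Phi> :: nat \<Rightarrow> 'g \<Rightarrow> 'g.
        (\<forall>i. \<Phi> i ` W \<subseteq> V \<and> smooth_map_on_submanifold \<A> \<A> W (\<Phi> i) \<and>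
             intrinsic_lipschitz W V d W (\<Phi> i)) \<and>
        (\<forall>\<epsilon>>0. \<exists>N. \<forall>i\<ge>N. \<forall>w\<in>A. d (\<Phi> i w) (\<phi> w) < \<epsilon>) \<and>
        (\<forall>l\<ge>0. intrinsic_lipschitz_const W V d A \<phi> \<le> l \<longrightarrow>
           (\<forall>i. intrinsic_lipschitz_const W V d W (\<Phi> i) \<le> u l))"
    if A: "A \<subseteq> W" "\<phi> ` A \<subseteq> V" and lip: "intrinsic_lipschitz W V d A \<phi>" for A \<phi>
  proof -
    define l0 where "l0 = intrinsic_lipschitz_const W V d A \<phi>"
    \<comment> \<open>\<open>M\<close> is computed from the constant \<open>l0\<close> of \<phi>
      alone, because the same sequence has to serve every bound \<open>l\<close>. The infimum may
      fail to be attained, hence the added 1.\<close>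
    define M where "M = nat \<lceil>l0 + 1\<rceil>"
    have "{1 / \<alpha> | \<alpha>. 0 < \<alpha> \<and> cone_condition W V d A \<phi> \<alpha>} \<noteq> {}"
      using lip by (auto simp: intrinsic_lipschitz_def)
    then obtain \<alpha> where \<alpha>: "\<alpha> > 0" "cone_condition W V d A \<phi> \<alpha>" "1 / \<alpha> < l0 + 1"
      using cInf_lessD[of "{1 / \<alpha> | \<alpha>. 0 < \<alpha> \<and> cone_condition W V d A \<phi> \<alpha>}" "l0 + 1"]
      unfolding l0_def intrinsic_lipschitz_const_def by auto
    have "l0 + 1 \<le> real M" unfolding M_def by (rule real_nat_ceiling_ge)
    then have M: "1 / \<alpha> \<le> real (Suc M)" using \<alpha>(3) by simp
    have "slope_bounded (real (Suc M) / c) (intrinsic_graph A \<phi>)"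
      by (rule slope_bounded_graph[OF \<alpha>(2,1) c(1,3) M])
    from approx[OF A this, unfolded smoothly_approximable_def] obtain \<Phi> :: "nat \<Rightarrow> 'g \<Rightarrow> 'g" where \<Phi>: "\<And>i x. smooth_at \<A> \<A> (\<Phi> i) x" "\<And>i x. \<Phi> i x \<in> V"
      "\<forall>\<epsilon>>0. \<exists>N. \<forall>i\<ge>N. \<forall>w\<in>A. d (\<Phi> i w) (\<phi> w) < \<epsilon>" "\<And>i. slope_bounded (L M) (intrinsic_graph W (\<Phi> i))"
      by blast
    have cone: "cone_condition W V d W (\<Phi> i) (1 / (2 * CE * L M))" for i
      by (rule cone_condition_if_slope_bounded[OF \<Phi>(4) L c(2,4)])
    have \<alpha>': "1 / (2 * CE * L M) > 0" using pos[of M] by simp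
    have "intrinsic_lipschitz_const W V d W (\<Phi> i) \<le> 1 / (1 / (2 * CE * L M))" for i
      unfolding intrinsic_lipschitz_const_def
    proof (rule cInf_lower)
      show "bdd_below {1 / \<alpha> | \<alpha>. 0 < \<alpha> \<and> cone_condition W V d W (\<Phi> i) \<alpha>}"
        by (rule bdd_belowI[of _ 0]) auto
    qed (use cone \<alpha>' in blast)
    then have const: "intrinsic_lipschitz_const W V d W (\<Phi> i) \<le> 2 * CE * L M" for i by simp
    have "smooth_map_on_submanifold \<A> \<A> W (\<Phi> i)" for i
      unfolding smooth_map_on_submanifold_def
      by (intro ballI exI[of _ UNIV] exI[of _ "\<Phi> i"]) (auto intro: smooth_map_onI_smooth_at is_pre_atlas \<Phi>(1))
    moreover have "intrinsic_lipschitz_const W V d W (\<Phi> i) \<le> u l"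
      if "intrinsic_lipschitz_const W V d A \<phi> \<le> l" for i l
    proof -
      have "M \<le> nat \<lceil>l + 1\<rceil>" unfolding M_def using that by (intro nat_mono ceiling_mono) (simp add: l0_def)
      then show ?thesis using const u_ge order_trans by blast
    qed
    moreover have "intrinsic_lipschitz W V d W (\<Phi> i)" for i
      unfolding intrinsic_lipschitz_def using cone \<alpha>' by blast
    ultimately show ?thesis using \<Phi>(2,3) by (intro exI[of _ \<Phi>]) auto
  qed
  note main = this
  have u0: "u l \<ge> 0" for l unfolding u_def using pos by (intro sum_nonneg less_imp_le) auto
  show ?thesis
    by (intro exI[of _ u] conjI allI impI; (elim conjE)?) (rule u0, erule (2) main)
qed

end

theorem theorem1p6:
  fixes \<A> :: "('g::{group_add, t2_space, second_countable_topology}, 'a::euclidean_space) chart set"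
    and e :: "('g, 'a) chart"
    and s :: nat
    and g :: "nat \<Rightarrow> 'a set"
    and \<delta> :: "real \<Rightarrow> 'g \<Rightarrow> 'g"
    and d :: "'g \<Rightarrow> 'g \<Rightarrow> real"
    and W V :: "'g set"
  assumes "carnot_group \<A> e s g \<delta>"
    and "homogeneous_distance \<delta> d"
    and "homogeneous_subgroup \<A> \<delta> W"
    and "homogeneous_subgroup \<A> \<delta> V"
    and "complementary W V"
    and "V \<noteq> {0}"
    and "horizontal \<A> e g V"
  shows "\<exists>u :: real \<Rightarrow> real. (\<forall>l\<ge>0. u l \<ge> 0) \<and>
    (\<forall>A \<phi>. A \<subseteq> W \<and> \<phi> ` A \<subseteq> V \<and> intrinsic_lipschitz W V d A \<phi> \<longrightarrow>
      (\<exists>\<Phi> :: nat \<Rightarrow> 'g \<Rightarrow> 'g.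
        (\<forall>i. \<Phi> i ` W \<subseteq> V \<and> smooth_map_on_submanifold \<A> \<A> W (\<Phi> i) \<and>
             intrinsic_lipschitz W V d W (\<Phi> i)) \<and>
        (\<forall>\<epsilon>>0. \<exists>N. \<forall>i\<ge>N. \<forall>w\<in>A. d (\<Phi> i w) (\<phi> w) < \<epsilon>) \<and>
        (\<forall>l\<ge>0. intrinsic_lipschitz_const W V d A \<phi> \<le> l \<longrightarrow>
           (\<forall>i. intrinsic_lipschitz_const W V d W (\<Phi> i) \<le> u l))))"
proof -
  interpret carnot_splitting \<A> e s g \<delta> d W V
    by unfold_locales (fact assms)+
  show ?thesis by (rule smooth_approximation)
qed

end
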